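(* Let $T_a\in\mathcal U$, $a\in[0,\delta]$, $\delta>0$, be a one-parameter family of mixing piecewise expanding unimodal maps through a map $T\in\mathcal U$ (as defined in the context), and let $$\Lambda_0=\frac{\sup_{x\in[T(1),1]}\left|\partial_aT_a(x)|_{a=0}\right|}{\lambda-1}.$$ If there exists $j_0\ge3$ such that $|D_aT_a^{j_0}(0)|_{a=0}|>\Lambda_0$, then there exists $0<\varepsilon\le\delta$ such that $0$ is typical for $\mu_a$ for almost every $a\in[0,\varepsilon]$, where $\mu_a$ is the unique absolutely continuous invariant probability measure of $T_a$.
   Context: $C^{1,1}(L)$ means $C^1$ with derivative Lipschitz with constant at most $L$; $\mathrm{Lip}(L)$ means Lipschitz with constant at most $L$. Fix real numbers $K>0$ and $L>0$. $\mathcal U$ is the set of piecewise expanding unimodal maps, i.e. continuous maps $T:[-K,1]\to\mathbb R$ such that $T$ is $C^{1,1}(L)$ on $[-K,0]$ and on $[0,1]$; $\inf_{x\in[-K,0]}T'(x)>1$ and $\sup_{x\in[0,1]}T'(x)<-1$ (one-sided derivatives at $0$); $T(0)=1$, $T(1)>-K$ and $T^2(1)\ge T(1)$. The interval $[T(1),1]$ is forward invariant and $T$ has a unique absolutely continuous invariant probability measure. $T\in\mathcal U$ is mixing if it is topologically mixing on $[T(1),1]$. A one-parameter family through $T\in\mathcal U$ is a family $T_a\in\mathcal U$, $a\in[0,\delta]$, $\delta>0$, with $T_0=T$ such that for all $x\in[-K,1]$ the map $a\mapsto T_a(x)$ is $C^1([0,\delta])$ and the maps $a\mapsto T_a(x)$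 and $a\mapsto\partial_xT_a(x)$ are $\mathrm{Lip}(L)$ on $[0,\delta]$. The family is mixing if every $T_a$ is mixing. The number $\lambda>1$ is a fixed uniform lower bound for the expansion: $|\partial_xT_a(x)|\ge\lambda$ for all $a\in[0,\delta]$ and all $x$ (one-sided derivatives at $x=0$). Derivatives with respect to $a$ at $a=0$ are one-sided (from the right). A point $x$ is typical for $\mu_a$ if $\frac1n\sum_{i=0}^{n-1}\delta_{T_a^i(x)}\to\mu_a$ weak-$*$ as $n\to\infty$. *)

theory Defs
  imports "HOL-Analysis.Analysis" "HOL-Probability.Probability"
begin

text \<open>Maps on the interval $[-K,1]$ are represented by total functions of type
  \<^typ>\<open>real \<Rightarrow> real\<close>; only their values on that interval are constrained.\<close>

text \<open>At an endpoint of an interval \<open>S\<close> this is the one-sided derivative. In particular the two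
  one-sided derivatives of a map \<open>f\<close> at 0 are \<open>deriv_within {-K..0} f 0\<close> and
  \<open>deriv_within {0..1} f 0\<close>.\<close>

abbreviation deriv_within :: "real set \<Rightarrow> (real \<Rightarrow> real) \<Rightarrow> real \<Rightarrow> real" where
  "deriv_within S f x \<equiv> vector_derivative f (at x within S)"

definition C1_on :: "real set \<Rightarrow> (real \<Rightarrow> real) \<Rightarrow> bool" where
  "C1_on S f \<longleftrightarrow> f differentiable_on S \<and> continuous_on S (deriv_within S f)"

definition C11_on :: "real \<Rightarrow> real set \<Rightarrow> (real \<Rightarrow> real) \<Rightarrow> bool" where
  "C11_on L S f \<longleftrightarrow> C1_on S f \<and> L-lipschitz_on S (deriv_within S f)"

definition unimodal_maps :: "real \<Rightarrow> real \<Rightarrow> (real \<Rightarrow> real) set" where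
  "unimodal_maps K L = {T.
     continuous_on {-K..1} T \<and>
     C11_on L {-K..0} T \<and> C11_on L {0..1} T \<and>
     (INF x\<in>{-K..0}. deriv_within {-K..0} T x) > 1 \<and>
     (SUP x\<in>{0..1}. deriv_within {0..1} T x) < -1 \<and>
     T 0 = 1 \<and> T 1 > -K \<and> T (T 1) \<ge> T 1}"

definition topologically_mixing_on :: "'a::topological_space set \<Rightarrow> ('a \<Rightarrow> 'a) \<Rightarrow> bool" where
  "topologically_mixing_on X T \<longleftrightarrow>
     (\<forall>U V. openin (top_of_set X) U \<and> U \<noteq> {} \<and> openin (top_of_set X) V \<and> V \<noteq> {} \<longrightarrow>
        (\<exists>N. \<forall>n\<ge>N. (T ^^ n) ` U \<inter> V \<noteq> {}))"

definition one_parameter_family ::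
  "real \<Rightarrow> real \<Rightarrow> real \<Rightarrow> (real \<Rightarrow> real) \<Rightarrow> (real \<Rightarrow> real \<Rightarrow> real) \<Rightarrow> bool" where
  "one_parameter_family K L \<delta> T Ta \<longleftrightarrow>
     \<delta> > 0 \<and>
     (\<forall>a\<in>{0..\<delta>}. Ta a \<in> unimodal_maps K L) \<and>
     (\<forall>x\<in>{-K..1}. Ta 0 x = T x) \<and>
     (\<forall>x\<in>{-K..1}. C1_on {0..\<delta>} (\<lambda>a. Ta a x)) \<and>
     (\<forall>x\<in>{-K..1}. L-lipschitz_on {0..\<delta>} (\<lambda>a. Ta a x)) \<and>
     (\<forall>x\<in>{-K..0}. L-lipschitz_on {0..\<delta>} (\<lambda>a. deriv_within {-K..0} (Ta a) x)) \<and>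
     (\<forall>x\<in>{0..1}. L-lipschitz_on {0..\<delta>} (\<lambda>a. deriv_within {0..1} (Ta a) x))"

definition mixing_family :: "real \<Rightarrow> (real \<Rightarrow> real \<Rightarrow> real) \<Rightarrow> bool" where
  "mixing_family \<delta> Ta \<longleftrightarrow> (\<forall>a\<in>{0..\<delta>}. topologically_mixing_on {Ta a 1..1} (Ta a))"

definition expansion_bound :: "real \<Rightarrow> real \<Rightarrow> (real \<Rightarrow> real \<Rightarrow> real) \<Rightarrow> real \<Rightarrow> bool" where
  "expansion_bound K \<delta> Ta l \<longleftrightarrow>
     (\<forall>a\<in>{0..\<delta>}. (\<forall>x\<in>{-K..0}. \<bar>deriv_within {-K..0} (Ta a) x\<bar> \<ge> l) \<and>
                  (\<forall>x\<in>{0..1}. \<bar>deriv_within {0..1} (Ta a) x\<bar> \<ge> l))"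

text \<open>Invariant measures live on the forward invariant interval $[T(1),1]$. They are Borel measures
  on the real line giving that interval full mass. Preimages are intersected with the interval
  because \<open>T\<close> is arbitrary outside $[-K,1]$.\<close>

definition is_acip :: "(real \<Rightarrow> real) \<Rightarrow> real measure \<Rightarrow> bool" where
  "is_acip T \<mu> \<longleftrightarrow>
     prob_space \<mu> \<and> sets \<mu> = sets borel \<and> emeasure \<mu> {T 1..1} = 1 \<and>
     absolutely_continuous lborel \<mu> \<and>
     (\<forall>A\<in>sets borel. emeasure \<mu> (T -` A \<inter> {T 1..1}) = emeasure \<mu> A)"

definition acip :: "(real \<Rightarrow> real) \<Rightarrow> real measure" where
  "acip T = (THE \<mu>. is_acip T \<mu>)"

text \<open>The measure $\frac1n\sum_{i<n}\delta_{T^i(x)}$, for $n \ge 1$.\<close>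

definition empirical_measure :: "('a::topological_space \<Rightarrow> 'a) \<Rightarrow> 'a \<Rightarrow> nat \<Rightarrow> 'a measure" where
  "empirical_measure T x n = distr (uniform_count_measure {..<n}) borel (\<lambda>i. (T ^^ i) x)"

lemma integral_empirical_measure:
  fixes f :: "'a::topological_space \<Rightarrow> real"
  assumes "continuous_on UNIV f" "n > 0"
  shows "(\<integral>y. f y \<partial>empirical_measure T x n) = (\<Sum>i<n. f ((T ^^ i) x)) / real n"
proof -
  have f: "f \<in> borel_measurable borel"
    using assms(1) by (rule borel_measurable_continuous_onI)
  have "(\<integral>y. f y \<partial>empirical_measure T x n)
      = (\<integral>i. f ((T ^^ i) x) \<partial>uniform_count_measure {..<n})"
    unfolding empirical_measure_def
    by (rule integral_distr[OF _ f])
      (simp add: measurable_def space_uniform_count_measure sets_uniform_count_measure)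
  also have "\<dots> = (\<Sum>i<n. f ((T ^^ i) x)) / real n"
    by (simp add: uniform_count_measure_def lebesgue_integral_point_measure_finite
        sum_divide_distrib)
  finally show ?thesis .
qed

text \<open>Weak-* convergence, with bounded continuous test functions on the whole space. For measures
  carried by a fixed compact interval these have the same restrictions to it as arbitrary continuous
  functions on the interval.\<close>

definition weak_star_conv :: "(nat \<Rightarrow> 'a::topological_space measure) \<Rightarrow> 'a measure \<Rightarrow> bool" where
  "weak_star_conv M \<mu> \<longleftrightarrow>
     (\<forall>f::'a \<Rightarrow> real. continuous_on UNIV f \<and> bounded (range f) \<longrightarrow>
        (\<lambda>n. \<integral>y. f y \<partial>M n) \<longlonglongrightarrow> (\<integral>y. f y \<partial>\<mu>))"

definition typical :: "('a::topological_space \<Rightarrow> 'a) \<Rightarrow> 'a measure \<Rightarrow> 'a \<Rightarrow> bool" where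
  "typical T \<mu> x \<longleftrightarrow> weak_star_conv (empirical_measure T x) \<mu>"

definition Lambda0 :: "real \<Rightarrow> (real \<Rightarrow> real) \<Rightarrow> (real \<Rightarrow> real \<Rightarrow> real) \<Rightarrow> real \<Rightarrow> real" where
  "Lambda0 \<delta> T Ta l = (SUP x\<in>{T 1..1}. \<bar>deriv_within {0..\<delta>} (\<lambda>a. Ta a x) 0\<bar>) / (l - 1)"

end

theory Submission
  imports Defs "HOL-Real_Asymp.Real_Asymp"
begin

text \<open>
  The orbit of the turning point \<open>x\<^sub>j(a) = T\<^sub>a\<^sup>j(0)\<close> is studied as a function of the parameter. The
  transversality hypothesis makes the difference quotients of \<open>x\<^sub>j\<close> grow exponentially on the
  parameter intervals (cells) with a common itinerary, with bounded distortion. The sum over cells of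
  the inverse slopes of \<open>x\<^sub>j\<close> bounds the density of the distribution of \<open>x\<^sub>j\<close>. It stays bounded
  because, near a parameter for which 0 is not periodic, a short cell is cut at most once in a time in
  which the expansion exceeds 4; the excluded parameters are countably many. A second moment estimate
  for nearly orthogonal variables then gives, for almost every \<open>a\<close>, the bound
  \<open>limsup (1/n) (\<Sum>i<n. f (x\<^sub>i(a))) \<le> C \<integral> f\<close> for countably many test functions \<open>f\<close>. Every weak limit of the
  empirical measures is therefore an absolutely continuous invariant probability measure, and there is
  only one: the same growth argument, applied to a single map, shows that a forward invariant set of
  positive measure contains an interval up to a null set, and mixing excludes two disjoint such sets.

  No lower bounds for densities and no uniformity of spectral data in the parameter are needed, since
  existence of the invariant measure comes out of the limit and typicality is a local statement in \<open>a\<close>.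
\<close>

section \<open>Measures on the real line\<close>

text \<open>The parameter derivative of the turning orbit obeys D' = T'(x) D + g(x), where g is the
  parameter derivative of the map. Once |D| exceeds sup |g| / (l - 1), the product l |D| outweighs
  |D| + sup |g|, so the inequality reproduces itself at all later times. In quotient form this is
  the origin of the effective rate \<open>lam = l - S / Q\<close>. Away from a = 0 an orbit point
  need not be differentiable in the parameter, because orbits cross the kink of \<open>Ta a\<close>.
  Slopes are therefore difference quotients, and comparisons of slopes are cross-multiplied. The
  obstacle is that the turning point may return to itself, possibly already for \<open>Ta 0\<close>;
  near such a parameter, cuts can follow each other too closely for the expansion to compensate. So
  \<open>\<kappa>\<close>, and with it \<open>short\<close> and \<open>growth_const\<close>, is
  chosen near one nonperiodic parameter at a time, and the exceptional null sets are joined by local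
  negligibility. The 4 in \<open>lamN\<close> is a factor 2 for the single cut and a factor 2 of net
  gain; that gain is the (1/2)^m in the conditional means, and it forces lags that are multiples of
  \<open>N\<close>.\<close>

lemma nn_integral_mono_measure_sets:
  assumes s: "sets M = sets N" and le: "\<And>A. A \<in> sets M \<Longrightarrow> emeasure M A \<le> emeasure N A"
  shows "nn_integral M f \<le> nn_integral N f"
proof -
  have sp: "space M = space N" using s by (rule sets_eq_imp_space_eq)
  have sf: "simple_function M g \<longleftrightarrow> simple_function N g" for g :: "'a \<Rightarrow> ennreal"
    by (simp add: simple_function_def s sp)
  show ?thesis
    unfolding nn_integral_def
  proof (rule SUP_mono)
    fix g assume g: "g \<in> {g. simple_function M g \<and> g \<le> f}"
    have "integral\<^sup>S M g \<le> integral\<^sup>S N g"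
      unfolding simple_integral_def sp
      using g by (intro sum_mono mult_left_mono le) (auto simp: sp[symmetric] dest:
          simple_functionD(2))
    then show "\<exists>m\<in>{g. simple_function N g \<and> g \<le> f}. integral\<^sup>S M g \<le> integral\<^sup>S N m"
      using g sf by blast
  qed
qed

text \<open>The sum of all \<open>g m\<close> has finite integral, hence is finite almost
  everywhere, and the terms of a convergent series tend to 0.\<close>

lemma AE_tendsto_0_of_summable_nn_integral:
  fixes g :: "nat \<Rightarrow> 'a \<Rightarrow> real"
  assumes meas: "\<And>m. g m \<in> borel_measurable M"
    and nonneg: "\<And>m x. 0 \<le> g m x"
    and bound: "\<And>m. (\<integral>\<^sup>+ x. ennreal (g m x) \<partial>M) \<le> ennreal (b m)"
    and b: "\<And>m. 0 \<le> b m" "summable b"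
  shows "AE x in M. (\<lambda>m. g m x) \<longlonglongrightarrow> 0"
proof -
  have "(\<integral>\<^sup>+ x. (\<Sum>m. ennreal (g m x)) \<partial>M) = (\<Sum>m. \<integral>\<^sup>+ x. ennreal (g m x) \<partial>M)"
    using meas by (intro nn_integral_suminf) auto
  also have "\<dots> \<le> (\<Sum>m. ennreal (b m))"
    by (intro suminf_le bound) auto
  also have "\<dots> = ennreal (suminf b)"
    using b by (intro suminf_ennreal2) auto
  also have "\<dots> < \<infinity>" by simp
  finally have "(\<integral>\<^sup>+ x. (\<Sum>m. ennreal (g m x)) \<partial>M) \<noteq> \<infinity>" by simp
  then have "AE x in M. (\<Sum>m. ennreal (g m x)) \<noteq> \<infinity>"
    using meas by (intro nn_integral_noteq_infinite) auto
  then show ?thesis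
  proof (rule AE_mp, intro AE_I2 impI)
    fix x assume "(\<Sum>m. ennreal (g m x)) \<noteq> \<infinity>"
    then have "summable (\<lambda>m. g m x)"
      using nonneg by (intro summable_suminf_not_top) auto
    then show "(\<lambda>m. g m x) \<longlonglongrightarrow> 0" by (rule summable_LIMSEQ_zero)
  qed
qed

text \<open>An open set is the increasing union of the finite unions of dyadic cells it contains, so an
  inequality between measures of half-open intervals passes to open sets, and from there by outer
  regularity to Borel sets.\<close>

lemma emeasure_open_mono:
  fixes M N :: "real measure"
  assumes sM: "sets M = sets borel" and sN: "sets N = sets borel"
    and le: "\<And>a b. a < b \<Longrightarrow> emeasure M {a<..b} \<le> emeasure N {a<..b}"
    and U: "open U"
  shows "emeasure M U \<le> emeasure N U"
proof -
  define D where "D n k = {real_of_int k / 2^n <.. real_of_int (k+1) / 2^n}" for n :: nat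
      and k :: int
  \<comment> \<open>The bound \<open>4^n\<close> on the index keeps \<open>I n\<close> finite, while
    cells of size 1 / 2^n still reach out to about 2^n, so every bounded part of \<open>U\<close> is
    eventually seen.\<close>
  define I where "I n = {k. \<bar>k\<bar> \<le> 4^n \<and> D n k \<subseteq> U}" for n :: nat
  define V where "V n = (\<Union>k\<in>I n. D n k)" for n
  have D_iff: "x \<in> D n k \<longleftrightarrow> \<lceil>x * 2^n\<rceil> = k + 1" for x n k
    unfolding D_def by (auto simp: ceiling_eq_iff field_simps)
  have fin: "finite (I n)" for n
    by (rule finite_subset[of _ "{-(4^n)..4^n}"]) (auto simp: I_def)
  have disj: "disjoint_family_on (D n) (I n)" for n
    by (auto simp: disjoint_family_on_def D_iff)
  have Dm: "D n k \<in> sets borel" for n k by (simp add: D_def)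
  have VM: "V n \<in> sets borel" for n unfolding V_def using fin Dm by auto
  have VU: "V n \<subseteq> U" for n by (auto simp: V_def I_def)
  \<comment> \<open>Halving the index leads from a child cell to its parent. Conversely, children of
    a parent with |k| at most \<open>4^n\<close> have indices at most 2 * 4^n + 1 in modulus, which
    the next level admits.\<close>
  have D_sub: "D (Suc n) k \<subseteq> D n (k div 2)" for n k
  proof
    fix x assume "x \<in> D (Suc n) k"
    then have "real_of_int k < x * 2^Suc n" "x * 2^Suc n \<le> real_of_int k + 1"
      by (auto simp: D_iff ceiling_eq_iff)
    then have *: "real_of_int k / 2 < x * 2^n" "x * 2^n \<le> (real_of_int k + 1) / 2"
      by auto
    have "2 * (k div 2) \<le> k" "k \<le> 2 * (k div 2) + 1" by auto
    then have "real_of_int (2 * (k div 2)) \<le> real_of_int k" "real_of_int k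
        \<le> real_of_int (2 * (k div 2) + 1)"
      by (auto simp only: of_int_le_iff)
    then have "real_of_int (k div 2) < x * 2^n" "x * 2^n \<le> real_of_int (k div 2) + 1"
      using * by auto
    then show "x \<in> D n (k div 2)" by (simp add: D_iff ceiling_eq_iff)
  qed
  have inc: "incseq V"
  proof (rule incseq_SucI, rule subsetI)
    fix n x assume "x \<in> V n"
    then obtain k where k: "\<bar>k\<bar> \<le> 4^n" "D n k \<subseteq> U" "x \<in> D n k" by (auto simp: V_def I_def)
    define j where "j = \<lceil>x * 2^Suc n\<rceil> - 1"
    have xj: "x \<in> D (Suc n) j" by (simp add: D_iff j_def)
    then have "x \<in> D n (j div 2)" using D_sub by blast
    with k have jk: "j div 2 = k" by (simp add: D_iff)
    then have "D (Suc n) j \<subseteq> U" using D_sub k by blast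
    moreover have "\<bar>j\<bar> \<le> 4^Suc n"
    proof -
      have "(1::int) \<le> 4^n" by simp
      moreover have "2 * k \<le> j" "j \<le> 2 * k + 1" using jk by auto
      moreover have "-(4^n) \<le> k" "k \<le> 4^n" using k by auto
      moreover have "(4::int)^Suc n = 4 * 4^n" by simp
      ultimately show ?thesis by linarith
    qed
    ultimately show "x \<in> V (Suc n)" using xj by (auto simp: V_def I_def)
  qed
  have UV: "(\<Union>n. V n) = U"
  proof
    show "(\<Union>n. V n) \<subseteq> U" using VU by blast
    show "U \<subseteq> (\<Union>n. V n)"
    proof
      fix x assume x: "x \<in> U"
      obtain e where e: "e > 0" "ball x e \<subseteq> U" using U x openE by blast
      obtain n1 :: nat where n1: "(1/2)^n1 < e" using real_arch_pow_inv[of e "1/2"] e by auto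
      obtain n2 :: nat where n2: "\<bar>x\<bar> + 1 < 2^n2" using real_arch_pow[of 2 "\<bar>x\<bar> + 1"] by auto
      define n where "n = max n1 n2"
      have n: "1 / 2^n < e" "\<bar>x\<bar> + 1 < 2^n"
      proof -
        have "(1/2::real)^n \<le> (1/2)^n1" by (rule power_decreasing) (auto simp: n_def)
        then show "1 / 2^n < e" using n1 by (simp add: power_one_over)
        have "(2::real)^n2 \<le> 2^n" by (rule power_increasing) (auto simp: n_def)
        then show "\<bar>x\<bar> + 1 < 2^n" using n2 by linarith
      qed
      define k where "k = \<lceil>x * 2^n\<rceil> - 1"
      have xk: "x \<in> D n k" by (simp add: D_iff k_def)
      have "D n k \<subseteq> ball x e"
      proof
        fix y assume "y \<in> D n k"
        with xk have "\<bar>y - x\<bar> < 1 / 2^n"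
          unfolding D_def by (auto simp: field_simps abs_if)
        then show "y \<in> ball x e" using n by (auto simp: dist_real_def)
      qed
      moreover have "\<bar>k\<bar> \<le> 4^n"
      proof -
        have "\<bar>x * 2^n\<bar> + 1 \<le> 4^n"
        proof -
          have "\<bar>x * 2^n\<bar> + 1 \<le> \<bar>x\<bar> * 2^n + 2^n" by (simp add: abs_mult)
          also have "\<dots> = (\<bar>x\<bar> + 1) * 2^n" by (simp add: algebra_simps)
          also have "\<dots> \<le> 2^n * 2^n" using n by (intro mult_right_mono) auto
          also have "\<dots> = 4^n" by (simp add: power_mult_distrib[symmetric])
          finally show ?thesis .
        qed
        moreover have "\<bar>real_of_int k\<bar> \<le> \<bar>x * 2^n\<bar> + 1"
          unfolding k_def by linarith
        ultimately have "\<bar>real_of_int k\<bar> \<le> 4^n" by linarith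
        then have "real_of_int \<bar>k\<bar> \<le> real_of_int (4^n)" by simp
        then show ?thesis by (simp only: of_int_le_iff)
      qed
      ultimately show "x \<in> (\<Union>n. V n)" using xk e by (auto simp: V_def I_def)
    qed
  qed
  have V_le: "emeasure M (V n) \<le> emeasure N (V n)" for n
  proof -
    have "emeasure M (V n) = (\<Sum>k\<in>I n. emeasure M (D n k))"
      unfolding V_def using fin disj Dm sM by (intro sum_emeasure[symmetric]) auto
    also have "\<dots> \<le> (\<Sum>k\<in>I n. emeasure N (D n k))"
      unfolding D_def by (intro sum_mono le) (auto simp: divide_strict_right_mono)
    also have "\<dots> = emeasure N (V n)"
      unfolding V_def using fin disj Dm sN by (intro sum_emeasure) auto
    finally show ?thesis .
  qed
  have "emeasure M U = (SUP n. emeasure M (V n))"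
    unfolding UV[symmetric] using inc VM sM by (intro SUP_emeasure_incseq[symmetric]) auto
  also have "\<dots> \<le> (SUP n. emeasure N (V n))" by (intro SUP_mono) (use V_le in auto)
  also have "\<dots> = emeasure N U"
    unfolding UV[symmetric] using inc VM sN by (intro SUP_emeasure_incseq) auto
  finally show ?thesis .
qed

text \<open>Every open \<open>U\<close> around \<open>B\<close> satisfies M B \<le> M U \<le> N U,
  and the infimum over \<open>U\<close> is N B by outer regularity of the finite measure
  \<open>N\<close>.\<close>

lemma emeasure_borel_mono_finite:
  fixes M N :: "real measure"
  assumes sM: "sets M = sets borel" and sN: "sets N = sets borel" and fN: "finite_measure N"
    and le: "\<And>a b. a < b \<Longrightarrow> emeasure M {a<..b} \<le> emeasure N {a<..b}"
    and B: "B \<in> sets borel"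
  shows "emeasure M B \<le> emeasure N B"
proof -
  interpret finite_measure N by fact
  have "emeasure N B = (INF U \<in> {U. B \<subseteq> U \<and> open U}. emeasure N U)"
    using B sN by (intro outer_regular) auto
  also have "emeasure M B \<le> \<dots>"
  proof (rule INF_greatest)
    fix U assume "U \<in> {U. B \<subseteq> U \<and> open U}"
    then have "emeasure M B \<le> emeasure M U" "emeasure M U \<le> emeasure N U"
      using sM emeasure_open_mono[OF sM sN le] by (auto intro!: emeasure_mono)
    then show "emeasure M B \<le> emeasure N U" by simp
  qed
  finally show ?thesis .
qed

lemma emeasure_borel_le_lborel:
  fixes M :: "real measure"
  assumes sM: "sets M = sets borel" and c: "c \<ge> 0"
    and le: "\<And>a b. a < b \<Longrightarrow> emeasure M {a<..b} \<le> ennreal (c * (b - a))"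
    and B: "B \<in> sets borel"
  shows "emeasure M B \<le> ennreal c * emeasure lborel B"
proof (rule ennreal_le_epsilon)
  fix e :: real assume e: "e > 0"
  \<comment> \<open>Lebesgue measure is not finite, so it is the excess \<open>U - B\<close> that is
    made small. The denominator \<open>c + 1\<close> covers \<open>c = 0\<close>.\<close>
  obtain U where U: "open U" "B \<subseteq> U" "emeasure lborel (U - B) < ennreal (e / (c + 1))"
    using outer_regular_lborel[OF B, of "e / (c+1)"] e c by auto
  define N :: "real measure" where "N = scale_measure (ennreal c) lborel"
  have "emeasure M B \<le> emeasure M U" using U sM by (intro emeasure_mono) auto
  also have "\<dots> \<le> emeasure N U"
  proof (rule emeasure_open_mono[OF sM])
    show "sets N = sets borel" by (simp add: N_def)
    fix a b :: real assume "a < b"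
    then show "emeasure M {a<..b} \<le> emeasure N {a<..b}"
      using le[of a b] c by (simp add: N_def ennreal_mult)
  qed (use U in auto)
  also have "\<dots> = ennreal c * emeasure lborel (B \<union> (U - B))"
    using U by (simp add: N_def Un_absorb1)
  also have "\<dots> = ennreal c * (emeasure lborel B + emeasure lborel (U - B))"
    using U B by (subst plus_emeasure) auto
  also have "\<dots> \<le> ennreal c * emeasure lborel B + ennreal c * ennreal (e / (c + 1))"
    unfolding distrib_left by (intro add_left_mono mult_left_mono) (use U in auto)
  also have "ennreal c * ennreal (e / (c + 1)) \<le> ennreal e"
  proof -
    have "c * (e / (c + 1)) \<le> e" using c e by (auto simp: field_simps)
    then show ?thesis using c e by (simp add: ennreal_mult[symmetric])
  qed
  finally show "emeasure M B \<le> ennreal c * emeasure lborel B + ennreal e"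
    by (simp add: add_left_mono)
qed

section \<open>Averages of weakly dependent variables\<close>

lemma integral_abs_le_integral:
  fixes f g :: "'a \<Rightarrow> real"
  assumes "integrable M f" "integrable M g" "\<And>x. \<bar>f x\<bar> \<le> g x"
  shows "\<bar>\<integral>x. f x \<partial>M\<bar> \<le> (\<integral>x. g x \<partial>M)"
proof -
  have "\<bar>\<integral>x. f x \<partial>M\<bar> \<le> (\<integral>x. \<bar>f x\<bar> \<partial>M)" using integral_norm_bound[of M f] by simp
  also have "\<dots> \<le> (\<integral>x. g x \<partial>M)" using assms by (intro integral_mono) auto
  finally show ?thesis .
qed

text \<open>Partial sums of a nonnegative sequence are monotone, so replacing n by the next fourth
  power costs at most the factor ((m+1)/m)^4, which tends to 1.\<close>

lemma eventually_average_le_of_subseq: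
  fixes y t :: "nat \<Rightarrow> real"
  assumes y: "\<And>i. 0 \<le> y i" and t: "t \<longlonglongrightarrow> 0"
    and le: "\<And>m. (\<Sum>i<(m+1)^4. y i) \<le> real ((m+1)^4) * (c + t m)"
    and \<eta>: "\<eta> > 0"
  shows "\<forall>\<^sub>F n in sequentially. (\<Sum>i<n. y i) / real n \<le> c + \<eta>"
proof -
  have "(\<lambda>m::nat. real ((m+1)^4) / real (m^4)) \<longlonglongrightarrow> 1" by real_asymp
  then have "(\<lambda>m. real ((m+1)^4) / real (m^4) * (c + t m)) \<longlonglongrightarrow> 1 * (c + 0)"
    by (intro tendsto_intros t)
  then have "\<forall>\<^sub>F m in sequentially. real ((m+1)^4) / real (m^4) * (c + t m) < c + \<eta>"
    using \<eta> by (intro order_tendstoD(2)[where y = "1 * (c + 0)"]) auto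
  then obtain M where M: "\<And>m. m \<ge> M \<Longrightarrow> real ((m+1)^4) / real (m^4) * (c + t m) < c + \<eta>"
    by (auto simp: eventually_sequentially)
  show ?thesis
    unfolding eventually_sequentially
  proof (intro exI allI impI)
    fix n :: nat assume n: "(M + 1)^4 + 1 \<le> n"
    define m where "m = (LEAST m. n \<le> (m+1)^4)"
    have ex: "n \<le> (n+1)^4"
      using self_le_power[of "n+1" 4] by linarith
    have m1: "n \<le> (m+1)^4" unfolding m_def by (rule LeastI[of _ n]) (rule ex)
    have "M < m"
    proof (rule ccontr)
      assume "\<not> M < m"
      then have "(m+1)^4 \<le> (M+1)^4" by (intro power_mono) auto
      then show False using m1 n by linarith
    qed
    have m2: "m^4 < n"
    proof (rule ccontr)
      assume "\<not> m^4 < n"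
      then have "n \<le> (m - 1 + 1)^4" using \<open>M < m\<close> by simp
      then have "m \<le> m - 1" unfolding m_def by (rule Least_le)
      then show False using \<open>M < m\<close> by simp
    qed
    have s0: "0 \<le> (\<Sum>i<k. y i)" for k by (intro sum_nonneg y)
    have "(\<Sum>i<n. y i) \<le> (\<Sum>i<(m+1)^4. y i)" using m1 y by (intro sum_mono2) auto
    also have "\<dots> \<le> real ((m+1)^4) * (c + t m)" by (rule le)
    finally have S: "(\<Sum>i<n. y i) \<le> real ((m+1)^4) * (c + t m)" .
    have "(\<Sum>i<n. y i) / real n \<le> (\<Sum>i<n. y i) / real (m^4)"
      using m2 \<open>M < m\<close> s0[of n] by (intro divide_left_mono) auto
    also have "\<dots> \<le> real ((m+1)^4) * (c + t m) / real (m^4)"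
      using S by (intro divide_right_mono) auto
    also have "\<dots> \<le> c + \<eta>" using M[of m] \<open>M < m\<close> by simp
    finally show "(\<Sum>i<n. y i) / real n \<le> c + \<eta>" .
  qed
qed

lemma sum_lessThan_add_split:
  fixes f :: "nat \<Rightarrow> 'a::comm_monoid_add"
  shows "(\<Sum>i<p+q. f i) = (\<Sum>i<p. f i) + (\<Sum>i<q. f (i + p))"
  by (induction q) (simp_all add: add_ac)

lemma card_near_le:
  fixes i n k :: nat
  shows "card {j\<in>{..<n}. \<not> (i + k \<le> j \<or> j + k \<le> i)} \<le> 2 * k"
proof -
  have "{j\<in>{..<n}. \<not> (i + k \<le> j \<or> j + k \<le> i)} \<subseteq> {i + 1 - k..<i + k}" by auto
  then have "card {j\<in>{..<n}. \<not> (i + k \<le> j \<or> j + k \<le> i)} \<le> card {i + 1 - k..<i + k}"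
    by (intro card_mono) auto
  also have "\<dots> \<le> 2 * k" by simp
  finally show ?thesis .
qed

text \<open>The random variables \<open>Y i\<close> are almost determined by the past once it is long enough, and
  conditionally on the past their later means are at most about \<open>c\<close>. Subtracting conditional
  expectations with a slowly growing lag leaves nearly orthogonal terms, so that second moments are
  summable along \<open>n = (m+1)^4\<close>.\<close>

lemma AE_limsup_average_le:
  fixes M :: "'a measure" and lab :: "nat \<Rightarrow> 'a \<Rightarrow> 'b" and Y :: "nat \<Rightarrow> 'a \<Rightarrow> real"
    and z :: "nat \<Rightarrow> 'b \<Rightarrow> real"
  assumes fM: "finite_measure M"
    and fin: "\<And>n. finite (lab n ` space M)"
    and lab_meas: "\<And>n w. {a\<in>space M. lab n a = w} \<in> sets M"
    and refine: "\<And>i j a b. i \<le> j \<Longrightarrow> a \<in> space M \<Longrightarrow> b \<in> space M \<Longrightarrow> lab j a = lab j b \<Longrightarrow> lab i a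
        = lab i b"
    and Ym[measurable]: "\<And>n. Y n \<in> borel_measurable M"
    and Y0: "\<And>n a. 0 \<le> Y n a" and Y1: "\<And>n a. Y n a \<le> 1"
    and osc: "\<And>i j a b. i \<le> j \<Longrightarrow> a \<in> space M \<Longrightarrow> b \<in> space M \<Longrightarrow> lab j a = lab j b
        \<Longrightarrow> \<bar>Y i a - Y i b\<bar> \<le> C * r^(j - i)"
    and C: "0 \<le> C" and r: "0 \<le> r" "r < 1"
    and N: "1 \<le> N" and c: "0 \<le> c"
    and cond: "\<And>n m w. w \<in> lab n ` space M \<Longrightarrow>
        (\<integral>a. indicator {a\<in>space M. lab n a = w} a * Y (n + N * m) a \<partial>M)
          \<le> (1/2)^m * z n w + c * measure M {a\<in>space M. lab n a = w}"
    and z0: "\<And>n w. 0 \<le> z n w"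
    and zsum: "\<And>n. (\<Sum>w\<in>lab n ` space M. z n w) \<le> Z"
  shows "AE a in M. \<forall>\<eta>>0. \<forall>\<^sub>F n in sequentially. (\<Sum>i<n. Y i a) / real n \<le> c + \<eta>"
proof -
  interpret finite_measure M by fact
  define P where "P n w = {a\<in>space M. lab n a = w}" for n w
  define \<Omega> where "\<Omega> n = lab n ` space M" for n
  have Pm[measurable]: "P n w \<in> sets M" for n w unfolding P_def by (rule lab_meas)
  have fin\<Omega>[simp]: "finite (\<Omega> n)" for n using fin by (simp add: \<Omega>_def)
  \<comment> \<open>The conditional mean of the variable at lag \<open>N * m\<close> on one label
    set; on a null label set division by zero gives 0, still a value between 0 and 1.
    \<open>E\<close> is the resulting conditional expectation and \<open>D\<close> the centred
    remainder.\<close>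
  define e where "e n m w = (\<integral>a. indicator (P n w) a * Y (n + N * m) a \<partial>M) / measure M (P n w)"
      for n m w
  define E where "E n m a = e n m (lab n a)" for n m a
  define D where "D n m a = Y (n + N * m) a - E n m a" for n m a
  have ind_sum: "g (lab n a) = (\<Sum>w\<in>\<Omega> n. g w * indicator (P n w) a)" if "a \<in> space M" for g ::
      "'b \<Rightarrow> real" and n a
  proof -
    have "(\<Sum>w\<in>\<Omega> n. g w * indicator (P n w) a) = (\<Sum>w\<in>\<Omega> n. if w = lab n a then g w else 0)"
      using that by (intro sum.cong) (auto simp: P_def indicator_def)
    also have "\<dots> = g (lab n a)" using that by (simp add: \<Omega>_def fin)
    finally show ?thesis ..
  qed
  have lab_fun_meas: "(\<lambda>a. g (lab n a)) \<in> borel_measurable M" for g :: "'b \<Rightarrow> real" and n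
  proof (subst measurable_cong[OF ind_sum])
    show "(\<lambda>a. \<Sum>w\<in>\<Omega> n. g w * indicator (P n w) a) \<in> borel_measurable M" by measurable
  qed
  have Em[measurable]: "E n m \<in> borel_measurable M" for n m unfolding E_def by (rule lab_fun_meas)
  have Dm[measurable]: "D n m \<in> borel_measurable M" for n m unfolding D_def by measurable
  have intb: "integrable M f" if "f \<in> borel_measurable M" "\<And>a. a \<in> space M \<Longrightarrow> \<bar>f a\<bar> \<le> B" for f ::
      "'a \<Rightarrow> real" and B
    using that by (intro integrable_const_bound[where B=B]) auto
  have iY: "integrable M (\<lambda>a. indicator (P n w) a * Y k a)" for n w k
    by (rule intb[where B=1]) (auto simp: indicator_def Y0 Y1 abs_le_iff intro: order_trans[OF _
      Y0])
  have e0: "0 \<le> e n m w" for n m w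
    unfolding e_def by (intro divide_nonneg_nonneg integral_nonneg_AE) (auto simp: Y0)
  have iind: "integrable M (\<lambda>a. indicator (P n w) a :: real)" for n w
    by (rule intb[where B=1]) (auto simp: indicator_def)
  have eint: "(\<integral>a. indicator (P n w) a * Y k a \<partial>M) \<le> measure M (P n w)" for n w k
  proof -
    have "(\<integral>a. indicator (P n w) a * Y k a \<partial>M) \<le> (\<integral>a. indicator (P n w) a \<partial>M)"
      by (intro integral_mono iY iind) (simp add: indicator_def Y1)
    then show ?thesis by simp
  qed
  have e1: "e n m w \<le> 1" for n m w
    unfolding e_def using eint[of n w "n + N*m"] by (cases "measure M (P n w)
        = 0") (auto simp: divide_le_eq_1 measure_nonneg zero_less_measure_iff less_le)
  have E01: "0 \<le> E n m a" "E n m a \<le> 1" for n m a by (auto simp: E_def e0 e1)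
  have D1: "\<bar>D n m a\<bar> \<le> 1" for n m a
    using E01[of n m a] Y0[of "n+N*m" a] Y1[of "n+N*m" a] by (auto simp: D_def abs_le_iff)
  have iD: "integrable M (\<lambda>a. indicator (P n w) a * D j m a)" for n w j m
    by (rule intb[where B=1]) (auto simp: indicator_def D1)
  have DD1: "\<bar>D i m a * D j m a\<bar> \<le> 1" for i j m a
    using D1[of i m a] D1[of j m a] by (simp add: abs_mult mult_le_one)
  have iDD: "integrable M (\<lambda>a. D i m a * D j m a)" for i j m
    by (rule intb[where B=1]) (auto simp: DD1)
  have D_mean: "(\<integral>a. indicator (P n w) a * D n m a \<partial>M) = 0" for n w m
  proof -
    have "(\<integral>a. indicator (P n w) a * D n m a \<partial>M)
        = (\<integral>a. indicator (P n w) a * Y (n + N*m) a - e n m w * indicator (P n w) a \<partial>M)"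
      by (intro Bochner_Integration.integral_cong) (auto simp: D_def E_def P_def indicator_def)
    also have "\<dots> = (\<integral>a. indicator (P n w) a * Y (n + N*m) a \<partial>M) - e n m w * measure M (P n w)"
      by (subst Bochner_Integration.integral_diff) (auto simp: iY less_top[symmetric])
    also have "\<dots> = 0"
    proof (cases "measure M (P n w) = 0")
      case True
      then have "(\<integral>a. indicator (P n w) a * Y (n + N*m) a \<partial>M) \<le> 0" using eint[of n w "n+N*m"]
          by simp
      moreover have "(\<integral>a. indicator (P n w) a * Y (n + N*m) a \<partial>M) \<ge> 0"
        by (intro integral_nonneg_AE) (auto simp: Y0)
      ultimately show ?thesis using True by simp
    qed (simp add: e_def)
    finally show ?thesis .
  qed
  have split: "(\<integral>a. f a \<partial>M) = (\<Sum>w\<in>\<Omega> n. \<integral>a. indicator (P n w) a * f a \<partial>M)"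
    if f: "integrable M f" for f :: "'a \<Rightarrow> real" and n
  proof -
    have "(\<integral>a. f a \<partial>M) = (\<integral>a. (\<Sum>w\<in>\<Omega> n. indicator (P n w) a * f a) \<partial>M)"
      using ind_sum[of _ "\<lambda>_. 1"] by (intro Bochner_Integration.integral_cong) (auto simp:
          sum_distrib_right[symmetric])
    also have "\<dots> = (\<Sum>w\<in>\<Omega> n. \<integral>a. indicator (P n w) a * f a \<partial>M)"
      by (intro Bochner_Integration.integral_sum integrable_real_mult_indicator f | simp add:
        mult.commute[of "indicator _ _"] integrable_real_mult_indicator f)+
    finally show ?thesis .
  qed
  have msum: "(\<Sum>w\<in>\<Omega> n. measure M (P n w)) = measure M (space M)" for n
    using split[of "\<lambda>_. 1" n] by simp
  define \<mu> where "\<mu> = measure M (space M)"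
  have \<mu>0: "0 \<le> \<mu>" by (simp add: \<mu>_def)
  \<comment> \<open>On a label set of level \<open>j\<close> the factor \<open>D i m\<close> is
    nearly constant, because \<open>j\<close> lies another \<open>N * m\<close> steps beyond the
    time \<open>i + N * m\<close> of its variable. Freezing it at one point \<open>b\<close> leaves
    a multiple of the mean of \<open>D j m\<close>, which is 0.\<close>
  have cross: "\<bar>\<integral>a. D i m a * D j m a \<partial>M\<bar> \<le> C * r^(N * m) * \<mu>" if ij: "i + 2 * (N * m) \<le> j"
      for i j m
  proof -
    have piece: "\<bar>\<integral>a. indicator (P j w) a * (D i m a * D j m a) \<partial>M\<bar>
        \<le> C * r^(N*m) * measure M (P j w)"
      if w: "w \<in> \<Omega> j" for w
    proof -
      obtain b where b: "b \<in> space M" "lab j b = w" using w by (auto simp: \<Omega>_def)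
      have near: "\<bar>D i m a - D i m b\<bar> \<le> C * r^(N*m)" if a: "a \<in> P j w" for a
      proof -
        have lab: "a \<in> space M" "lab j a = lab j b" using a b by (auto simp: P_def)
        have "lab i a = lab i b" using refine[OF _ lab(1) b(1) lab(2), of i] ij by simp
        then have "\<bar>D i m a - D i m b\<bar> = \<bar>Y (i + N*m) a - Y (i + N*m) b\<bar>" by (simp add: D_def E_def)
        also have "\<dots> \<le> C * r^(j - (i + N*m))" using osc[OF _ lab(1) b(1) lab(2)] ij by simp
        also have "\<dots> \<le> C * r^(N*m)" using ij r C by (intro mult_left_mono power_decreasing) auto
        finally show ?thesis .
      qed
      have "(\<integral>a. indicator (P j w) a * (D i m a * D j m a) \<partial>M)
          = (\<integral>a. indicator (P j w) a * ((D i m a - D i m b) * D j m a) + D i m b * (indicator (P j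
              w) a * D j m a) \<partial>M)"
        by (intro Bochner_Integration.integral_cong) (auto simp: algebra_simps)
      also have "\<dots> = (\<integral>a. indicator (P j w) a * ((D i m a - D i m b) * D j m a) \<partial>M) + D i m b * (\<integral>a.
          indicator (P j w) a * D j m a \<partial>M)"
      proof (subst Bochner_Integration.integral_add)
        show "integrable M (\<lambda>a. indicator (P j w) a * ((D i m a - D i m b) * D j m a))"
        proof (rule intb[where B="2"])
          fix a
          have "\<bar>D i m a - D i m b\<bar> * \<bar>D j m a\<bar> \<le> 2 * 1"
            using D1[of i m a] D1[of i m b] D1[of j m a] by (intro mult_mono) auto
          then show "\<bar>indicator (P j w) a * ((D i m a - D i m b) * D j m a)\<bar> \<le> 2"
            by (auto simp: indicator_def abs_mult)
        qed measurable
      qed (auto intro!: iD)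
      finally have eq: "(\<integral>a. indicator (P j w) a * (D i m a * D j m a) \<partial>M)
        = (\<integral>a. indicator (P j w) a * ((D i m a - D i m b) * D j m a) \<partial>M)" by (simp add: D_mean)
      have "\<bar>\<integral>a. indicator (P j w) a * ((D i m a - D i m b) * D j m a) \<partial>M\<bar>
          \<le> (\<integral>a. C * r^(N*m) * indicator (P j w) a \<partial>M)"
      proof (rule integral_abs_le_integral)
        show "integrable M (\<lambda>a. C * r^(N*m) * indicator (P j w) a)"
            by (auto simp: less_top[symmetric])
        show pw: "\<bar>indicator (P j w) a * ((D i m a - D i m b) * D j m a)\<bar>
            \<le> C * r^(N*m) * indicator (P j w) a" for a
        proof (cases "a \<in> P j w")
          case True
          have "\<bar>D i m a - D i m b\<bar> * \<bar>D j m a\<bar> \<le> C * r^(N*m) * 1"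
            using near[OF True] D1[of j m a] C r by (intro mult_mono) auto
          then show ?thesis using True by (simp add: abs_mult)
        qed simp
        show "integrable M (\<lambda>a. indicator (P j w) a * ((D i m a - D i m b) * D j m a))"
        proof (rule intb[where B="C * r^(N*m)"])
          fix a
          show "\<bar>indicator (P j w) a * ((D i m a - D i m b) * D j m a)\<bar> \<le> C * r^(N*m)"
            using pw[of a] C r by (auto simp: indicator_def split: if_splits)
        qed measurable
      qed
      then show ?thesis unfolding eq by simp
    qed
    have "\<bar>\<integral>a. D i m a * D j m a \<partial>M\<bar> = \<bar>\<Sum>w\<in>\<Omega> j. \<integral>a. indicator (P j w) a * (D i m a * D j m a) \<partial>M\<bar>"
      by (subst split[OF iDD, of i m j j]) simp
    also have "\<dots> \<le> (\<Sum>w\<in>\<Omega> j. C * r^(N*m) * measure M (P j w))"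
      by (rule order_trans[OF sum_abs]) (intro sum_mono piece)
    also have "\<dots> = C * r^(N*m) * \<mu>" by (simp add: sum_distrib_left[symmetric] msum \<mu>_def)
    finally show ?thesis .
  qed
  have trivial: "\<bar>\<integral>a. D i m a * D j m a \<partial>M\<bar> \<le> \<mu>" for i j m
  proof -
    have "\<bar>\<integral>a. D i m a * D j m a \<partial>M\<bar> \<le> (\<integral>a. 1 \<partial>M)"
      by (rule integral_abs_le_integral) (auto intro!: iDD DD1)
    then show ?thesis by (simp add: \<mu>_def)
  qed
  \<comment> \<open>Each row has at most \<open>4 * (N * m)\<close> entries closer than
    \<open>2 * (N * m)\<close> to the diagonal. They get the trivial bound \<open>\<mu>\<close>, and
    all others the exponentially small bound of \<open>cross\<close>.\<close>
  have second: "(\<integral>a. (\<Sum>j<n. D j m a)^2 \<partial>M)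
      \<le> real n * (4 * real (N * m)) * \<mu> + real n ^2 * (C * r^(N*m) * \<mu>)" for n m
  proof -
    have "(\<integral>a. (\<Sum>j<n. D j m a)^2 \<partial>M) = (\<integral>a. (\<Sum>i<n. \<Sum>j<n. D i m a * D j m a) \<partial>M)"
      by (simp add: power2_eq_square sum_product)
    also have "\<dots> = (\<Sum>i<n. \<Sum>j<n. \<integral>a. D i m a * D j m a \<partial>M)"
      by (subst Bochner_Integration.integral_sum, intro Bochner_Integration.integrable_sum iDD)
        (intro sum.cong refl Bochner_Integration.integral_sum iDD)
    also have "\<dots> \<le> (\<Sum>i<n. \<Sum>j<n. (if \<not> (i + 2*(N*m) \<le> j \<or> j + 2*(N*m)
        \<le> i) then \<mu> else 0) + C * r^(N*m) * \<mu>)"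
    proof (intro sum_mono)
      fix i j
      have nn: "0 \<le> C * r^(N*m) * \<mu>" using C r \<mu>0 by simp
      show "(\<integral>a. D i m a * D j m a \<partial>M) \<le> (if \<not> (i + 2*(N*m) \<le> j \<or> j + 2*(N*m)
          \<le> i) then \<mu> else 0) + C * r^(N*m) * \<mu>"
      proof (cases "i + 2*(N*m) \<le> j \<or> j + 2*(N*m) \<le> i")
        case True
        then have "\<bar>\<integral>a. D i m a * D j m a \<partial>M\<bar> \<le> C * r^(N*m) * \<mu>"
          using cross[of i m j] cross[of j m i] by (auto simp: mult.commute)
        then show ?thesis using True by auto
      next
        case False
        then show ?thesis using trivial[where i=i and j=j and m=m] nn by auto
      qed
    qed
    also have "\<dots> = (\<Sum>i<n. real (card {j\<in>{..<n}. \<not> (i + 2*(N*m) \<le> j \<or> j + 2*(N*m)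
        \<le> i)}) * \<mu> + real n * (C * r^(N*m) * \<mu>))"
      by (intro sum.cong refl) (simp add: sum.distrib sum.If_cases Collect_conj_eq[symmetric]
        Int_def)
    also have "\<dots> \<le> (\<Sum>i<n. 4 * real (N*m) * \<mu> + real n * (C * r^(N*m) * \<mu>))"
    proof (intro sum_mono add_right_mono mult_right_mono \<mu>0)
      fix i
      have "card {j\<in>{..<n}. \<not> (i + 2*(N*m) \<le> j \<or> j + 2*(N*m) \<le> i)} \<le> 2 * (2 * (N*m))"
          by (rule card_near_le)
      then have "real (card {j\<in>{..<n}. \<not> (i + 2*(N*m) \<le> j \<or> j + 2*(N*m) \<le> i)})
          \<le> real (2 * (2 * (N*m)))"
        by (simp only: of_nat_le_iff)
      then show "real (card {j\<in>{..<n}. \<not> (i + 2*(N*m) \<le> j \<or> j + 2*(N*m) \<le> i)}) \<le> 4 * real (N*m)"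
          by simp
    qed
    also have "\<dots> = real n * (4 * real (N * m)) * \<mu> + real n ^2 * (C * r^(N*m) * \<mu>)"
      by (simp add: algebra_simps power2_eq_square)
    finally show ?thesis .
  qed
  \<comment> \<open>With (m+1)^4 terms and lag \<open>N * m\<close>, the near-diagonal pairs
    contribute order m / (m+1)^4 to the normalised second moment: summable, although the lag tends
    to infinity.\<close>
  define q where "q m = real ((m+1)^4)" for m :: nat
  have q0: "0 < q m" for m by (simp add: q_def)
  define V where "V m a = (\<Sum>j<(m+1)^4. D j m a) / q m" for m a
  \<comment> \<open>The average of the transient parts of the conditional means. Integrating
    \<open>z / measure\<close> over the label sets returns at most the sum of the \<open>z\<close>,
    so the integral of \<open>W m\<close> is at most \<open>Z * (1/2)^m\<close>.\<close>
  define W where "W m a = (\<Sum>j<(m+1)^4. (1/2)^m * (z j (lab j a) / measure M (P j (lab j a)))) / q m"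
      for m a
  have Vm[measurable]: "V m \<in> borel_measurable M" for m unfolding V_def by measurable
  have Wm[measurable]: "W m \<in> borel_measurable M" for m
    unfolding W_def
    by (intro borel_measurable_divide borel_measurable_sum borel_measurable_const)
      (rule lab_fun_meas[where g="\<lambda>w. (1/2)^m * (z j w / measure M (P j w))" for j])
  have W0: "0 \<le> W m a" for m a
    unfolding W_def using q0[of m] z0 by (intro divide_nonneg_nonneg sum_nonneg mult_nonneg_nonneg)
        auto
  have AE_V: "AE a in M. (\<lambda>m. (V m a)^2) \<longlonglongrightarrow> 0"
  proof (rule AE_tendsto_0_of_summable_nn_integral[where b="\<lambda>m. \<mu> * (4 * real N * (1 / real
      (m+1)^2)) + \<mu> * C * r^m"])
    fix m
    have V1: "\<bar>V m a\<bar> \<le> 1" for a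
    proof -
      have "\<bar>\<Sum>j<(m+1)^4. D j m a\<bar> \<le> (\<Sum>j<(m+1)^4. 1)"
        by (rule order_trans[OF sum_abs]) (intro sum_mono D1)
      then show ?thesis using q0[of m] by (simp add: V_def q_def abs_divide)
    qed
    have iV: "integrable M (\<lambda>a. (V m a)^2)"
      by (rule intb[where B=1]) (auto simp: V1 power2_le_iff_abs_le abs_square_le_1)
    have "(\<integral>\<^sup>+ a. ennreal ((V m a)^2) \<partial>M) = ennreal (\<integral>a. (V m a)^2 \<partial>M)"
      using iV by (intro nn_integral_eq_integral) auto
    also have "(\<integral>a. (V m a)^2 \<partial>M) = (\<integral>a. (\<Sum>j<(m+1)^4. D j m a)^2 \<partial>M) / q m ^2"
      by (simp add: V_def power_divide)
    also have "\<dots> \<le> (q m * (4 * real (N * m)) * \<mu> + q m ^2 * (C * r^(N*m) * \<mu>)) / q m ^2"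
      using second[where m=m and n="(m+1)^4"] unfolding q_def by (intro divide_right_mono) auto
    also have "\<dots> = \<mu> * (4 * real N * (real m / q m)) + C * r^(N*m) * \<mu>"
      using q0[of m] by (simp add: field_simps power2_eq_square)
    also have "\<dots> \<le> \<mu> * (4 * real N * (1 / real (m+1)^2)) + \<mu> * C * r^m"
    proof (intro add_mono mult_left_mono \<mu>0)
      have "real m * real (m+1)^2 \<le> real (m+1) * real (m+1)^2" by (intro mult_right_mono) auto
      also have "\<dots> = real (m+1)^3" by (simp add: power3_eq_cube power2_eq_square)
      also have "\<dots> \<le> q m" unfolding q_def of_nat_power by (rule power_increasing) auto
      finally show "real m / q m \<le> 1 / real (m+1)^2" using q0[of m] by (simp add: divide_simps)
      have "r^(N*m) \<le> r^m" using r N by (intro power_decreasing) auto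
      then have "\<mu> * C * r^(N*m) \<le> \<mu> * C * r^m" using C \<mu>0 by (intro mult_left_mono) auto
      then show "C * r^(N*m) * \<mu> \<le> \<mu> * C * r^m" by (simp add: mult_ac)
    qed auto
    finally show "(\<integral>\<^sup>+ a. ennreal ((V m a)^2) \<partial>M)
        \<le> ennreal (\<mu> * (4 * real N * (1 / real (m+1)^2)) + \<mu> * C * r^m)"
      by (simp add: ennreal_leI)
    show "0 \<le> \<mu> * (4 * real N * (1 / real (m+1)^2)) + \<mu> * C * r^m" using \<mu>0 C r by simp
  next
    have "summable (\<lambda>m. inverse (real (Suc m) ^ 2))"
      using inverse_power_summable[of 2, where 'a=real] by (subst summable_Suc_iff) auto
    then have "summable (\<lambda>m. 1 / real (m+1)^2)" by (simp add: inverse_eq_divide)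
    then show "summable (\<lambda>m. \<mu> * (4 * real N * (1 / real (m+1)^2)) + \<mu> * C * r^m)"
      using r by (intro summable_add summable_mult summable_geometric) auto
  qed auto
  have AE_W: "AE a in M. (\<lambda>m. W m a) \<longlonglongrightarrow> 0"
  proof (rule AE_tendsto_0_of_summable_nn_integral[where b="\<lambda>m. Z * (1/2)^m"])
    have Z0: "0 \<le> Z" using zsum[of 0] z0 sum_nonneg[of "lab 0 ` space M" "z 0"] by simp
    then show "0 \<le> Z * (1/2)^m" for m by simp
    show "summable (\<lambda>m. Z * (1/2)^m)" by (intro summable_mult summable_geometric) auto
    fix m
    have iz: "integrable M (\<lambda>a. z j (lab j a) / measure M (P j (lab j a)))" for j
    proof (rule intb[where B="\<Sum>w\<in>\<Omega> j. z j w / measure M (P j w)"])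
      show "(\<lambda>a. z j (lab j a) / measure M (P j (lab j a))) \<in> borel_measurable M"
        by (rule lab_fun_meas[where g="\<lambda>w. (z j w / measure M (P j w))"])
      fix a assume "a \<in> space M"
      then show "\<bar>z j (lab j a) / measure M (P j (lab j a))\<bar> \<le> (\<Sum>w\<in>\<Omega> j. z j w / measure M (P j w))"
        using z0 by (auto simp: \<Omega>_def abs_of_nonneg intro!: member_le_sum[where f="\<lambda>w. z j
            w / measure M (P j w)"] fin)
    qed
    have zint: "(\<integral>a. z j (lab j a) / measure M (P j (lab j a)) \<partial>M) \<le> Z" for j
    proof -
      have "(\<integral>a. z j (lab j a) / measure M (P j (lab j a)) \<partial>M)
          = (\<integral>a. (\<Sum>w\<in>\<Omega> j. z j w / measure M (P j w) * indicator (P j w) a) \<partial>M)"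
        by (intro Bochner_Integration.integral_cong refl ind_sum[where g="\<lambda>w. z j w / measure M (P j
          w)" and n=j])
      also have "\<dots> = (\<Sum>w\<in>\<Omega> j. z j w / measure M (P j w) * measure M (P j w))"
        by (subst Bochner_Integration.integral_sum) (auto simp: less_top[symmetric])
      also have "\<dots> \<le> (\<Sum>w\<in>\<Omega> j. z j w)" by (intro sum_mono) (auto simp: z0)
      also have "\<dots> \<le> Z" using zsum by (simp add: \<Omega>_def)
      finally show ?thesis .
    qed
    have iW: "integrable M (W m)" unfolding W_def
      by (intro integrable_divide Bochner_Integration.integrable_sum integrable_mult_right iz)
    have "(\<integral>\<^sup>+ a. ennreal (W m a) \<partial>M) = ennreal (\<integral>a. W m a \<partial>M)"
      using iW W0 by (intro nn_integral_eq_integral) auto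
    also have "(\<integral>a. W m a \<partial>M) = (\<Sum>j<(m+1)^4. (1/2)^m * (\<integral>a. z j (lab j a) / measure M (P j (lab j
        a)) \<partial>M)) / q m"
    proof -
      have "(\<integral>a. W m a \<partial>M) = (\<integral>a. (\<Sum>j<(m+1)^4. (1/2)^m * (z j (lab j a) / measure M (P j (lab j
          a)))) \<partial>M) / q m"
        unfolding W_def by simp
      also have "(\<integral>a. (\<Sum>j<(m+1)^4. (1/2)^m * (z j (lab j a) / measure M (P j (lab j a)))) \<partial>M)
         = (\<Sum>j<(m+1)^4. \<integral>a. (1/2)^m * (z j (lab j a) / measure M (P j (lab j a))) \<partial>M)"
        by (intro Bochner_Integration.integral_sum integrable_mult_right iz)
      also have "\<dots> = (\<Sum>j<(m+1)^4. (1/2)^m * (\<integral>a. z j (lab j a) / measure M (P j (lab j a)) \<partial>M))"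
        by (simp only: integral_mult_right_zero)
      finally show ?thesis .
    qed
    also have "\<dots> \<le> (\<Sum>j<(m+1)^4. (1/2)^m * Z) / q m"
      using q0[of m] by (intro divide_right_mono sum_mono mult_left_mono zint) auto
    also have "\<dots> = Z * (1/2)^m" using q0[of m] by (simp add: q_def)
    finally show "(\<integral>\<^sup>+ a. ennreal (W m a) \<partial>M) \<le> ennreal (Z * (1/2)^m)" by (simp add: ennreal_leI)
  qed (auto simp: W0)
  have E_le: "E j m a \<le> (1/2)^m * (z j (lab j a) / measure M (P j (lab j a))) + c" if a:
      "a \<in> space M" for j m a
  proof (cases "measure M (P j (lab j a)) = 0")
    case True
    then show ?thesis using c by (simp add: E_def e_def)
  next
    case False
    then have pos: "0 < measure M (P j (lab j a))" using measure_nonneg[of M "P j (lab j a)"]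
        by linarith
    have "(\<integral>a'. indicator (P j (lab j a)) a' * Y (j + N * m) a' \<partial>M)
        \<le> (1/2)^m * z j (lab j a) + c * measure M (P j (lab j a))"
      unfolding P_def using a by (intro cond) auto
    then have "E j m a \<le> ((1/2)^m * z j (lab j a) + c * measure M (P j (lab j a))) / measure M (P j
        (lab j a))"
      unfolding E_def e_def using pos by (intro divide_right_mono) auto
    also have "\<dots> = (1/2)^m * (z j (lab j a) / measure M (P j (lab j a))) + c" using pos
        by (simp add: field_simps)
    finally show ?thesis .
  qed
  show ?thesis
    using AE_V AE_W AE_space
  proof eventually_elim
    case (elim a)
    note V = elim(1) and W = elim(2) and a = elim(3)
    have "(\<lambda>m. sqrt ((V m a)^2)) \<longlonglongrightarrow> sqrt 0" by (intro tendsto_intros V)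
    then have V': "(\<lambda>m. V m a) \<longlonglongrightarrow> 0" by (simp add: tendsto_rabs_zero_iff)
    have Nq: "(\<lambda>m. real (N * m) / q m) \<longlonglongrightarrow> 0"
    proof -
      have "(\<lambda>m. real m / real ((m+1)^4)) \<longlonglongrightarrow> 0" by real_asymp
      from tendsto_mult_left[OF this, of "real N"] show ?thesis by (simp add: q_def)
    qed
    \<comment> \<open>The third error pays for the first \<open>N * m\<close> variables: they have
      no predecessor at this lag and are bounded by 1.\<close>
    define t where "t m = V m a + W m a + real (N * m) / q m" for m
    have t: "t \<longlonglongrightarrow> 0"
      unfolding t_def using tendsto_add[OF tendsto_add[OF V' W] Nq] by simp
    have main: "(\<Sum>i<(m+1)^4. Y i a) \<le> real ((m+1)^4) * (c + t m)" for m
    proof -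
      let ?n = "(m+1)^4"
      have "(\<Sum>i<?n. Y i a) \<le> (\<Sum>i<N*m + ?n. Y i a)"
        using Y0 by (intro sum_mono2) auto
      also have "\<dots> = (\<Sum>i<N*m. Y i a) + (\<Sum>i<?n. Y (i + N*m) a)"
        by (rule sum_lessThan_add_split)
      also have "(\<Sum>i<N*m. Y i a) \<le> (\<Sum>i<N*m. 1)" by (intro sum_mono Y1)
      also have "(\<Sum>i<?n. Y (i + N*m) a) = (\<Sum>i<?n. D i m a) + (\<Sum>i<?n. E i m a)"
        by (simp add: D_def sum.distrib[symmetric])
      also have "(\<Sum>i<?n. E i m a) \<le> (\<Sum>i<?n. (1/2)^m * (z i (lab i a) / measure M (P i (lab i
          a))) + c)"
        by (intro sum_mono E_le a)
      also have "\<dots> = q m * W m a + q m * c"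
        using q0[of m] by (simp add: W_def sum.distrib q_def)
      also have "(\<Sum>i<?n. D i m a) = q m * V m a" using q0[of m] by (simp add: V_def)
      finally have "(\<Sum>i<?n. Y i a) \<le> real (N*m) + (q m * V m a + (q m * W m a + q m * c))" by simp
      also have "\<dots> = q m * (c + t m)" using q0[of m] by (simp add: t_def field_simps)
      finally show ?thesis by (simp add: q_def)
    qed
    show "\<forall>\<eta>>0. \<forall>\<^sub>F n in sequentially. (\<Sum>i<n. Y i a) / real n \<le> c + \<eta>"
      using eventually_average_le_of_subseq[of "\<lambda>i. Y i a", OF Y0 t main] by blast
  qed
qed

section \<open>Expanding orbits and their cells\<close>

text \<open>\<open>True\<close> stands for the right branch. Both branches are closed and contain 0,
  so derivatives within a branch are the one-sided derivatives at the turning point.\<close>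

definition branch :: "real \<Rightarrow> bool \<Rightarrow> real set" where
  "branch K s = (if s then {0..1} else {-K..0})"

lemma branch_sign: "y \<in> {-K..1} \<Longrightarrow> y \<in> branch K (0 \<le> y)"
  by (auto simp: branch_def)

text \<open>Points on different branches are compared through 0, which lies between them, so that
  the two distances to 0 add up to |p - q|.\<close>

lemma branch_lipschitz_imp_lipschitz:
  fixes f :: "real \<Rightarrow> real"
  assumes K: "0 \<le> K" and p: "p \<in> {-K..1}" and q: "q \<in> {-K..1}"
    and br: "\<And>s p q. p \<in> branch K s \<Longrightarrow> q \<in> branch K s \<Longrightarrow> \<bar>f p - f q\<bar> \<le> C * \<bar>p - q\<bar>"
  shows "\<bar>f p - f q\<bar> \<le> C * \<bar>p - q\<bar>"
proof -
  have cross: "\<bar>f p - f q\<bar> \<le> C * \<bar>p - q\<bar>" if "p \<in> {-K..0}" "q \<in> {0..1}" for p q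
  proof -
    have "\<bar>f p - f 0\<bar> \<le> C * \<bar>p - 0\<bar>"
      using that K by (intro br[where s=False]) (auto simp: branch_def)
    moreover have "\<bar>f 0 - f q\<bar> \<le> C * \<bar>0 - q\<bar>"
      using that by (intro br[where s=True]) (auto simp: branch_def)
    moreover have eq: "\<bar>p - q\<bar> = \<bar>p - 0\<bar> + \<bar>0 - q\<bar>" using that by auto
    ultimately show ?thesis unfolding eq distrib_left by linarith
  qed
  consider "p \<le> 0 \<and> q \<le> 0" | "0 \<le> p \<and> 0 \<le> q" | "p \<le> 0 \<and> 0 \<le> q" | "q \<le> 0 \<and> 0 \<le> p"
    by linarith
  then show ?thesis
  proof cases
    case 1 then show ?thesis using p q by (intro br[where s=False]) (auto simp: branch_def)
  next
    case 2 then show ?thesis using p q by (intro br[where s=True]) (auto simp: branch_def)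
  next
    case 3 then show ?thesis using p q by (intro cross) auto
  next
    case 4
    then have "\<bar>f q - f p\<bar> \<le> C * \<bar>q - p\<bar>" using p q by (intro cross) auto
    then show ?thesis by (simp only: abs_minus_commute)
  qed
qed

text \<open>Covers both the parameter dependence \<open>x n a = T\<^sub>a\<^sup>n(x\<^sub>0(a))\<close> and, for \<open>F\<close> independent of the
  parameter and \<open>x 0 a = a\<close>, the dynamics of a single map. Derivatives with respect to the
  parameter are replaced by difference quotients; \<open>G s a\<close> is the derivative of \<open>F a\<close> on a branch.\<close>

locale expanding_orbits =
  fixes K L l M S Q Q' lam lo hi :: real
    and F :: "real \<Rightarrow> real \<Rightarrow> real" and G :: "bool \<Rightarrow> real \<Rightarrow> real \<Rightarrow> real" and x :: "nat \<Rightarrow> real \<Rightarrow> real"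
  assumes K0: "0 \<le> K" and L0: "0 \<le> L" and S0: "0 \<le> S" and Q0: "0 < Q" and Q'0: "0 < Q'"
    and lam: "lam = l - S / Q" "1 < lam" and lohi: "lo \<le> hi"
    and x_Suc: "\<And>a n. a \<in> {lo..hi} \<Longrightarrow> x (Suc n) a = F a (x n a)"
    and x_range: "\<And>a n. a \<in> {lo..hi} \<Longrightarrow> x n a \<in> {-K..1}"
    and F_mvt: "\<And>a s p q. a \<in> {lo..hi} \<Longrightarrow> p \<in> branch K s \<Longrightarrow> q \<in> branch K s
        \<Longrightarrow> \<exists>\<xi>\<in>closed_segment p q. F a p - F a q = G s a \<xi> * (p - q)"
    and G_bounds: "\<And>a s y. a \<in> {lo..hi} \<Longrightarrow> y \<in> branch K s \<Longrightarrow> l \<le> \<bar>G s a y\<bar> \<and> \<bar>G s a y\<bar> \<le> M"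
    and G_lip: "\<And>a b s y z. a \<in> {lo..hi} \<Longrightarrow> b \<in> {lo..hi} \<Longrightarrow> y \<in> branch K s \<Longrightarrow> z \<in> branch K s
        \<Longrightarrow> \<bar>G s a y - G s b z\<bar> \<le> L * (\<bar>a - b\<bar> + \<bar>y - z\<bar>)"
    and F_param: "\<And>a b n. a \<in> {lo..hi} \<Longrightarrow> b \<in> {lo..hi} \<Longrightarrow> \<bar>F a (x n b) - F b (x n b)\<bar> \<le> S * \<bar>a - b\<bar>"
    and x0_lower: "\<And>a b. a \<in> {lo..hi} \<Longrightarrow> b \<in> {lo..hi} \<Longrightarrow> Q * \<bar>a - b\<bar> \<le> \<bar>x 0 a - x 0 b\<bar>"
    and x0_upper: "\<And>a b. a \<in> {lo..hi} \<Longrightarrow> b \<in> {lo..hi} \<Longrightarrow> \<bar>x 0 a - x 0 b\<bar> \<le> Q' * \<bar>a - b\<bar>"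
begin

abbreviation I :: "real set" where "I \<equiv> {lo..hi}"

text \<open>The word records the times below \<open>n\<close> and omits time \<open>n\<close>
  itself: on a level-n cell \<open>x n\<close> is injective but may still take both signs. The
  turning point counts as lying on the right branch.\<close>

definition itin :: "nat \<Rightarrow> real \<Rightarrow> bool list" where
  "itin n a = map (\<lambda>i. 0 \<le> x i a) [0..<n]"

definition cell :: "nat \<Rightarrow> real \<Rightarrow> real set" where
  "cell n a = {b\<in>I. itin n b = itin n a}"

lemma itin_eq_iff: "itin n a = itin n b \<longleftrightarrow> (\<forall>i<n. (0 \<le> x i a) = (0 \<le> x i b))"
  by (auto simp: itin_def)

lemma itin_mono: "i \<le> j \<Longrightarrow> itin j a = itin j b \<Longrightarrow> itin i a = itin i b"
  by (auto simp: itin_eq_iff)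

lemma finite_itin: "finite (itin n ` A)"
proof (rule finite_subset)
  show "itin n ` A \<subseteq> {xs. set xs \<subseteq> UNIV \<and> length xs = n}" by (auto simp: itin_def)
  show "finite {xs :: bool list. set xs \<subseteq> UNIV \<and> length xs = n}"
      by (rule finite_lists_length_eq) simp
qed

lemma cell_self: "a \<in> I \<Longrightarrow> a \<in> cell n a"
  by (simp add: cell_def)

lemma cell_eqI: "b \<in> cell n a \<Longrightarrow> cell n b = cell n a"
  by (auto simp: cell_def)

lemma cell_subset_I: "cell n a \<subseteq> I"
  by (auto simp: cell_def)

lemma cell_I: "b \<in> cell n a \<Longrightarrow> b \<in> I"
  by (simp add: cell_def)

lemma cell_mono: "i \<le> j \<Longrightarrow> cell j a \<subseteq> cell i a"
  by (auto simp: cell_def dest: itin_mono)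

lemma cell_itin: "b \<in> cell n a \<Longrightarrow> c \<in> cell n a \<Longrightarrow> itin n b = itin n c"
  by (simp add: cell_def)

lemma l1: "1 < l"
  using lam S0 Q0 divide_nonneg_pos[of S Q] by linarith

lemma branch_segment: "p \<in> branch K s \<Longrightarrow> q \<in> branch K s \<Longrightarrow> \<xi> \<in> closed_segment p q \<Longrightarrow> \<xi> \<in> branch K s"
  by (auto simp: branch_def closed_segment_eq_real_ivl split: if_splits)

lemma M1: "1 < M"
proof -
  have "0 \<in> branch K True" by (simp add: branch_def)
  then show ?thesis using G_bounds[of lo 0 True] lohi l1 by auto
qed

lemma F_lip_branch:
  assumes "a \<in> I" "p \<in> branch K s" "q \<in> branch K s"
  shows "l * \<bar>p - q\<bar> \<le> \<bar>F a p - F a q\<bar>" "\<bar>F a p - F a q\<bar> \<le> M * \<bar>p - q\<bar>"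
proof -
  obtain \<xi> where \<xi>: "\<xi> \<in> closed_segment p q" "F a p - F a q = G s a \<xi> * (p - q)"
    using F_mvt[OF assms] by blast
  have "l \<le> \<bar>G s a \<xi>\<bar>" "\<bar>G s a \<xi>\<bar> \<le> M"
    using G_bounds[OF assms(1) branch_segment[OF assms(2,3) \<xi>(1)]] by auto
  then show "l * \<bar>p - q\<bar> \<le> \<bar>F a p - F a q\<bar>" "\<bar>F a p - F a q\<bar> \<le> M * \<bar>p - q\<bar>"
    unfolding \<xi>(2) abs_mult by (auto intro: mult_right_mono)
qed

lemma F_lip:
  assumes "a \<in> I" "p \<in> {-K..1}" "q \<in> {-K..1}"
  shows "\<bar>F a p - F a q\<bar> \<le> M * \<bar>p - q\<bar>"
  by (rule branch_lipschitz_imp_lipschitz[OF K0 assms(2,3)]) (rule F_lip_branch(2)[OF assms(1)])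

lemma x_upper_step:
  assumes a: "a \<in> I" and b: "b \<in> I"
  shows "\<bar>x (Suc n) a - x (Suc n) b\<bar> \<le> M * \<bar>x n a - x n b\<bar> + S * \<bar>a - b\<bar>"
proof -
  have "\<bar>F a (x n a) - F a (x n b)\<bar> \<le> M * \<bar>x n a - x n b\<bar>"
      by (rule F_lip[OF a x_range[OF a] x_range[OF b]])
  moreover have "\<bar>F a (x n b) - F b (x n b)\<bar> \<le> S * \<bar>a - b\<bar>" by (rule F_param[OF a b])
  ultimately show ?thesis unfolding x_Suc[OF a] x_Suc[OF b] by linarith
qed

lemma x_lipschitz: "\<exists>C. \<forall>a\<in>I. \<forall>b\<in>I. \<bar>x n a - x n b\<bar> \<le> C * \<bar>a - b\<bar>"
proof (induction n)
  case 0 then show ?case using x0_upper by blast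
next
  case (Suc n)
  then obtain C where C: "\<And>a b. a \<in> I \<Longrightarrow> b \<in> I \<Longrightarrow> \<bar>x n a - x n b\<bar> \<le> C * \<bar>a - b\<bar>" by blast
  have "\<bar>x (Suc n) a - x (Suc n) b\<bar> \<le> (M * C + S) * \<bar>a - b\<bar>" if "a \<in> I" "b \<in> I" for a b
  proof -
    have "M * \<bar>x n a - x n b\<bar> \<le> M * (C * \<bar>a - b\<bar>)" using C[OF that] M1
        by (intro mult_left_mono) auto
    then show ?thesis using x_upper_step[OF that, of n] by (simp add: algebra_simps)
  qed
  then show ?case by blast
qed

lemma x_continuous: "continuous_on I (x n)"
proof -
  obtain C where C: "\<And>a b. a \<in> I \<Longrightarrow> b \<in> I \<Longrightarrow> \<bar>x n a - x n b\<bar> \<le> C * \<bar>a - b\<bar>" using x_lipschitz[of n]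
      by blast
  have "\<bar>C\<bar>-lipschitz_on I (x n)"
  proof (rule lipschitz_onI)
    fix a b assume "a \<in> I" "b \<in> I"
    then have "\<bar>x n a - x n b\<bar> \<le> C * \<bar>a - b\<bar>" by (rule C)
    also have "\<dots> \<le> \<bar>C\<bar> * \<bar>a - b\<bar>" by (intro mult_right_mono) auto
    finally show "dist (x n a) (x n b) \<le> \<bar>C\<bar> * dist a b" by (simp add: dist_real_def)
  qed simp
  then show ?thesis by (rule lipschitz_on_continuous_on)
qed

text \<open>The parameter term \<open>S * |a - b|\<close> is at most the fraction
  \<open>S / Q\<close> of the current distance of the orbit points. Subtracting it from the branch
  expansion \<open>l\<close> leaves exactly \<open>lam\<close>.\<close>

lemma expand_step:
  assumes a: "a \<in> I" and b: "b \<in> I" and s: "(0 \<le> x n a) = (0 \<le> x n b)"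
    and Q: "Q * \<bar>a - b\<bar> \<le> \<bar>x n a - x n b\<bar>"
  shows "lam * \<bar>x n a - x n b\<bar> \<le> \<bar>x (Suc n) a - x (Suc n) b\<bar>"
proof -
  have "x n a \<in> branch K (0 \<le> x n a)" "x n b \<in> branch K (0 \<le> x n a)"
    using branch_sign[OF x_range[OF a, of n]] branch_sign[OF x_range[OF b, of n]] s by auto
  then have "l * \<bar>x n a - x n b\<bar> \<le> \<bar>F a (x n a) - F a (x n b)\<bar>" by (rule F_lip_branch(1)[OF a])
  moreover have "\<bar>F a (x n b) - F b (x n b)\<bar> \<le> S * \<bar>a - b\<bar>" by (rule F_param[OF a b])
  moreover have "S * \<bar>a - b\<bar> \<le> S / Q * \<bar>x n a - x n b\<bar>"
  proof -
    have "S / Q * (Q * \<bar>a - b\<bar>) \<le> S / Q * \<bar>x n a - x n b\<bar>" using Q S0 Q0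
        by (intro mult_left_mono) auto
    then show ?thesis using Q0 by simp
  qed
  ultimately have "l * \<bar>x n a - x n b\<bar> - S / Q * \<bar>x n a - x n b\<bar> \<le> \<bar>F a (x n a) - F b (x n b)\<bar>"
      by linarith
  then show ?thesis unfolding x_Suc[OF a] x_Suc[OF b] lam(1) left_diff_distrib .
qed

text \<open>As \<open>lam ^ n\<close> is at least 1, the bound reached at time \<open>n\<close>
  contains the hypothesis with slope \<open>Q\<close> that \<open>expand_step\<close> needs for the
  next step.\<close>

lemma expand:
  assumes a: "a \<in> I" and b: "b \<in> I"
  shows "itin n a = itin n b \<Longrightarrow> Q * lam ^ n * \<bar>a - b\<bar> \<le> \<bar>x n a - x n b\<bar>"
proof (induction n)
  case 0 then show ?case using x0_lower[OF a b] by simp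
next
  case (Suc n)
  then have it: "itin n a = itin n b" and s: "(0 \<le> x n a) = (0 \<le> x n b)" by (auto simp: itin_eq_iff)
  have IH: "Q * lam ^ n * \<bar>a - b\<bar> \<le> \<bar>x n a - x n b\<bar>" by (rule Suc.IH[OF it])
  have "Q * \<bar>a - b\<bar> * 1 \<le> Q * \<bar>a - b\<bar> * lam ^ n" using Q0 lam
      by (intro mult_left_mono one_le_power) auto
  then have "Q * \<bar>a - b\<bar> \<le> \<bar>x n a - x n b\<bar>" using IH by (simp add: mult_ac)
  then have "lam * \<bar>x n a - x n b\<bar> \<le> \<bar>x (Suc n) a - x (Suc n) b\<bar>" by (rule expand_step[OF a b s])
  moreover have "lam * (Q * lam ^ n * \<bar>a - b\<bar>) \<le> lam * \<bar>x n a - x n b\<bar>" using IH lam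
      by (intro mult_left_mono) auto
  ultimately show ?case by (simp add: mult_ac)
qed

lemma expand_Q:
  assumes "a \<in> I" "b \<in> I" "itin n a = itin n b"
  shows "Q * \<bar>a - b\<bar> \<le> \<bar>x n a - x n b\<bar>"
proof -
  have "Q * \<bar>a - b\<bar> * 1 \<le> Q * \<bar>a - b\<bar> * lam ^ n" using Q0 lam
      by (intro mult_left_mono one_le_power) auto
  then show ?thesis using expand[OF assms] by (simp add: mult_ac)
qed

lemma expand_from:
  assumes a: "a \<in> I" and b: "b \<in> I"
  shows "itin (m + k) a = itin (m + k) b \<Longrightarrow> lam ^ k * \<bar>x m a - x m b\<bar> \<le> \<bar>x (m + k) a - x (m + k) b\<bar>"
proof (induction k)
  case 0 then show ?case by simp
next
  case (Suc k)
  then have it: "itin (m + k) a = itin (m + k) b" and s: "(0 \<le> x (m+k) a) = (0 \<le> x (m+k) b)"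
      by (auto simp: itin_eq_iff)
  have "lam * \<bar>x (m+k) a - x (m+k) b\<bar> \<le> \<bar>x (Suc (m+k)) a - x (Suc (m+k)) b\<bar>"
    by (rule expand_step[OF a b s expand_Q[OF a b it]])
  moreover have "lam * (lam ^ k * \<bar>x m a - x m b\<bar>) \<le> lam * \<bar>x (m+k) a - x (m+k) b\<bar>" 
    using Suc.IH[OF it] lam by (intro mult_left_mono) auto
  ultimately show ?case by (simp add: mult_ac)
qed

lemma x_diff_le:
  assumes "a \<in> I" "b \<in> I"
  shows "\<bar>x n a - x n b\<bar> \<le> K + 1"
  using x_range[OF assms(1), of n] x_range[OF assms(2), of n] by auto

text \<open>Expansion read backwards: the distance at time \<open>n\<close> is at most the diameter
  \<open>K + 1\<close>, and \<open>n - m\<close> steps with a common itinerary have multiplied the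
  earlier distance by at least \<open>lam ^ (n - m)\<close>.\<close>

lemma contract:
  assumes a: "a \<in> I" and b: "b \<in> I" and it: "itin n a = itin n b" and mn: "m \<le> n"
  shows "\<bar>x m a - x m b\<bar> \<le> (K + 1) * (1 / lam) ^ (n - m)"
proof -
  have "lam ^ (n - m) * \<bar>x m a - x m b\<bar> \<le> \<bar>x (m + (n - m)) a - x (m + (n - m)) b\<bar>"
    using it mn by (intro expand_from[OF a b]) auto
  also have "\<dots> \<le> K + 1" by (rule x_diff_le[OF a b])
  finally show ?thesis using lam(2) by (simp add: power_divide field_simps)
qed

text \<open>For a fixed itinerary the point \<open>x n\<close> is injective in the parameter, so a
  level set embeds into the finite set of words. This makes the periodic parameters
  countable.\<close>

lemma finite_level_set: "finite {a\<in>I. x n a = y}"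
proof (rule finite_imageD[OF finite_itin])
  show "inj_on (itin n) {a\<in>I. x n a = y}"
  proof (rule inj_onI)
    fix a b assume a: "a \<in> {a\<in>I. x n a = y}" and b: "b \<in> {a\<in>I. x n a = y}" and it: "itin n a
        = itin n b"
    have "Q * \<bar>a - b\<bar> \<le> \<bar>x n a - x n b\<bar>" by (rule expand_Q[OF _ _ it]) (use a b in blast)+
    then show "a = b" using a b Q0 by (simp add: mult_le_0_iff)
  qed
qed

text \<open>Between two points of the cell \<open>x n\<close> is continuous and, by expansion,
  injective, hence monotone. A value between two values of the same sign keeps that sign, so the
  next cut leaves an interval.\<close>

lemma cell_between:
  assumes b: "b \<in> cell n a" and c: "c \<in> cell n a" and d: "b \<le> d" "d \<le> c"
  shows "d \<in> cell n a"
  using b c d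
proof (induction n arbitrary: b c d)
  case 0
  then show ?case by (auto simp: cell_def itin_def)
next
  case (Suc n)
  have bn: "b \<in> cell n a" "c \<in> cell n a" using Suc.prems cell_mono[of n "Suc n" a] by auto
  have dn: "d \<in> cell n a" by (rule Suc.IH[OF bn Suc.prems(3,4)])
  show ?case
  proof (cases "d = b \<or> d = c")
    case True then show ?thesis using Suc.prems by auto
  next
    case False
    then have dd: "b < d" "d < c" using Suc.prems(3,4) by auto
    have sub: "{b..c} \<subseteq> I" using bn cell_subset_I by (auto simp: cell_def)
    have "continuous_on {b..c} (x n)" by (rule continuous_on_subset[OF x_continuous sub])
    moreover have "inj_on (x n) {b..c}"
    proof (rule inj_onI)
      fix u v assume u: "u \<in> {b..c}" and v: "v \<in> {b..c}" and eq: "x n u = x n v"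
      have "u \<in> cell n a" "v \<in> cell n a"
        using u v Suc.IH[OF bn, of u] Suc.IH[OF bn, of v] by auto
      then show "u = v" using expand_Q[of u v n] eq Q0 cell_subset_I
          by (auto simp: cell_def mult_le_0_iff)
    qed
    ultimately have "(x n b < x n d \<and> x n d < x n c) \<or> (x n c < x n d \<and> x n d < x n b)"
      using continuous_inj_imp_mono[OF dd] by blast
    moreover have "(0 \<le> x n b) = (0 \<le> x n c)"
      using cell_itin[OF Suc.prems(1,2)] by (auto simp: itin_eq_iff)
    ultimately have "(0 \<le> x n d) = (0 \<le> x n b)" by auto
    moreover have "(0 \<le> x n b) = (0 \<le> x n a)" using Suc.prems by (auto simp: cell_def itin_eq_iff)
    ultimately show ?thesis using dn by (auto simp: cell_def itin_eq_iff less_Suc_eq)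
  qed
qed

end

text \<open>The turning point has no return to itself up to time \<open>N\<close>, where the expansion \<open>lam ^ N\<close>
  beats the factor 2 lost by cutting a short interval once.\<close>

locale expanding_family = expanding_orbits +
  fixes \<kappa> :: real and N :: nat
  assumes \<kappa>0: "0 < \<kappa>" and N1: "1 \<le> N" and lamN: "4 \<le> lam ^ N"
    and turn_range: "\<And>a i. a \<in> {lo..hi} \<Longrightarrow> (F a ^^ i) 0 \<in> {-K..1}"
    and turn_away: "\<And>a i. a \<in> {lo..hi} \<Longrightarrow> 1 \<le> i \<Longrightarrow> i \<le> N \<Longrightarrow> \<kappa> \<le> \<bar>(F a ^^ i) 0\<bar>"
    and turn_sign: "\<And>a b i. a \<in> {lo..hi} \<Longrightarrow> b \<in> {lo..hi} \<Longrightarrow> 1 \<le> i \<Longrightarrow> i \<le> N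
        \<Longrightarrow> 0 \<le> (F a ^^ i) 0 \<longleftrightarrow> 0 \<le> (F b ^^ i) 0"

lemma emeasure_le_diameter:
  fixes A :: "real set"
  assumes A: "A \<in> sets borel" and d: "\<And>c d. c \<in> A \<Longrightarrow> d \<in> A \<Longrightarrow> \<bar>c - d\<bar> \<le> B"
  shows "emeasure lborel A \<le> ennreal B"
proof (cases "A = {}")
  case False
  then obtain c0 where c0: "c0 \<in> A" by blast
  have B0: "0 \<le> B" using d[OF c0 c0] by simp
  have low: "e - B \<le> c" if "c \<in> A" "e \<in> A" for c e
    using d[OF that] by linarith
  have bdd: "bdd_below A" by (rule bdd_belowI[of _ "c0 - B"]) (rule low[OF _ c0])
  have "A \<subseteq> {Inf A..Inf A + B}"
  proof
    fix e assume e: "e \<in> A"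
    have "e - B \<le> Inf A"
      by (rule cInf_greatest[OF False]) (rule low[OF _ e])
    moreover have "Inf A \<le> e" by (rule cInf_lower[OF e bdd])
    ultimately show "e \<in> {Inf A..Inf A + B}" by auto
  qed
  then have "emeasure lborel A \<le> emeasure lborel {Inf A..Inf A + B}" by (intro emeasure_mono) auto
  then show ?thesis using B0 by simp
qed simp

lemma abs_diff_triangle: "\<bar>p\<bar> - \<bar>q\<bar> \<le> \<bar>p + q\<bar>" for p q :: real
  by linarith

section \<open>Bounded distortion on cells\<close>

context expanding_orbits
begin

definition \<rho> :: real where "\<rho> = 1 / lam"
text \<open>The first part is the variation of the slope \<open>G\<close> between two pairs in a
  common cell: \<open>(K + 1) / Q\<close> bounds their parameter distance, and 3 counts the hops
  from one intermediate point to an orbit point, across to the other pair, and on to its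
  intermediate point. The part \<open>2 * S / Q\<close> comes from the parameter term in both
  numerator and denominator.\<close>

definition step_const :: real where "step_const = L * ((K + 1) / Q + 3 * (K + 1)) + 2 * S / Q"
text \<open>\<open>Q' / Q\<close> is the distortion at time 0, and the exponent is the bound of
  \<open>geometric_sums_le\<close> for all one-step errors together.\<close>

definition distortion_const :: real where "distortion_const
    = Q' / Q * exp (2 * step_const / (1 - \<rho>))"

lemma \<rho>: "0 < \<rho>" "\<rho> < 1"
  using lam(2) by (auto simp: \<rho>_def)

lemma step_const_nonneg: "0 \<le> step_const"
  using K0 L0 S0 Q0 by (simp add: step_const_def)

lemma distortion_const_pos: "0 < distortion_const"
  using Q0 Q'0 by (simp add: distortion_const_def)

lemma geometric_sums_le: "(\<Sum>i<n. step_const * (\<rho> ^ (n - i) + \<rho> ^ i)) \<le> 2 * step_const / (1 - \<rho>)"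
proof -
  have *: "(\<Sum>i<n. \<rho> ^ i) \<le> 1 / (1 - \<rho>)"
  proof -
    have "(\<Sum>i<n. \<rho> ^ i) = (1 - \<rho> ^ n) / (1 - \<rho>)" using \<rho> by (simp add: sum_gp_strict)
    also have "\<dots> \<le> 1 / (1 - \<rho>)" using \<rho> by (intro divide_right_mono) auto
    finally show ?thesis .
  qed
  have "(\<Sum>i<n. \<rho> ^ (n - i)) = (\<Sum>i<n. \<rho> ^ Suc i)"
    by (rule sum.reindex_bij_witness[where i="\<lambda>i. n - Suc i"
      and j="\<lambda>i. n - Suc i"]) (auto simp: Suc_diff_Suc simp del: power_Suc)
  also have "\<dots> \<le> (\<Sum>i<n. \<rho> ^ i)" using \<rho> by (intro sum_mono power_decreasing) auto
  finally have "(\<Sum>i<n. \<rho> ^ (n - i) + \<rho> ^ i) \<le> 2 / (1 - \<rho>)" using * by (simp add: sum.distrib)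
  then have "step_const * (\<Sum>i<n. \<rho> ^ (n - i) + \<rho> ^ i) \<le> step_const * (2 / (1 - \<rho>))"
    using step_const_nonneg by (intro mult_left_mono)
  then show ?thesis by (simp add: sum_distrib_left mult_ac)
qed

text \<open>Once the difference quotients of \<open>x m\<close> grow like \<open>lam ^ m\<close>, the inhomogeneous term coming from
  the parameter dependence of \<open>F\<close> is a geometrically small relative error.\<close>

lemma distortion_step:
  assumes cell: "a \<in> cell n e" "b \<in> cell n e" "c \<in> cell n e" "d \<in> cell n e" and m: "m < n"
    and C: "0 < C" and IH: "\<bar>x m c - x m d\<bar> * \<bar>a - b\<bar> \<le> C * (\<bar>c - d\<bar> * \<bar>x m a - x m b\<bar>)"
  shows "\<bar>x (Suc m) c - x (Suc m) d\<bar> * \<bar>a - b\<bar>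
    \<le> C * exp (step_const * (\<rho> ^ (n - m) + \<rho> ^ m)) * (\<bar>c - d\<bar> * \<bar>x (Suc m) a - x (Suc m) b\<bar>)"
proof -
  have inI: "a \<in> I" "b \<in> I" "c \<in> I" "d \<in> I" using cell cell_subset_I by blast+
  have it: "itin n u = itin n v" if "u \<in> {a,b,c,d}" "v \<in> {a,b,c,d}" for u v
    by (rule cell_itin[of _ n e]) (use that cell in auto)
  have itm: "itin m u = itin m v" if "u \<in> {a,b,c,d}" "v \<in> {a,b,c,d}" for u v
    by (rule itin_mono[OF less_imp_le[OF m] it[OF that]])
  define s where "s = (0 \<le> x m a)"
  have br: "x m u \<in> branch K s" if u: "u \<in> {a,b,c,d}" for u
  proof -
    have "u \<in> I" using u inI by auto
    moreover have "(0 \<le> x m u) = s" using it[OF u, of a] m by (auto simp: s_def itin_eq_iff)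
    ultimately show ?thesis using branch_sign[OF x_range[of u m]] by auto
  qed
  have near: "\<bar>x m u - x m v\<bar> \<le> (K + 1) * \<rho> ^ (n - m)" if "u \<in> {a,b,c,d}" "v \<in> {a,b,c,d}" for u v
    using contract[of u v n m] it[OF that] that inI m by (auto simp: \<rho>_def)
  obtain \<xi> where \<xi>: "\<xi> \<in> closed_segment (x m a) (x m b)" "F a (x m a) - F a (x m b)
      = G s a \<xi> * (x m a - x m b)"
    using F_mvt[OF inI(1) br br, of a b] by auto
  obtain \<zeta> where \<zeta>: "\<zeta> \<in> closed_segment (x m c) (x m d)" "F c (x m c) - F c (x m d)
      = G s c \<zeta> * (x m c - x m d)"
    using F_mvt[OF inI(3) br br, of c d] by auto
  have \<xi>b: "\<xi> \<in> branch K s" and \<zeta>b: "\<zeta> \<in> branch K s"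
    using branch_segment[OF br br \<xi>(1)] branch_segment[OF br br \<zeta>(1)] by auto
  define \<sigma> where "\<sigma> = \<bar>G s a \<xi>\<bar>"
  define \<tau> where "\<tau> = \<bar>G s c \<zeta>\<bar>"
  \<comment> \<open>The relative size of the parameter term at time \<open>m\<close>:
    \<open>S * |a - b|\<close> is compared with an orbit distance that has grown to at least
    \<open>Q * lam ^ m * |a - b|\<close>.\<close>
  define \<epsilon> where "\<epsilon> = S / Q * \<rho> ^ m"
  define h where "h = step_const * (\<rho> ^ (n - m) + \<rho> ^ m)"
  have h0: "0 \<le> h" using step_const_nonneg \<rho> by (simp add: h_def)
  have ac: "\<bar>a - c\<bar> \<le> (K + 1) / Q * \<rho> ^ (n - m)"
  proof -
    have "Q * \<bar>a - c\<bar> \<le> \<bar>x m a - x m c\<bar>" using expand_Q[OF inI(1,3) itm] by auto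
    also have "\<dots> \<le> (K + 1) * \<rho> ^ (n - m)" by (rule near) auto
    finally show ?thesis using Q0 by (simp add: field_simps)
  qed
  have seg: "\<bar>y - u\<bar> \<le> \<bar>u - v\<bar>" if "y \<in> closed_segment u v" for y u v :: real
    using that by (auto simp: closed_segment_eq_real_ivl split: if_splits)
  have \<xi>\<zeta>: "\<bar>\<xi> - \<zeta>\<bar> \<le> 3 * (K + 1) * \<rho> ^ (n - m)"
  proof -
    have "\<bar>\<xi> - x m a\<bar> \<le> (K + 1) * \<rho> ^ (n - m)" using seg[OF \<xi>(1)] near[of a b] by auto
    moreover have "\<bar>\<zeta> - x m c\<bar> \<le> (K + 1) * \<rho> ^ (n - m)" using seg[OF \<zeta>(1)] near[of c d] by auto
    moreover have "\<bar>x m a - x m c\<bar> \<le> (K + 1) * \<rho> ^ (n - m)" using near[of a c] by auto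
    ultimately show ?thesis unfolding mult.assoc by linarith
  qed
  have \<tau>\<sigma>: "\<tau> + 2 * \<epsilon> \<le> \<sigma> + h"
  proof -
    have "\<tau> - \<sigma> \<le> \<bar>G s a \<xi> - G s c \<zeta>\<bar>" by (simp add: \<tau>_def \<sigma>_def)
    also have "\<dots> \<le> L * (\<bar>a - c\<bar> + \<bar>\<xi> - \<zeta>\<bar>)" by (rule G_lip[OF inI(1,3) \<xi>b \<zeta>b])
    also have "\<dots> \<le> L * ((K + 1) / Q * \<rho> ^ (n - m) + 3 * (K + 1) * \<rho> ^ (n - m))"
      using ac \<xi>\<zeta> L0 by (intro mult_left_mono add_mono) auto
    also have "\<dots> = (L * ((K + 1) / Q + 3 * (K + 1))) * \<rho> ^ (n - m)" by (simp add: algebra_simps)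
    also have "\<dots> \<le> step_const * \<rho> ^ (n - m)"
      using \<rho> S0 Q0 by (intro mult_right_mono) (auto simp: step_const_def)
    finally have "\<tau> - \<sigma> \<le> step_const * \<rho> ^ (n - m)" .
    moreover have "2 * \<epsilon> \<le> step_const * \<rho> ^ m"
    proof -
      have "2 * \<epsilon> = (2 * S / Q) * \<rho> ^ m" by (simp add: \<epsilon>_def)
      also have "\<dots> \<le> step_const * \<rho> ^ m" using \<rho> K0 L0 Q0
          by (intro mult_right_mono) (auto simp: step_const_def)
      finally show ?thesis .
    qed
    ultimately show ?thesis by (simp add: h_def algebra_simps)
  qed
  \<comment> \<open>Cross products in place of the two difference quotients, so that coinciding
    points need no separate case; \<open>w\<close> is the common parameter term, small relative to
    both \<open>u\<close> and \<open>v\<close>.\<close>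
  define u where "u = \<bar>x m c - x m d\<bar> * \<bar>a - b\<bar>"
  define v where "v = \<bar>c - d\<bar> * \<bar>x m a - x m b\<bar>"
  define w where "w = S * (\<bar>a - b\<bar> * \<bar>c - d\<bar>)"
  have uv: "u \<le> C * v" using IH by (simp add: u_def v_def)
  have v0: "0 \<le> v" by (simp add: v_def)
  have \<rho>m: "\<rho> ^ m * lam ^ m = 1" using lam(2) by (simp add: \<rho>_def power_mult_distrib[symmetric])
  have w_le: "w \<le> \<epsilon> * t" if t: "Q * lam ^ m * (\<bar>a - b\<bar> * \<bar>c - d\<bar>) \<le> t" for t
  proof -
    have "\<epsilon> * (Q * lam ^ m * (\<bar>a - b\<bar> * \<bar>c - d\<bar>)) \<le> \<epsilon> * t"
      using t S0 Q0 \<rho> by (intro mult_left_mono) (auto simp: \<epsilon>_def)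
    moreover have "\<epsilon> * (Q * lam ^ m * (\<bar>a - b\<bar> * \<bar>c - d\<bar>)) = w * (\<rho> ^ m * lam ^ m)"
      using Q0 by (simp add: \<epsilon>_def w_def)
    ultimately show ?thesis by (simp add: \<rho>m)
  qed
  have wv: "w \<le> \<epsilon> * v"
  proof (rule w_le)
    have "Q * lam ^ m * \<bar>a - b\<bar> * \<bar>c - d\<bar> \<le> \<bar>x m a - x m b\<bar> * \<bar>c - d\<bar>"
      using expand[OF inI(1,2) itm] by (intro mult_right_mono) auto
    then show "Q * lam ^ m * (\<bar>a - b\<bar> * \<bar>c - d\<bar>) \<le> v" by (simp add: v_def mult_ac)
  qed
  have wu: "w \<le> \<epsilon> * u"
  proof (rule w_le)
    have "Q * lam ^ m * \<bar>c - d\<bar> * \<bar>a - b\<bar> \<le> \<bar>x m c - x m d\<bar> * \<bar>a - b\<bar>"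
      using expand[OF inI(3,4) itm] by (intro mult_right_mono) auto
    then show "Q * lam ^ m * (\<bar>a - b\<bar> * \<bar>c - d\<bar>) \<le> u" by (simp add: u_def mult_ac)
  qed
  have \<epsilon>0: "0 \<le> \<epsilon>" using S0 Q0 \<rho> by (simp add: \<epsilon>_def)
  have \<sigma>l: "l \<le> \<sigma>" using G_bounds[OF inI(1) \<xi>b] by (simp add: \<sigma>_def)
  have \<epsilon>S: "\<epsilon> \<le> S / Q"
  proof -
    have "S / Q * \<rho> ^ m \<le> S / Q * 1" using S0 Q0 \<rho> by (intro mult_left_mono power_le_one) auto
    then show ?thesis by (simp add: \<epsilon>_def)
  qed
  have low: "\<sigma> * v - w \<le> \<bar>c - d\<bar> * \<bar>x (Suc m) a - x (Suc m) b\<bar>"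
  proof -
    have "\<sigma> * \<bar>x m a - x m b\<bar> - S * \<bar>a - b\<bar>
        \<le> \<bar>F a (x m a) - F a (x m b)\<bar> - \<bar>F a (x m b) - F b (x m b)\<bar>"
      by (rule diff_mono[OF _ F_param[OF inI(1,2)]]) (simp add: \<xi>(2) abs_mult \<sigma>_def)
    also have "\<dots> \<le> \<bar>(F a (x m a) - F a (x m b)) + (F a (x m b) - F b (x m b))\<bar>"
        by (rule abs_diff_triangle)
    also have "\<dots> = \<bar>x (Suc m) a - x (Suc m) b\<bar>" unfolding x_Suc[OF inI(1)] x_Suc[OF inI(2)] by simp
    finally have "\<sigma> * \<bar>x m a - x m b\<bar> - S * \<bar>a - b\<bar> \<le> \<bar>x (Suc m) a - x (Suc m) b\<bar>" .
    then have "\<bar>c - d\<bar> * (\<sigma> * \<bar>x m a - x m b\<bar> - S * \<bar>a - b\<bar>)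
        \<le> \<bar>c - d\<bar> * \<bar>x (Suc m) a - x (Suc m) b\<bar>"
      by (intro mult_left_mono) auto
    then show ?thesis by (simp only: v_def w_def right_diff_distrib mult_ac)
  qed
  have up: "\<bar>x (Suc m) c - x (Suc m) d\<bar> * \<bar>a - b\<bar> \<le> \<tau> * u + w"
  proof -
    have "\<bar>x (Suc m) c - x (Suc m) d\<bar> = \<bar>(F c (x m c) - F c (x m d)) + (F c (x m d) - F d (x m d))\<bar>"
      unfolding x_Suc[OF inI(3)] x_Suc[OF inI(4)] by simp
    also have "\<dots> \<le> \<bar>F c (x m c) - F c (x m d)\<bar> + \<bar>F c (x m d) - F d (x m d)\<bar>"
        by (rule abs_triangle_ineq)
    also have "\<dots> \<le> \<tau> * \<bar>x m c - x m d\<bar> + S * \<bar>c - d\<bar>"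
      by (rule add_mono[OF _ F_param[OF inI(3,4)]]) (simp add: \<zeta>(2) abs_mult \<tau>_def)
    finally have "\<bar>x (Suc m) c - x (Suc m) d\<bar> \<le> \<tau> * \<bar>x m c - x m d\<bar> + S * \<bar>c - d\<bar>" .
    then have "\<bar>x (Suc m) c - x (Suc m) d\<bar> * \<bar>a - b\<bar>
        \<le> (\<tau> * \<bar>x m c - x m d\<bar> + S * \<bar>c - d\<bar>) * \<bar>a - b\<bar>"
      by (intro mult_right_mono) auto
    then show ?thesis by (simp only: u_def w_def distrib_left distrib_right mult_ac)
  qed
  have \<tau>0: "0 \<le> \<tau>" by (simp add: \<tau>_def)
  \<comment> \<open>The reduced slope \<open>\<sigma> - \<epsilon>\<close> is at least
    \<open>l - S / Q\<close>, hence above 1. This lets the error \<open>h * v\<close> be absorbed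
    into \<open>h * (\<sigma> * v - w)\<close>.\<close>
  have v_le: "v \<le> \<sigma> * v - w"
  proof -
    have "1 * v \<le> (\<sigma> - \<epsilon>) * v" using v0 \<sigma>l \<epsilon>S lam by (intro mult_right_mono) auto
    then show ?thesis using wv by (simp add: algebra_simps)
  qed
  have "\<tau> * u + w \<le> (\<tau> + \<epsilon>) * u" using wu by (simp add: algebra_simps)
  also have "\<dots> \<le> (\<tau> + \<epsilon>) * (C * v)" using uv \<tau>0 \<epsilon>0 by (intro mult_left_mono) auto
  also have "\<dots> = C * ((\<tau> + \<epsilon>) * v)" by simp
  also have "\<dots> \<le> C * ((1 + h) * (\<sigma> * v - w))"
  proof (intro mult_left_mono)
    have "(\<tau> + \<epsilon>) * v \<le> (\<sigma> + h - \<epsilon>) * v" using \<tau>\<sigma> v0 by (intro mult_right_mono) auto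
    also have "\<dots> = \<sigma> * v - \<epsilon> * v + h * v" by (simp add: algebra_simps)
    also have "\<dots> \<le> (\<sigma> * v - w) + h * (\<sigma> * v - w)" using wv mult_left_mono[OF v_le h0] by linarith
    finally show "(\<tau> + \<epsilon>) * v \<le> (1 + h) * (\<sigma> * v - w)" by (simp add: algebra_simps)
  qed (use C in auto)
  also have "\<dots> \<le> C * (exp h * (\<bar>c - d\<bar> * \<bar>x (Suc m) a - x (Suc m) b\<bar>))"
  proof (rule mult_left_mono)
    have "0 \<le> \<sigma> * v - w" using v_le v0 by linarith
    then show "(1 + h) * (\<sigma> * v - w) \<le> exp h * (\<bar>c - d\<bar> * \<bar>x (Suc m) a - x (Suc m) b\<bar>)"
      using low h0 by (intro mult_mono) auto
  qed (use C in simp)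
  finally show ?thesis using up unfolding h_def mult.assoc by (rule order_trans[rotated])
qed

text \<open>The one-step errors are summable from both ends: slopes agree better the longer the
  orbits still stay together, which gives \<open>\<rho> ^ (n - i)\<close>, and the parameter term
  loses weight as the quotients grow, which gives \<open>\<rho> ^ i\<close>.\<close>

lemma distortion:
  assumes cell: "a \<in> cell n e" "b \<in> cell n e" "c \<in> cell n e" "d \<in> cell n e"
  shows "\<bar>x n c - x n d\<bar> * \<bar>a - b\<bar> \<le> distortion_const * (\<bar>c - d\<bar> * \<bar>x n a - x n b\<bar>)"
proof -
  have inI: "a \<in> I" "b \<in> I" "c \<in> I" "d \<in> I" using cell cell_subset_I by blast+
  have "\<bar>x m c - x m d\<bar> * \<bar>a - b\<bar> \<le> Q' / Q * exp (\<Sum>i<m. step_const * (\<rho> ^ (n - i) + \<rho> ^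
      i)) * (\<bar>c - d\<bar> * \<bar>x m a - x m b\<bar>)"
    if "m \<le> n" for m
    using that
  proof (induction m)
    case 0
    have "\<bar>x 0 c - x 0 d\<bar> * (Q * \<bar>a - b\<bar>) \<le> (Q' * \<bar>c - d\<bar>) * \<bar>x 0 a - x 0 b\<bar>"
      by (rule mult_mono[OF x0_upper[OF inI(3,4)] x0_lower[OF inI(1,2)]]) (use Q0 Q'0 in simp_all)
    then have "(\<bar>x 0 c - x 0 d\<bar> * \<bar>a - b\<bar>) * Q \<le> Q' * (\<bar>c - d\<bar> * \<bar>x 0 a - x 0 b\<bar>)"
      by (simp only: mult_ac)
    then have "\<bar>x 0 c - x 0 d\<bar> * \<bar>a - b\<bar> \<le> Q' * (\<bar>c - d\<bar> * \<bar>x 0 a - x 0 b\<bar>) / Q"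
      using Q0 by (simp only: pos_le_divide_eq)
    then show ?case by simp
  next
    case (Suc m)
    define C where "C = Q' / Q * exp (\<Sum>i<m. step_const * (\<rho> ^ (n - i) + \<rho> ^ i))"
    have "0 < C" using Q0 Q'0 by (simp add: C_def)
    moreover have "m < n" "m \<le> n" using Suc.prems by auto
    ultimately have "\<bar>x (Suc m) c - x (Suc m) d\<bar> * \<bar>a - b\<bar>
        \<le> C * exp (step_const * (\<rho> ^ (n - m) + \<rho> ^ m)) * (\<bar>c - d\<bar> * \<bar>x (Suc m) a - x (Suc m) b\<bar>)"
      using Suc.IH by (intro distortion_step[OF cell]) (auto simp: C_def)
    then show ?case by (simp only: C_def sum.lessThan_Suc exp_add mult.assoc)
  qed
  from this[of n] have "\<bar>x n c - x n d\<bar> * \<bar>a - b\<bar>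
      \<le> Q' / Q * exp (\<Sum>i<n. step_const * (\<rho> ^ (n - i) + \<rho> ^ i)) * (\<bar>c - d\<bar> * \<bar>x n a - x n b\<bar>)"
    by simp
  also have "\<dots> \<le> distortion_const * (\<bar>c - d\<bar> * \<bar>x n a - x n b\<bar>)"
    unfolding distortion_const_def using Q0 Q'0 geometric_sums_le[of n]
        by (intro mult_right_mono mult_left_mono) auto
  finally show ?thesis .
qed

lemma cell_borel[measurable]: "cell n a \<in> sets borel"
proof (induction n)
  case 0
  then show ?case by (simp add: cell_def itin_def)
next
  case (Suc n)
  define Z where "Z = I \<inter> x n -` {0..}"
  have "closed Z" unfolding Z_def by (rule continuous_closed_preimage[OF x_continuous]) auto
  then have Z: "Z \<in> sets borel" by simp
  have "cell (Suc n) a = (if 0 \<le> x n a then cell n a \<inter> Z else cell n a - Z)"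
    by (auto simp: cell_def Z_def itin_eq_iff less_Suc_eq)
  then show ?case using Suc Z by auto
qed

lemma emeasure_cell_finite: "emeasure lborel (cell n a) < \<infinity>"
proof -
  have "emeasure lborel (cell n a) \<le> emeasure lborel I" by (intro emeasure_mono cell_subset_I) auto
  then show ?thesis by (rule le_less_trans) (use lohi in auto)
qed

definition len :: "real set \<Rightarrow> real" where "len A = measure lborel A"

lemma len_nonneg: "0 \<le> len A"
  by (simp add: len_def)

lemma dist_le_len:
  assumes "b \<in> cell n a" "c \<in> cell n a"
  shows "\<bar>b - c\<bar> \<le> len (cell n a)"
proof -
  have "{min b c..max b c} \<subseteq> cell n a"
  proof (cases "b \<le> c")
    case True
    then show ?thesis using cell_between[OF assms] by (simp add: subset_iff min_absorb1 max_absorb2)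
  next
    case False
    then show ?thesis using cell_between[OF assms(2,1)]
        by (simp add: subset_iff min_absorb2 max_absorb1)
  qed
  then have "measure lborel {min b c..max b c} \<le> len (cell n a)"
    unfolding len_def using emeasure_cell_finite
        by (intro measure_mono_fmeasurable) (auto intro!: fmeasurableI)
  then show ?thesis by (auto simp: min_def max_def split: if_splits)
qed

end

section \<open>Growth of short cells\<close>

lemma sum_UNION_le:
  fixes f :: "'b \<Rightarrow> real"
  assumes "finite X" "\<And>A. A \<in> X \<Longrightarrow> finite (g A)" "\<And>A B. A \<in> X \<Longrightarrow> B \<in> g A \<Longrightarrow> 0 \<le> f B"
  shows "(\<Sum>B\<in>(\<Union>A\<in>X. g A). f B) \<le> (\<Sum>A\<in>X. \<Sum>B\<in>g A. f B)"
  using assms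
proof (induction X rule: finite_induct)
  case (insert A X)
  have "(\<Sum>B\<in>(\<Union>A\<in>insert A X. g A). f B) = (\<Sum>B\<in>g A \<union> (\<Union>A\<in>X. g A). f B)" by simp
  also have "\<dots> \<le> (\<Sum>B\<in>g A. f B) + (\<Sum>B\<in>(\<Union>A\<in>X. g A). f B)"
  proof (subst sum_Un)
    have "0 \<le> (\<Sum>B\<in>g A \<inter> (\<Union>A\<in>X. g A). f B)" using insert.prems by (intro sum_nonneg) auto
    then show "(\<Sum>B\<in>g A. f B) + (\<Sum>B\<in>(\<Union>A\<in>X. g A). f B) - (\<Sum>B\<in>g A \<inter> (\<Union>A\<in>X. g A). f B)
        \<le> (\<Sum>B\<in>g A. f B) + (\<Sum>B\<in>(\<Union>A\<in>X. g A). f B)"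
      by simp
  qed (use insert in auto)
  also have "\<dots> \<le> (\<Sum>A\<in>insert A X. \<Sum>B\<in>g A. f B)" using insert by auto
  finally show ?case .
qed simp

context expanding_family
begin

text \<open>The supremum of inverse difference quotients of \<open>x n\<close> on \<open>A\<close>,
  that is, a bound for the density of the image of Lebesgue measure. The extra pair
  \<open>(lo, lo)\<close> contributes 0/0 = 0, which makes the supremum nonnegative and meaningful
  for the empty set.\<close>

definition ratio :: "nat \<Rightarrow> real set \<Rightarrow> real" where
  "ratio n A = (SUP p \<in> insert (lo, lo) (A \<times> A). \<bar>fst p - snd p\<bar> / \<bar>x n (fst p) - x n (snd p)\<bar>)"

lemma ratio_bdd:
  assumes "A \<subseteq> cell n a"
  shows "bdd_above ((\<lambda>p. \<bar>fst p - snd p\<bar> / \<bar>x n (fst p) - x n (snd p)\<bar>) ` insert (lo, lo) (A \<times> A))"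
proof (rule bdd_aboveI2[where M = "1 / Q"])
  fix p assume p: "p \<in> insert (lo, lo) (A \<times> A)"
  show "\<bar>fst p - snd p\<bar> / \<bar>x n (fst p) - x n (snd p)\<bar> \<le> 1 / Q"
  proof (cases "fst p = snd p")
    case False
    then have "fst p \<in> cell n a" "snd p \<in> cell n a" using p assms by auto
    then have "Q * \<bar>fst p - snd p\<bar> \<le> \<bar>x n (fst p) - x n (snd p)\<bar>"
      by (intro expand_Q cell_itin) (auto simp: cell_def)
    moreover have "0 < Q * \<bar>fst p - snd p\<bar>" using Q0 False by simp
    ultimately show ?thesis using Q0 by (simp add: divide_simps mult.commute)
  qed (use Q0 in simp)
qed

lemma ratio_nonneg: "A \<subseteq> cell n a \<Longrightarrow> 0 \<le> ratio n A"
  unfolding ratio_def using ratio_bdd[of A n a] by (intro cSUP_upper2[where x="(lo,lo)"]) auto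

lemma ratio_upper:
  assumes A: "A \<subseteq> cell n a" and b: "b \<in> A" and c: "c \<in> A"
  shows "\<bar>b - c\<bar> \<le> ratio n A * \<bar>x n b - x n c\<bar>"
proof (cases "b = c")
  case False
  have "b \<in> cell n a" "c \<in> cell n a" using A b c by auto
  then have "Q * \<bar>b - c\<bar> \<le> \<bar>x n b - x n c\<bar>"
    by (intro expand_Q cell_itin) (auto simp: cell_def)
  moreover have "0 < Q * \<bar>b - c\<bar>" using Q0 False by simp
  ultimately have pos: "0 < \<bar>x n b - x n c\<bar>" by linarith
  have "\<bar>b - c\<bar> / \<bar>x n b - x n c\<bar> \<le> ratio n A"
    unfolding ratio_def using ratio_bdd[OF A] b c by (intro cSUP_upper2[where x="(b,c)"]) auto
  then show ?thesis using pos by (simp add: pos_divide_le_eq)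
qed simp

lemma ratio_le:
  assumes B: "0 \<le> B" and le: "\<And>b c. b \<in> A \<Longrightarrow> c \<in> A \<Longrightarrow> \<bar>b - c\<bar> \<le> B * \<bar>x n b - x n c\<bar>"
  shows "ratio n A \<le> B"
  unfolding ratio_def
proof (rule cSUP_least)
  fix p assume p: "p \<in> insert (lo, lo) (A \<times> A)"
  show "\<bar>fst p - snd p\<bar> / \<bar>x n (fst p) - x n (snd p)\<bar> \<le> B"
  proof (cases "x n (fst p) = x n (snd p)")
    case False
    then have "\<bar>fst p - snd p\<bar> \<le> B * \<bar>x n (fst p) - x n (snd p)\<bar>" using p le by auto
    then show ?thesis using False by (simp add: pos_divide_le_eq)
  qed (use B in simp)
qed simp

lemma ratio_subcell:
  assumes b: "b \<in> cell n a"
  shows "ratio (n + k) (cell (n + k) b) \<le> ratio n (cell n a) / lam ^ k"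
proof (rule ratio_le)
  show "0 \<le> ratio n (cell n a) / lam ^ k" using ratio_nonneg[of "cell n a" n a] lam(2) by simp
  fix c d assume cd: "c \<in> cell (n + k) b" "d \<in> cell (n + k) b"
  have I: "c \<in> I" "d \<in> I" using cd cell_subset_I by blast+
  have "cell (n + k) b \<subseteq> cell n a" using cell_mono[of n "n+k" b] cell_eqI[OF b] by auto
  then have "\<bar>c - d\<bar> \<le> ratio n (cell n a) * \<bar>x n c - x n d\<bar>" using cd
      by (intro ratio_upper[of _ n a]) auto
  also have "\<bar>x n c - x n d\<bar> \<le> \<bar>x (n + k) c - x (n + k) d\<bar> / lam ^ k"
    using expand_from[OF I cell_itin[OF cd]] lam(2) by (simp add: pos_le_divide_eq mult.commute)
  finally show "\<bar>c - d\<bar> \<le> ratio n (cell n a) / lam ^ k * \<bar>x (n + k) c - x (n + k) d\<bar>"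
    using ratio_nonneg[of "cell n a" n a] by (simp add: mult_left_mono)
qed

text \<open>By bounded distortion a single pair with image distance at least \<open>t\<close>
  controls every inverse quotient on the cell: all of them are at most about the cell length over
  \<open>t\<close>.\<close>

lemma ratio_long:
  assumes c: "c \<in> cell n a" and d: "d \<in> cell n a" and t: "0 < t" "t \<le> \<bar>x n c - x n d\<bar>"
  shows "ratio n (cell n a) \<le> distortion_const * len (cell n a) / t"
proof (rule ratio_le)
  show "0 \<le> distortion_const * len (cell n a) / t" using distortion_const_pos len_nonneg t by simp
  fix b e assume be: "b \<in> cell n a" "e \<in> cell n a"
  have "t * \<bar>b - e\<bar> \<le> \<bar>x n c - x n d\<bar> * \<bar>b - e\<bar>" using t by (intro mult_right_mono) auto
  also have "\<dots> \<le> distortion_const * (\<bar>c - d\<bar> * \<bar>x n b - x n e\<bar>)" by (rule distortion[OF be c d])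
  also have "\<dots> \<le> distortion_const * (len (cell n a) * \<bar>x n b - x n e\<bar>)"
    using distortion_const_pos dist_le_len[OF c d] by (intro mult_left_mono mult_right_mono) auto
  finally have "t * \<bar>b - e\<bar> \<le> distortion_const * len (cell n a) * \<bar>x n b - x n e\<bar>"
      by (simp only: mult.assoc)
  then show "\<bar>b - e\<bar> \<le> distortion_const * len (cell n a) / t * \<bar>x n b - x n e\<bar>"
    using t by (simp add: pos_le_divide_eq mult.commute)
qed

definition sub :: "nat \<Rightarrow> nat \<Rightarrow> real set \<Rightarrow> real set set" where
  "sub n k A = cell (n + k) ` A"

lemma sub_cell_bound: "finite (sub n k (cell n a)) \<and> card (sub n k (cell n a)) \<le> 2 ^ k"
proof -
  define W where "W = {w :: bool list. set w \<subseteq> UNIV \<and> length w = k}"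
  have W: "finite W" "card W = 2 ^ k"
    unfolding W_def
    using finite_lists_length_eq[of "UNIV :: bool set" k] card_lists_length_eq[of
        "UNIV :: bool set" k] by simp_all
  have "sub n k (cell n a) \<subseteq> (\<lambda>w. {b\<in>I. itin (n + k) b = itin n a @ w}) ` W"
  proof
    fix A assume "A \<in> sub n k (cell n a)"
    then obtain b where b: "b \<in> cell n a" "A = cell (n + k) b" by (auto simp: sub_def)
    define w where "w = map (\<lambda>i. 0 \<le> x i b) [n..<n+k]"
    have "itin (n + k) b = itin n b @ w"
      unfolding itin_def w_def using upt_add_eq_append[of 0 n k] by simp
    also have "itin n b = itin n a" using b by (simp add: cell_def)
    finally have "A = {c\<in>I. itin (n + k) c = itin n a @ w}" using b by (simp add: cell_def)
    moreover have "w \<in> W" by (simp add: W_def w_def)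
    ultimately show "A \<in> (\<lambda>w. {b\<in>I. itin (n + k) b = itin n a @ w}) ` W" by blast
  qed
  then show ?thesis
    using finite_surj[OF W(1)] surj_card_le[OF W(1)] unfolding W(2) by blast
qed

lemmas finite_sub = conjunct1[OF sub_cell_bound]
lemmas card_sub = conjunct2[OF sub_cell_bound]

text \<open>The upper counterpart of \<open>lam\<close>: within a cell the parameter term adds at
  most \<open>S / Q\<close> to the growth factor \<open>M\<close>.\<close>

definition M' :: real where "M' = M + S / Q"
text \<open>One power \<open>M' ^ N\<close> is spent on the growth of the image up to a cut, the
  other on the separation from the turning orbit during the following \<open>N\<close> steps. What
  remains is \<open>\<kappa> / 2\<close>, too little to reverse a sign.\<close>

definition short :: real where "short = \<kappa> / (2 * M' ^ (2 * N))"

lemma M'1: "1 < M'"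
proof -
  have "0 \<le> S / Q" using S0 Q0 by simp
  then show ?thesis using M1 by (simp add: M'_def)
qed

lemma short_length_pos: "0 < short"
  using \<kappa>0 M'1 by (simp add: short_def)

text \<open>Both orbits belong to the same parameter, so the distance of \<open>x n a\<close> from 0
  is the only initial error and grows at most by the Lipschitz constant.\<close>

lemma turn_orbit_near:
  assumes a: "a \<in> I"
  shows "\<bar>x (n + k) a - (F a ^^ k) 0\<bar> \<le> M ^ k * \<bar>x n a\<bar>"
proof (induction k)
  case 0 then show ?case by simp
next
  case (Suc k)
  have "\<bar>x (n + Suc k) a - (F a ^^ Suc k) 0\<bar> = \<bar>F a (x (n + k) a) - F a ((F a ^^ k) 0)\<bar>"
    by (simp add: x_Suc[OF a])
  also have "\<dots> \<le> M * \<bar>x (n + k) a - (F a ^^ k) 0\<bar>"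
    by (rule F_lip[OF a x_range[OF a] turn_range[OF a]])
  also have "\<dots> \<le> M * (M ^ k * \<bar>x n a\<bar>)" using Suc M1 by (intro mult_left_mono) auto
  finally show ?case by simp
qed

lemma cell_growth_le:
  assumes bc: "b \<in> cell n a" "c \<in> cell n a" and t: "\<bar>x n b - x n c\<bar> \<le> t"
  shows "\<bar>x (n + k) b - x (n + k) c\<bar> \<le> M' ^ k * t"
proof (induction k)
  case 0 then show ?case using t by simp
next
  case (Suc k)
  have I: "b \<in> I" "c \<in> I" using bc by (auto intro: cell_I simp del: atLeastAtMost_iff)
  have t0: "0 \<le> t" using t by linarith
  have "Q * \<bar>b - c\<bar> \<le> t" using expand_Q[OF I cell_itin[OF bc]] t by linarith
  then have "S / Q * (Q * \<bar>b - c\<bar>) \<le> S / Q * t" using S0 Q0 by (intro mult_left_mono) auto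
  moreover have "S / Q * (Q * \<bar>b - c\<bar>) = S * \<bar>b - c\<bar>" using Q0 by simp
  moreover have "S / Q * t \<le> S / Q * (M' ^ k * t)"
    using S0 Q0 t0 M'1 by (intro mult_left_mono) (auto simp: mult_le_cancel_right1 intro:
        one_le_power)
  ultimately have s: "S * \<bar>b - c\<bar> \<le> S / Q * (M' ^ k * t)" by linarith
  have "\<bar>x (n + Suc k) b - x (n + Suc k) c\<bar> \<le> M * \<bar>x (n + k) b - x (n + k) c\<bar> + S * \<bar>b - c\<bar>"
    using x_upper_step[OF I, of "n + k"] by simp
  also have "\<dots> \<le> M * (M' ^ k * t) + S / Q * (M' ^ k * t)"
    using Suc s M1 by (intro add_mono mult_left_mono) auto
  also have "\<dots> = M' ^ Suc k * t" by (simp add: M'_def algebra_simps)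
  finally show ?case .
qed

text \<open>After a short interval has been cut at the turning point, its image follows the orbit of the
  turning point, which stays away from 0 for \<open>N\<close> steps, so no second cut occurs in that time.\<close>

lemma card_sub_short:
  assumes a: "a \<in> I" and sh: "\<And>b c. b \<in> cell n a \<Longrightarrow> c \<in> cell n a \<Longrightarrow> \<bar>x n b - x n c\<bar> < short"
  shows "card (sub n N (cell n a)) \<le> 2"
proof -
  \<comment> \<open>A cut at relative time \<open>i\<close>. As the image is still small, two
    opposite signs force every point of it to be near 0.\<close>
  define ch where "ch i \<longleftrightarrow> (\<exists>b\<in>cell n a. \<exists>c\<in>cell n a. (0 \<le> x (n + i) b) \<noteq> (0 \<le> x (n + i) c))" for i
  have small: "\<bar>x (n + i) e\<bar> \<le> M' ^ N * short" if i: "i < N" "ch i" and e: "e \<in> cell n a" for i e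
  proof -
    obtain b c where bc: "b \<in> cell n a" "c \<in> cell n a" "0 \<le> x (n + i) b" "\<not> 0 \<le> x (n + i) c"
      using i(2) unfolding ch_def by blast
    have *: "\<bar>x (n + i) u - x (n + i) e\<bar> \<le> M' ^ N * short" if u: "u \<in> cell n a" for u
    proof -
      have "\<bar>x (n + i) u - x (n + i) e\<bar> \<le> M' ^ i * short"
        by (rule cell_growth_le[OF u e less_imp_le[OF sh[OF u e]]])
      also have "\<dots> \<le> M' ^ N * short" using i M'1 short_length_pos
          by (intro mult_right_mono power_increasing) auto
      finally show ?thesis .
    qed
    show ?thesis using *[OF bc(1)] *[OF bc(2)] bc(3,4) by linarith
  qed
  have sgn: "0 \<le> x (n + i + r) e \<longleftrightarrow> 0 \<le> (F e ^^ r) 0"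
    if i: "i < N" "ch i" and e: "e \<in> cell n a" and r: "1 \<le> r" "r \<le> N" for i r e
  proof -
    have eI: "e \<in> I" using e by (rule cell_I)
    have "\<bar>x (n + i + r) e - (F e ^^ r) 0\<bar> \<le> M ^ r * \<bar>x (n + i) e\<bar>" by (rule turn_orbit_near[OF eI])
    also have "\<dots> \<le> M' ^ N * (M' ^ N * short)"
    proof (intro mult_mono small[OF i e])
      have "M ^ r \<le> M' ^ r" using M1 S0 Q0 by (intro power_mono) (auto simp: M'_def)
      also have "\<dots> \<le> M' ^ N" using r M'1 by (intro power_increasing) auto
      finally show "M ^ r \<le> M' ^ N" .
    qed (use M'1 in auto)
    also have "\<dots> = \<kappa> / 2" using M'1 by (simp add: short_def power_add[symmetric] mult_2[symmetric]
        mult.assoc[symmetric])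
    also have "\<dots> < \<kappa>" using \<kappa>0 by simp
    finally show ?thesis using turn_away[OF eI r] by linarith
  qed
  \<comment> \<open>After a cut the sign of each point is that of its own turning orbit, and
    \<open>turn_sign\<close> makes these signs agree for all parameters of the cell.\<close>
  have no_second: "\<not> ch j" if i: "i < N" "ch i" and j: "i < j" "j < N" for i j
  proof
    assume "ch j"
    then obtain b c where bc: "b \<in> cell n a" "c \<in> cell n a" "(0 \<le> x (n + j) b) \<noteq> (0 \<le> x (n + j) c)"
      unfolding ch_def by blast
    have r: "1 \<le> j - i" "j - i \<le> N" "n + i + (j - i) = n + j" using j by auto
    have "b \<in> I" "c \<in> I" using bc by (auto intro: cell_I simp del: atLeastAtMost_iff)
    then show False
      using sgn[OF i bc(1) r(1,2)] sgn[OF i bc(2) r(1,2)] turn_sign[OF _ _ r(1,2), of b c] bc(3)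
          r(3) by auto
  qed
  have same: "cell (n + N) b = cell (n + N) c"
    if bc: "b \<in> cell n a" "c \<in> cell n a" and eq: "\<And>i. i < N \<Longrightarrow> ch i \<Longrightarrow> (0 \<le> x (n + i) b) = (0
        \<le> x (n + i) c)" for b c
  proof -
    have "itin (n + N) b = itin (n + N) c"
      unfolding itin_eq_iff
    proof (intro allI impI)
      fix i assume i: "i < n + N"
      show "(0 \<le> x i b) = (0 \<le> x i c)"
      proof (cases "i < n")
        case True then show ?thesis using cell_itin[OF bc] by (auto simp: itin_eq_iff)
      next
        case False
        then have "i = n + (i - n)" "i - n < N" using i by auto
        then show ?thesis using eq[of "i - n"] bc unfolding ch_def by metis
      qed
    qed
    then show ?thesis by (simp add: cell_def)
  qed
  show ?thesis
  proof (cases "\<exists>i<N. ch i")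
    case True
    then obtain i where i: "i < N" "ch i" by blast
    have only: "j = i" if "j < N" "ch j" for j
      using no_second[OF i, of j] no_second[OF that, of i] that i
          by (cases i j rule: linorder_cases) auto
    \<comment> \<open>With a single cutting time \<open>i\<close>, the sign at that time determines
      the subcell, so the two values of \<open>g\<close> exhaust all subcells.\<close>
    define g where "g s = cell (n + N) (SOME b. b \<in> cell n a \<and> (0 \<le> x (n + i) b) = s)" for s
    have "sub n N (cell n a) \<subseteq> g ` UNIV"
    proof
      fix A assume "A \<in> sub n N (cell n a)"
      then obtain b where b: "b \<in> cell n a" "A = cell (n + N) b" by (auto simp: sub_def)
      define s where "s = (0 \<le> x (n + i) b)"
      define c where "c = (SOME b. b \<in> cell n a \<and> (0 \<le> x (n + i) b) = s)"
      have c: "c \<in> cell n a \<and> (0 \<le> x (n + i) c) = s"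
        unfolding c_def by (rule someI[of _ b]) (use b s_def in auto)
      have "A = g s" unfolding g_def c_def[symmetric] b(2)
        by (rule same) (use b c s_def only in auto)
      then show "A \<in> g ` UNIV" by blast
    qed
    then have "card (sub n N (cell n a)) \<le> card (UNIV :: bool set)"
      by (rule surj_card_le[rotated]) simp
    then show ?thesis by simp
  next
    case False
    have "sub n N (cell n a) \<subseteq> {cell (n + N) a}"
      using same[OF _ cell_self[OF a]] False by (auto simp: sub_def)
    then have "card (sub n N (cell n a)) \<le> card {cell (n + N) a}" by (intro card_mono) auto
    then show ?thesis by simp
  qed
qed

text \<open>A long cell is cut into at most \<open>2 ^ N\<close> pieces, none with a larger
  \<open>ratio\<close> than the cell itself, which \<open>ratio_long\<close> bounds by
  \<open>distortion_const * len / short\<close>.\<close>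

definition growth_const :: real where "growth_const = 2 ^ N * distortion_const / short"

lemma growth_const_pos: "0 < growth_const"
  using distortion_const_pos short_length_pos by (simp add: growth_const_def)

text \<open>An inequality of Lasota-Yorke type, with \<open>ratio\<close> as the strong quantity and
  length as the weak one. A short cell gives at most 2 pieces, each with \<open>ratio\<close>
  divided by at least 4; for a long cell \<open>ratio\<close> is itself controlled by length, so the
  crude count of pieces is affordable.\<close>

lemma growth_step:
  assumes a: "a \<in> I"
  shows "(\<Sum>A\<in>sub n N (cell n a). ratio (n + N) A)
      \<le> ratio n (cell n a) / 2 + growth_const * len (cell n a)"
proof -
  let ?z = "ratio n (cell n a)"
  have z0: "0 \<le> ?z" by (rule ratio_nonneg[of _ n a]) simp
  have "(\<Sum>A\<in>sub n N (cell n a). ratio (n + N) A) \<le> (\<Sum>A\<in>sub n N (cell n a). ?z / lam ^ N)"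
    by (intro sum_mono) (auto simp: sub_def intro: ratio_subcell)
  also have "\<dots> = real (card (sub n N (cell n a))) * (?z / lam ^ N)" by simp
  finally have *: "(\<Sum>A\<in>sub n N (cell n a). ratio (n + N) A)
      \<le> real (card (sub n N (cell n a))) * (?z / lam ^ N)" .
  have z4: "?z / lam ^ N \<le> ?z / 4" using z0 lamN by (intro divide_left_mono) auto
  have zl: "0 \<le> ?z / lam ^ N" using z0 lam(2) by simp
  show ?thesis
  proof (cases "\<exists>b\<in>cell n a. \<exists>c\<in>cell n a. short \<le> \<bar>x n b - x n c\<bar>")
    case True
    then have z: "?z \<le> distortion_const * len (cell n a) / short" using ratio_long short_length_pos
        by blast
    have "real (card (sub n N (cell n a))) * (?z / lam ^ N) \<le> 2 ^ N * ?z"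
    proof (rule mult_mono)
      have "real (card (sub n N (cell n a))) \<le> real (2 ^ N)" using card_sub
          by (simp only: of_nat_le_iff)
      then show "real (card (sub n N (cell n a))) \<le> 2 ^ N" by simp
      show "?z / lam ^ N \<le> ?z" using z4 z0 by linarith
    qed (use zl in auto)
    also have "\<dots> \<le> 2 ^ N * (distortion_const * len (cell n a) / short)" using z
        by (intro mult_left_mono) auto
    also have "\<dots> = growth_const * len (cell n a)" by (simp add: growth_const_def)
    finally show ?thesis using * z0 by linarith
  next
    case False
    then have "card (sub n N (cell n a)) \<le> 2" by (intro card_sub_short[OF a]) (auto simp: not_le)
    then have "real (card (sub n N (cell n a))) * (?z / lam ^ N) \<le> 2 * (?z / 4)"
      using z4 zl by (intro mult_mono) auto
    moreover have "0 \<le> growth_const * len (cell n a)" using growth_const_pos len_nonneg by simp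
    ultimately show ?thesis using * by linarith
  qed
qed

lemma cells_disjoint: "A \<in> cell n ` I \<Longrightarrow> B \<in> cell n ` I \<Longrightarrow> A \<noteq> B \<Longrightarrow> A \<inter> B = {}"
  by (auto simp: cell_def)

lemma Union_sub: "\<Union> (sub n k (cell n a)) = cell n a"
proof
  show "\<Union> (sub n k (cell n a)) \<subseteq> cell n a"
  proof
    fix b assume "b \<in> \<Union> (sub n k (cell n a))"
    then obtain c where c: "c \<in> cell n a" "b \<in> cell (n + k) c" by (auto simp: sub_def)
    then show "b \<in> cell n a" using cell_mono[of n "n+k" c] cell_eqI[OF c(1)] by auto
  qed
  show "cell n a \<subseteq> \<Union> (sub n k (cell n a))"
    using cell_self cell_subset_I by (force simp: sub_def)
qed

lemma sub_disjoint: "disjoint (sub n k (cell n a))"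
  unfolding disjoint_def sub_def using cells_disjoint[of _ "n + k"] cell_subset_I by blast

lemma sub_cell: "A \<in> sub n k (cell n a) \<Longrightarrow> \<exists>b\<in>I. b \<in> cell n a \<and> A = cell (n + k) b"
  using cell_subset_I by (auto simp: sub_def)

lemma sub_sub: "sub n (k + m) (cell n a) = (\<Union>A\<in>sub n k (cell n a). sub (n + k) m A)"
proof -
  have "sub n (k + m) (cell n a) = cell (n + k + m) ` cell n a" by (simp add: sub_def add.assoc)
  also have "\<dots> = cell (n + k + m) ` (\<Union> (sub n k (cell n a)))" by (simp only: Union_sub)
  also have "\<dots> = (\<Union>A\<in>sub n k (cell n a). sub (n + k) m A)" by (auto simp: sub_def[of "n + k" m])
  finally show ?thesis .
qed

lemma sum_len_sub: "(\<Sum>A\<in>sub n k (cell n a). len A) = len (cell n a)"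
proof -
  have "measure lborel (\<Union> (sub n k (cell n a))) = (\<Sum>A\<in>sub n k (cell n a). measure lborel A)"
  proof (rule measure_Union'[symmetric, THEN sym])
    show "finite (sub n k (cell n a))" by (rule finite_sub)
    show "A \<in> fmeasurable lborel" if "A \<in> sub n k (cell n a)" for A
      using sub_cell[OF that] emeasure_cell_finite by (auto intro!: fmeasurableI)
    show "pairwise disjnt (sub n k (cell n a))"
      using sub_disjoint by (auto simp: pairwise_def disjnt_def disjoint_def)
  qed
  then show ?thesis by (simp add: Union_sub len_def)
qed

lemma ratio_sub_nonneg: "A \<in> sub n k (cell n a) \<Longrightarrow> 0 \<le> ratio (n + k) A"
  using ratio_nonneg[OF subset_refl] by (auto simp: sub_def)

text \<open>Iterating \<open>growth_step\<close> halves the strong part each time, while the lengths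
  of the pieces always add up to that of the original cell. The length terms thus form a geometric
  series with sum at most 2.\<close>

lemma growth:
  assumes a: "a \<in> I"
  shows "(\<Sum>A\<in>sub n (N * k) (cell n a). ratio (n + N * k) A)
      \<le> (1/2) ^ k * ratio n (cell n a) + 2 * growth_const * len (cell n a)"
proof -
  have "(\<Sum>A\<in>sub n (N * k) (cell n a). ratio (n + N * k) A)
      \<le> (1/2) ^ k * ratio n (cell n a) + (\<Sum>i<k. (1/2) ^ i) * (growth_const * len (cell n a))"
  proof (induction k)
    case 0
    have "sub n 0 (cell n a) = {cell n a}"
      using cell_self[OF a] cell_eqI by (auto simp: sub_def)
    then show ?case by simp
  next
    case (Suc k)
    let ?X = "sub n (N * k) (cell n a)"
    have e1: "N * Suc k = N * k + N" and e2: "n + N * Suc k = n + N * k + N" by simp_all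
    have "(\<Sum>A\<in>sub n (N * Suc k) (cell n a). ratio (n + N * Suc k) A)
        = (\<Sum>B\<in>(\<Union>A\<in>?X. sub (n + N * k) N A). ratio (n + N * k + N) B)"
      unfolding e2 unfolding e1 sub_sub ..
    also have "\<dots> \<le> (\<Sum>A\<in>?X. \<Sum>B\<in>sub (n + N * k) N A. ratio (n + N * k + N) B)"
    proof (rule sum_UNION_le[OF finite_sub])
      fix A assume "A \<in> ?X"
      then obtain b where b: "A = cell (n + N * k) b" using sub_cell by blast
      show "finite (sub (n + N * k) N A)" unfolding b by (rule finite_sub)
      show "0 \<le> ratio (n + N * k + N) B" if "B \<in> sub (n + N * k) N A" for B
        using that unfolding b by (rule ratio_sub_nonneg)
    qed
    also have "\<dots> \<le> (\<Sum>A\<in>?X. ratio (n + N * k) A / 2 + growth_const * len A)"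
    proof (rule sum_mono)
      fix A assume "A \<in> ?X"
      then obtain b where b: "b \<in> I" "A = cell (n + N * k) b" using sub_cell by blast
      show "(\<Sum>B\<in>sub (n + N * k) N A. ratio (n + N * k + N) B)
          \<le> ratio (n + N * k) A / 2 + growth_const * len A"
        unfolding b(2) by (rule growth_step[OF b(1)])
    qed
    also have "\<dots> = (\<Sum>A\<in>?X. ratio (n + N * k) A) / 2 + growth_const * len (cell n a)"
      by (simp add: sum.distrib sum_divide_distrib[symmetric] sum_distrib_left[symmetric]
        sum_len_sub)
    also have "\<dots> \<le> ((1/2) ^ k * ratio n (cell n a) + (\<Sum>i<k. (1/2) ^ i) * (growth_const * len (cell n
        a))) / 2 + growth_const * len (cell n a)"
      using Suc.IH by simp
    also have "\<dots> = (1/2) ^ Suc k * ratio n (cell n a) + ((\<Sum>i<k. (1/2) ^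
        i) / 2 + 1) * (growth_const * len (cell n a))"
      by (simp add: algebra_simps)
    also have "(\<Sum>i<k. (1/2 :: real) ^ i) / 2 + 1 = (\<Sum>i<Suc k. (1/2) ^ i)"
      by (subst sum.lessThan_Suc_shift) (simp add: sum_divide_distrib)
    finally show ?case .
  qed
  also have "(\<Sum>i<k. (1/2 :: real) ^ i) * (growth_const * len (cell n a))
      \<le> 2 * (growth_const * len (cell n a))"
    using growth_const_pos len_nonneg by (intro mult_right_mono) (auto simp: sum_gp_strict)
  finally show ?thesis by (simp add: mult.assoc)
qed

definition ratio_const :: real where "ratio_const = 2 ^ N / Q + 2 * growth_const * (hi - lo)"

lemma cell_0: "cell 0 a = I"
  by (auto simp: cell_def itin_def)

text \<open>Write n = r + N k with r < N. The first \<open>r\<close> steps produce at most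
  \<open>2 ^ N\<close> cells with \<open>ratio\<close> at most \<open>1 / Q\<close>, and
  \<open>growth\<close> handles the rest. The bound is uniform in \<open>n\<close>: the
  distributions of all \<open>x n\<close> have a common density bound.\<close>

lemma ratio_total: "(\<Sum>A\<in>cell n ` I. ratio n A) \<le> ratio_const"
proof -
  define r where "r = n mod N"
  define k where "k = n div N"
  have n: "n = r + N * k" by (simp add: r_def k_def)
  have r: "r < N" using N1 by (simp add: r_def)
  have X: "cell r ` I = sub 0 r (cell 0 lo)" by (simp add: sub_def cell_0)
  have Y: "cell n ` I = (\<Union>A\<in>sub 0 r (cell 0 lo). sub r (N * k) A)"
  proof -
    have "cell n ` I = sub 0 (r + N * k) (cell 0 lo)" by (simp add: sub_def cell_0 n)
    then show ?thesis by (simp only: sub_sub add_0)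
  qed
  have "(\<Sum>A\<in>cell n ` I. ratio n A) \<le> (\<Sum>A\<in>sub 0 r (cell 0 lo). \<Sum>B\<in>sub r (N * k) A. ratio n B)"
    unfolding Y
  proof (rule sum_UNION_le[OF finite_sub])
    fix A assume "A \<in> sub 0 r (cell 0 lo)"
    then obtain b where b: "A = cell r b" using sub_cell by fastforce
    show "finite (sub r (N * k) A)" unfolding b by (rule finite_sub)
    show "0 \<le> ratio n B" if "B \<in> sub r (N * k) A" for B
      using that unfolding b n by (rule ratio_sub_nonneg)
  qed
  also have "\<dots> \<le> (\<Sum>A\<in>sub 0 r (cell 0 lo). 1 / Q + 2 * growth_const * len A)"
  proof (rule sum_mono)
    fix A assume A: "A \<in> sub 0 r (cell 0 lo)"
    then obtain b where b: "b \<in> I" "A = cell r b" using sub_cell by force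
    have z: "ratio r (cell r b) \<le> 1 / Q"
    proof (rule ratio_le)
      fix c d assume "c \<in> cell r b" "d \<in> cell r b"
      then have "Q * \<bar>c - d\<bar> \<le> \<bar>x r c - x r d\<bar>" by (intro expand_Q cell_itin) (auto simp: cell_def)
      then show "\<bar>c - d\<bar> \<le> 1 / Q * \<bar>x r c - x r d\<bar>" using Q0
          by (simp add: pos_le_divide_eq mult.commute)
    qed (use Q0 in simp)
    have "(1/2) ^ k * ratio r (cell r b) \<le> 1 * (1 / Q)"
      using z ratio_nonneg[of "cell r b" r b] by (intro mult_mono power_le_one) auto
    then show "(\<Sum>B\<in>sub r (N * k) A. ratio n B) \<le> 1 / Q + 2 * growth_const * len A"
      using growth[OF b(1), of r k] unfolding b(2) n by linarith
  qed
  also have "\<dots> = real (card (sub 0 r (cell 0 lo))) / Q + 2 * growth_const * (hi - lo)"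
    using sum_len_sub[of 0 r lo] lohi by (simp add: sum.distrib sum_distrib_left[symmetric] cell_0
        len_def)
  also have "\<dots> \<le> ratio_const"
  proof -
    have "card (sub 0 r (cell 0 lo)) \<le> 2 ^ r" by (rule card_sub)
    also have "\<dots> \<le> 2 ^ N" using r by (intro power_increasing) auto
    finally have "real (card (sub 0 r (cell 0 lo))) \<le> real (2 ^ N)" by (simp only: of_nat_le_iff)
    then have "real (card (sub 0 r (cell 0 lo))) / Q \<le> 2 ^ N / Q" using Q0
        by (intro divide_right_mono) auto
    then show ?thesis by (simp add: ratio_const_def)
  qed
  finally show ?thesis .
qed

end

section \<open>Distribution of orbit points\<close>

context expanding_family
begin

lemma x_measurable_restrict: "A \<subseteq> I \<Longrightarrow> x n \<in> borel_measurable (restrict_space lborel A)"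
proof -
  assume "A \<subseteq> I"
  then have "x n \<in> borel_measurable (restrict_space borel A)"
    by (intro borel_measurable_continuous_on_restrict continuous_on_subset[OF x_continuous])
  then show ?thesis by (simp cong: measurable_cong_sets sets_restrict_space_cong)
qed

definition image_measure :: "nat \<Rightarrow> real set \<Rightarrow> real measure" where
  "image_measure n A = distr (restrict_space lborel A) borel (x n)"

lemma emeasure_image_measure:
  assumes "A \<subseteq> I" "A \<in> sets borel" "B \<in> sets borel"
  shows "emeasure (image_measure n A) B = emeasure lborel {b\<in>A. x n b \<in> B}"
proof -
  have "emeasure (image_measure n A) B = emeasure (restrict_space lborel A) (x n -` B \<inter> space
      (restrict_space lborel A))"
    unfolding image_measure_def using assms by (intro emeasure_distr x_measurable_restrict) auto
  also have "x n -` B \<inter> space (restrict_space lborel A) = {b\<in>A. x n b \<in> B}"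
    by (auto simp: space_restrict_space)
  also have "emeasure (restrict_space lborel A) {b\<in>A. x n b \<in> B} = emeasure lborel {b\<in>A. x n b \<in> B}"
    using assms by (intro emeasure_restrict_space) auto
  finally show ?thesis .
qed

lemma preimage_borel:
  assumes "A \<subseteq> I" "A \<in> sets borel" "B \<in> sets borel"
  shows "{b\<in>A. x n b \<in> B} \<in> sets borel"
proof -
  have "x n -` B \<inter> space (restrict_space lborel A) \<in> sets (restrict_space lborel A)"
    using assms by (intro measurable_sets[OF x_measurable_restrict]) auto
  moreover have "x n -` B \<inter> space (restrict_space lborel A) = {b\<in>A. x n b \<in> B}"
    by (auto simp: space_restrict_space)
  ultimately show ?thesis using assms by (auto simp: sets_restrict_space)
qed

text \<open>Within one cell the preimage of an interval has diameter at most \<open>ratio\<close>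
  times its length, and bounds on half-open intervals extend to Borel sets.\<close>

lemma image_measure_le:
  assumes B: "B \<in> sets borel"
  shows "emeasure (image_measure n (cell n a)) B \<le> ennreal (ratio n (cell n a)) * emeasure lborel B"
proof (rule emeasure_borel_le_lborel[OF _ _ _ B])
  show "0 \<le> ratio n (cell n a)" by (rule ratio_nonneg[OF subset_refl])
  show "sets (image_measure n (cell n a)) = sets borel" by (simp add: image_measure_def)
  fix u v :: real assume uv: "u < v"
  have "emeasure (image_measure n (cell n a)) {u<..v}
      = emeasure lborel {b\<in>cell n a. x n b \<in> {u<..v}}"
    by (rule emeasure_image_measure[OF cell_subset_I]) auto
  also have "\<dots> \<le> ennreal (ratio n (cell n a) * (v - u))"
  proof (rule emeasure_le_diameter)
    show "{b\<in>cell n a. x n b \<in> {u<..v}} \<in> sets borel"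
        by (rule preimage_borel[OF cell_subset_I]) auto
    fix c d assume cd: "c \<in> {b\<in>cell n a. x n b \<in> {u<..v}}" "d \<in> {b\<in>cell n a. x n b \<in> {u<..v}}"
    have "\<bar>c - d\<bar> \<le> ratio n (cell n a) * \<bar>x n c - x n d\<bar>"
      using cd by (intro ratio_upper[of _ n a]) auto
    also have "\<dots> \<le> ratio n (cell n a) * (v - u)"
      using cd ratio_nonneg[of "cell n a" n a] by (intro mult_left_mono) auto
    finally show "\<bar>c - d\<bar> \<le> ratio n (cell n a) * (v - u)" .
  qed
  finally show "emeasure (image_measure n (cell n a)) {u<..v}
      \<le> ennreal (ratio n (cell n a) * (v - u))" .
qed

lemma nn_integral_cell_le:
  assumes f[measurable]: "f \<in> borel_measurable borel"
  shows "(\<integral>\<^sup>+b. f (x n b) * indicator (cell n a) b \<partial>lborel)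
      \<le> ennreal (ratio n (cell n a)) * (\<integral>\<^sup>+y. f y \<partial>lborel)"
proof -
  have "(\<integral>\<^sup>+b. f (x n b) * indicator (cell n a) b \<partial>lborel)
      = (\<integral>\<^sup>+b. f (x n b) \<partial>restrict_space lborel (cell n a))"
    by (subst nn_integral_restrict_space) auto
  also have "\<dots> = (\<integral>\<^sup>+y. f y \<partial>image_measure n (cell n a))"
    unfolding image_measure_def
    by (rule nn_integral_distr[symmetric]) (auto intro: x_measurable_restrict[OF cell_subset_I])
  also have "\<dots> \<le> (\<integral>\<^sup>+y. f y \<partial>scale_measure (ennreal (ratio n (cell n a))) lborel)"
    by (rule nn_integral_mono_measure_sets) (use image_measure_le in \<open>auto simp: image_measure_def\<close>)
  also have "\<dots> = ennreal (ratio n (cell n a)) * (\<integral>\<^sup>+y. f y \<partial>lborel)"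
    by (rule nn_integral_scale_measure) auto
  finally show ?thesis .
qed

text \<open>Summing the density bounds over the subcells turns \<open>growth\<close> into a
  conditional estimate: given the cell at time \<open>n\<close>, the law of
  \<open>x (n + N * k)\<close> has a transient part decaying in \<open>k\<close> and a part
  proportional to the length of the cell.\<close>

lemma nn_integral_cell_iterate_le:
  assumes a: "a \<in> I" and f[measurable]: "f \<in> borel_measurable borel"
  shows "(\<integral>\<^sup>+b. f (x (n + N * k) b) * indicator (cell n a) b \<partial>lborel)
    \<le> ennreal ((1/2) ^ k * ratio n (cell n a) + 2 * growth_const * len (cell n a)) * (\<integral>\<^sup>+y. f y
        \<partial>lborel)"
proof -
  let ?X = "sub n (N * k) (cell n a)" and ?m = "n + N * k"
  have fm: "(\<lambda>b. f (x ?m b) * indicator A b) \<in> borel_measurable lborel" if A: "A \<in> ?X" for A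
  proof -
    obtain b where b: "A = cell ?m b" using sub_cell[OF A] by blast
    have "(\<lambda>b. f (x ?m b)) \<in> borel_measurable (restrict_space lborel A)"
      unfolding b using x_measurable_restrict[OF cell_subset_I, of ?m ?m b] by measurable
    then show ?thesis unfolding b by (subst (asm) borel_measurable_restrict_space_iff_ennreal) auto
  qed
  have "(\<integral>\<^sup>+b. f (x ?m b) * indicator (cell n a) b \<partial>lborel)
      = (\<integral>\<^sup>+b. (\<Sum>A\<in>?X. f (x ?m b) * indicator A b) \<partial>lborel)"
  proof (intro nn_integral_cong)
    fix b
    have "indicator (cell n a) b = (\<Sum>A\<in>?X. indicator A b :: ennreal)"
      using indicator_UN_disjoint[OF finite_sub, of "\<lambda>A. A" n "N * k" a b] sub_disjoint[of n
          "N * k" a] Union_sub[of n "N * k" a]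
      by (simp add: disjoint_def disjoint_family_on_def)
    then show "f (x ?m b) * indicator (cell n a) b = (\<Sum>A\<in>?X. f (x ?m b) * indicator A b)"
      by (simp add: sum_distrib_left)
  qed
  also have "\<dots> = (\<Sum>A\<in>?X. \<integral>\<^sup>+b. f (x ?m b) * indicator A b \<partial>lborel)"
    using fm by (rule nn_integral_sum)
  also have "\<dots> \<le> (\<Sum>A\<in>?X. ennreal (ratio ?m A) * (\<integral>\<^sup>+y. f y \<partial>lborel))"
  proof (rule sum_mono)
    fix A assume "A \<in> ?X"
    then obtain b where b: "A = cell ?m b" using sub_cell by blast
    show "(\<integral>\<^sup>+b. f (x ?m b) * indicator A b \<partial>lborel) \<le> ennreal (ratio ?m A) * (\<integral>\<^sup>+y. f y \<partial>lborel)"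
      unfolding b by (rule nn_integral_cell_le[OF f])
  qed
  also have "\<dots> = ennreal (\<Sum>A\<in>?X. ratio ?m A) * (\<integral>\<^sup>+y. f y \<partial>lborel)"
    unfolding sum_distrib_right[symmetric] using ratio_sub_nonneg by (subst sum_ennreal) auto
  also have "\<dots> \<le> ennreal ((1/2) ^ k * ratio n (cell n a) + 2 * growth_const * len (cell n
      a)) * (\<integral>\<^sup>+y. f y \<partial>lborel)"
    using growth[OF a] by (intro mult_right_mono ennreal_leI) auto
  finally show ?thesis .
qed

lemma sets_restrict_I: "A \<subseteq> I \<Longrightarrow> A \<in> sets borel \<Longrightarrow> A \<in> sets (restrict_space lborel I)"
  by (subst sets_restrict_space_iff) auto

lemma label_set_cases: "{b\<in>I. itin n b = w} = {} \<or> (\<exists>a\<in>I. {b\<in>I. itin n b = w} = cell n a)"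
  by (auto simp: cell_def)

text \<open>The labels are itineraries. \<open>contract\<close> makes earlier observations almost
  constant on label sets, \<open>nn_integral_cell_iterate_le\<close> gives the conditional means,
  and \<open>ratio_total\<close> bounds the sum of their transient parts.\<close>

theorem AE_average_le:
  fixes f :: "real \<Rightarrow> real"
  assumes f0: "\<And>y. 0 \<le> f y" and f1: "\<And>y. f y \<le> 1"
    and f_lip: "\<And>y z. \<bar>f y - f z\<bar> \<le> Lf * \<bar>y - z\<bar>" and Lf: "0 \<le> Lf"
    and f[measurable]: "f \<in> borel_measurable borel"
    and J: "0 \<le> J" "(\<integral>\<^sup>+y. ennreal (f y) \<partial>lborel) \<le> ennreal J"
  shows "AE a in lborel. a \<in> I \<longrightarrow> (\<forall>\<eta>>0. \<forall>\<^sub>F n in sequentially. (\<Sum>i<n. f (x i a)) / real n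
      \<le> 2 * growth_const * J + \<eta>)"
proof -
  let ?M = "restrict_space lborel I"
  have sp: "space ?M = I" by (simp add: space_restrict_space)
  have lab: "{b\<in>I. itin n b = w} \<in> sets borel" for n w
    using label_set_cases[of n w]
  proof
    assume "{b\<in>I. itin n b = w} = {}"
    then show ?thesis by (simp only: sets.empty_sets)
  next
    assume "\<exists>a\<in>I. {b\<in>I. itin n b = w} = cell n a"
    then obtain a where "{b\<in>I. itin n b = w} = cell n a" by blast
    then show ?thesis by (simp only: cell_borel)
  qed
  have z0: "0 \<le> ratio n {b\<in>I. itin n b = w}" for n w
    using label_set_cases[of n w]
  proof
    assume "{b\<in>I. itin n b = w} = {}"
    then show ?thesis using ratio_nonneg[of "{}" n lo] by (simp only: empty_subsetI)
  next
    assume "\<exists>a\<in>I. {b\<in>I. itin n b = w} = cell n a"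
    then obtain a where "{b\<in>I. itin n b = w} = cell n a" by blast
    then show ?thesis using ratio_nonneg[OF subset_refl, of n a] by (simp only:)
  qed
  have "AE a in ?M. \<forall>\<eta>>0. \<forall>\<^sub>F n in sequentially. (\<Sum>i<n. f (x i a)) / real n
      \<le> 2 * growth_const * J + \<eta>"
  proof (rule AE_limsup_average_le[where lab=itin and z="\<lambda>n w. J * ratio n {b\<in>I. itin n b = w}"
      and N=N and r="1/lam" and C="Lf * (K + 1)" and Z="J * ratio_const"])
    show "finite_measure ?M"
      by (rule finite_measureI) (use lohi in \<open>simp add: emeasure_restrict_space sp\<close>)
    show "finite (itin n ` space ?M)" for n by (rule finite_itin)
    show "{a \<in> space ?M. itin n a = w} \<in> sets ?M" for n w
      unfolding sp by (rule sets_restrict_I[OF _ lab]) (rule Collect_restrict)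
    show "itin i a = itin i b" if "i \<le> j" "itin j a = itin j b" for i j a b
      using that by (rule itin_mono)
    show "(\<lambda>a. f (x n a)) \<in> borel_measurable ?M" for n
      using x_measurable_restrict[OF subset_refl, of n] by measurable
    show "\<bar>f (x i a) - f (x i b)\<bar> \<le> Lf * (K + 1) * (1 / lam) ^ (j - i)"
      if "i \<le> j" "a \<in> space ?M" "b \<in> space ?M" "itin j a = itin j b" for i j a b
    proof -
      have "\<bar>f (x i a) - f (x i b)\<bar> \<le> Lf * \<bar>x i a - x i b\<bar>" by (rule f_lip)
      also have "\<dots> \<le> Lf * ((K + 1) * (1 / lam) ^ (j - i))"
        using that unfolding sp by (intro mult_left_mono contract Lf)
      finally show ?thesis by (simp add: mult.assoc)
    qed
    show "0 \<le> Lf * (K + 1)" using Lf K0 by simp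
    show "0 \<le> 1 / lam" "1 / lam < 1" using lam(2) by auto
    show "0 \<le> 2 * growth_const * J" using growth_const_pos J by simp
    show "0 \<le> J * ratio n {b \<in> I. itin n b = w}" for n w using J z0 by simp
    show "(\<Sum>w\<in>itin n ` space ?M. J * ratio n {b \<in> I. itin n b = w}) \<le> J * ratio_const" for n
    proof -
      define g where "g w = {b \<in> I. itin n b = w}" for w
      have inj: "inj_on g (itin n ` I)"
      proof (rule inj_onI)
        fix v w assume "v \<in> itin n ` I" and eq: "g v = g w"
        then obtain a where a: "a \<in> I" "v = itin n a" by blast
        then have "a \<in> g v" unfolding g_def by blast
        then have "a \<in> g w" unfolding eq .
        then show "v = w" unfolding a(2) g_def by blast
      qed
      have "(\<Sum>w\<in>itin n ` I. ratio n (g w)) = (\<Sum>A\<in>g ` itin n ` I. ratio n A)"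
        using sum.reindex[OF inj, of "ratio n"] unfolding comp_def ..
      also have "g ` itin n ` I = cell n ` I"
        unfolding image_image g_def cell_def ..
      finally have "(\<Sum>w\<in>itin n ` I. ratio n (g w)) \<le> ratio_const" using ratio_total[of n]
          by (simp only:)
      then have "J * (\<Sum>w\<in>itin n ` I. ratio n (g w)) \<le> J * ratio_const"
          by (rule mult_left_mono[OF _ J(1)])
      then show ?thesis unfolding sp g_def sum_distrib_left .
    qed
    fix n m w assume "w \<in> itin n ` space ?M"
    then obtain a where a: "a \<in> I" "w = itin n a" by (auto simp: sp)
    have W: "{a \<in> space ?M. itin n a = w} = cell n a" by (simp add: sp a cell_def)
    have W': "{b \<in> I. itin n b = w} = cell n a" by (simp add: a cell_def)
    let ?B = "(1/2) ^ m * ratio n (cell n a) + 2 * growth_const * len (cell n a)"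
    have B0: "0 \<le> ?B" using ratio_nonneg[of "cell n a" n a] growth_const_pos len_nonneg by simp
    have gm: "(\<lambda>b. f (x (n + N * m) b)) \<in> borel_measurable ?M"
      using x_measurable_restrict[OF subset_refl, of "n + N * m"] by measurable
    have cm: "cell n a \<in> sets ?M" by (rule sets_restrict_I[OF cell_subset_I cell_borel])
    have "(\<integral>b. indicator (cell n a) b * f (x (n + N * m) b) \<partial>?M)
        = enn2real (\<integral>\<^sup>+b. ennreal (indicator (cell n a) b * f (x (n + N * m) b)) \<partial>?M)"
      using gm cm f0 by (intro integral_eq_nn_integral) auto
    also have "\<dots> \<le> ?B * J"
    proof (rule enn2real_leI)
      have "(\<integral>\<^sup>+b. ennreal (indicator (cell n a) b * f (x (n + N * m) b)) \<partial>?M)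
          = (\<integral>\<^sup>+b. ennreal (f (x (n + N * m) b)) * indicator (cell n a) b \<partial>lborel)"
        using cell_subset_I
        by (subst nn_integral_restrict_space) (auto intro!: nn_integral_cong simp: indicator_def
          cell_def)
      also have "\<dots> \<le> ennreal ?B * (\<integral>\<^sup>+y. ennreal (f y) \<partial>lborel)"
        by (rule nn_integral_cell_iterate_le[OF a(1)]) auto
      also have "\<dots> \<le> ennreal ?B * ennreal J" by (intro mult_left_mono J) auto
      finally show "(\<integral>\<^sup>+b. ennreal (indicator (cell n a) b * f (x (n + N * m) b)) \<partial>?M)
          \<le> ennreal (?B * J)"
        using B0 J by (simp add: ennreal_mult)
    qed (use B0 J in simp)
    finally have "(\<integral>b. indicator (cell n a) b * f (x (n + N * m) b) \<partial>?M) \<le> ?B * J" .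
    then show "(\<integral>b. indicator {a \<in> space ?M. itin n a = w} b * f (x (n + N * m) b) \<partial>?M)
        \<le> (1/2) ^ m * (J * ratio n {b \<in> I. itin n b
            = w}) + 2 * growth_const * J * measure ?M {a \<in> space ?M. itin n a = w}"
    proof -
      have "measure ?M (cell n a) = len (cell n a)"
        unfolding len_def by (rule measure_restrict_space[OF _ cell_subset_I]) simp
      moreover assume "(\<integral>b. indicator (cell n a) b * f (x (n + N * m) b) \<partial>?M) \<le> ?B * J"
      moreover have "?B * J = (1/2) ^ m * (J * ratio n (cell n a)) + 2 * growth_const * J * len
          (cell n a)"
        unfolding distrib_right by (simp only: mult_ac)
      ultimately show ?thesis unfolding W W' by (simp only:)
    qed
  qed (use N1 f0 f1 in auto)
  then show ?thesis
    by (subst (asm) AE_restrict_space_iff) auto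
qed

text \<open>The density bound from below. The intermediate value theorem supplies preimages of the
  ends of any subinterval of \<open>{p..q}\<close>, and distortion compares the segment between them
  with the entire cell, whose image has length at most \<open>K + 1\<close>. Both sides are measures
  in \<open>B\<close>, so half-open intervals decide.\<close>

lemma image_measure_lower:
  assumes c: "c \<in> cell n a" and d: "d \<in> cell n a" and pq: "p = min (x n c) (x n d)" "q
      = max (x n c) (x n d)"
    and B: "B \<in> sets borel" "B \<subseteq> {p..q}"
  shows "ennreal (len (cell n a)) * emeasure lborel B
      \<le> ennreal (distortion_const * (K + 1)) * emeasure lborel {b\<in>cell n a. x n b \<in> B}"
proof -
  let ?A = "cell n a"
  define M1 where "M1 = scale_measure (ennreal (len ?A)) (density lborel (indicator {p..q}))"
  define M2 where "M2 = scale_measure (ennreal (distortion_const * (K + 1))) (image_measure n ?A)"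
  have CK: "0 \<le> distortion_const * (K + 1)" using distortion_const_pos K0 by simp
  have M1: "emeasure M1 E = ennreal (len ?A) * emeasure lborel (E \<inter> {p..q})" if "E \<in> sets borel"
      for E
    using that by (simp add: M1_def emeasure_restricted Int_commute)
  have M2: "emeasure M2 E = ennreal (distortion_const * (K + 1)) * emeasure lborel {b\<in>?A. x n b \<in>
      E}" if "E \<in> sets borel" for E
    using that by (simp add: M2_def emeasure_image_measure[OF cell_subset_I cell_borel])
  have AI: "\<And>b. b \<in> ?A \<Longrightarrow> b \<in> I" by (rule cell_I)
  have "emeasure M1 B \<le> emeasure M2 B"
  proof (rule emeasure_borel_mono_finite[OF _ _ _ _ B(1)])
    show "sets M1 = sets borel" "sets M2 = sets borel"
        by (simp_all add: M1_def M2_def image_measure_def)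
    have "emeasure M2 UNIV < \<infinity>"
      using emeasure_cell_finite[of n a] CK by (simp add: M2 ennreal_mult_less_top)
    moreover have "space M2 = UNIV" by (simp add: M2_def image_measure_def space_scale_measure)
    ultimately show "finite_measure M2" by (intro finite_measureI) simp
    fix u v :: real assume "u < v"
    define u' where "u' = max u p"
    define v' where "v' = min v q"
    show "emeasure M1 {u<..v} \<le> emeasure M2 {u<..v}"
    proof (cases "u' < v'")
      case False
      then have "emeasure lborel ({u<..v} \<inter> {p..q}) \<le> emeasure lborel {v'}"
        by (intro emeasure_mono) (auto simp: u'_def v'_def)
      then show ?thesis by (simp add: M1)
    next
      case True
      have seg: "e \<in> ?A" if "b \<in> ?A" "b' \<in> ?A" "min b b' \<le> e" "e \<le> max b b'" for b b' e
      proof (cases "b \<le> b'")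
        case True
        then show ?thesis using cell_between[OF that(1,2)] that(3,4)
            by (simp add: min_absorb1 max_absorb2)
      next
        case False
        then show ?thesis using cell_between[OF that(2,1)] that(3,4)
            by (simp add: min_absorb2 max_absorb1)
      qed
      have cont: "continuous_on {min b b'..max b b'} (x n)" if "b \<in> ?A" "b' \<in> ?A" for b b'
        by (rule continuous_on_subset[OF x_continuous], rule subsetI, rule AI, rule seg[OF that])
          simp_all
      have hit: "\<exists>b\<in>?A. x n b = y" if y: "p \<le> y" "y \<le> q" for y
      proof -
        have "connected (x n ` {min c d..max c d})"
          by (intro connected_continuous_image cont[OF c d] connected_Icc)
        moreover have "p \<in> x n ` {min c d..max c d}" "q \<in> x n ` {min c d..max c d}"
          unfolding pq by (simp_all add: min_def max_def)
        ultimately have "y \<in> x n ` {min c d..max c d}" using y by (rule connectedD_interval)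
        then show ?thesis using seg[OF c d] by auto
      qed
      obtain b where b: "b \<in> ?A" "x n b = u'" using hit[of u'] True by (auto simp: u'_def v'_def)
      obtain e where e: "e \<in> ?A" "x n e = v'" using hit[of v'] True by (auto simp: u'_def v'_def)
      have be: "b \<noteq> e" using b e True by auto
      have sub: "{min b e<..<max b e} \<subseteq> {b\<in>?A. x n b \<in> {u<..v}}"
      proof
        fix w assume w: "w \<in> {min b e<..<max b e}"
        have wA: "w \<in> ?A" using seg[OF b(1) e(1), of w] w by auto
        have inj: "inj_on (x n) {min b e..max b e}"
        proof (rule inj_onI)
          fix g h assume "g \<in> {min b e..max b e}" "h \<in> {min b e..max b e}" and eq: "x n g = x n h"
          then have gh: "g \<in> ?A" "h \<in> ?A" using seg[OF b(1) e(1), of g] seg[OF b(1) e(1), of h]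
              by simp_all
          have "Q * \<bar>g - h\<bar> \<le> \<bar>x n g - x n h\<bar>"
              by (rule expand_Q[OF AI[OF gh(1)] AI[OF gh(2)] cell_itin[OF gh]])
          then show "g = h" using eq Q0 by (simp add: mult_le_0_iff)
        qed
        have "(x n (min b e) < x n w \<and> x n w < x n (max b e)) \<or> (x n (max b e) < x n w \<and> x n w
            < x n (min b e))"
          using w by (intro continuous_inj_imp_mono cont b e inj) auto
        then have "u' < x n w \<and> x n w < v'"
          using b e True by (auto simp: min_def max_def split: if_splits)
        then show "w \<in> {b\<in>?A. x n b \<in> {u<..v}}" using wA by (auto simp: u'_def v'_def)
      qed
      \<comment> \<open>Every pair of the cell is compared with the pair \<open>b\<close>,
        \<open>e\<close> of image distance \<open>v' - u'\<close>. The resulting bound on its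
        distance bounds the diameter, hence the length, of the cell.\<close>
      have lenA: "emeasure lborel ?A \<le> ennreal (distortion_const * (K + 1) * \<bar>b - e\<bar> / (v' - u'))"
      proof (rule emeasure_le_diameter[OF cell_borel])
        fix g h assume gh: "g \<in> ?A" "h \<in> ?A"
        have "\<bar>x n b - x n e\<bar> * \<bar>g - h\<bar> \<le> distortion_const * (\<bar>b - e\<bar> * \<bar>x n g - x n h\<bar>)"
          by (rule distortion[OF gh b(1) e(1)])
        also have "\<dots> \<le> distortion_const * (\<bar>b - e\<bar> * (K + 1))"
          using distortion_const_pos x_diff_le[OF AI[OF gh(1)] AI[OF gh(2)]]
              by (intro mult_left_mono) auto
        finally have "(v' - u') * \<bar>g - h\<bar> \<le> distortion_const * (K + 1) * \<bar>b - e\<bar>"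
          using b e True by (simp add: abs_of_neg mult_ac)
        then show "\<bar>g - h\<bar> \<le> distortion_const * (K + 1) * \<bar>b - e\<bar> / (v' - u')"
          using True by (simp add: pos_le_divide_eq mult.commute)
      qed
      have fin: "emeasure lborel ?A = ennreal (len ?A)"
        unfolding len_def using emeasure_cell_finite[of n a]
            by (intro emeasure_eq_ennreal_measure) auto
      have l: "len ?A \<le> distortion_const * (K + 1) * \<bar>b - e\<bar> / (v' - u')"
        using lenA True CK unfolding fin by (subst (asm) ennreal_le_iff) auto
      have "emeasure lborel ({u<..v} \<inter> {p..q}) \<le> emeasure lborel {u'..v'}"
        by (intro emeasure_mono) (auto simp: u'_def v'_def)
      then have "emeasure M1 {u<..v} \<le> ennreal (len ?A) * ennreal (v' - u')"
        using True by (simp add: M1 mult_left_mono)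
      also have "\<dots> = ennreal (len ?A * (v' - u'))" using True len_nonneg by (simp add: ennreal_mult)
      also have "\<dots> \<le> ennreal (distortion_const * (K + 1) * \<bar>b - e\<bar>)"
        using l True by (intro ennreal_leI) (simp add: pos_le_divide_eq)
      also have "\<dots> = ennreal (distortion_const * (K + 1)) * emeasure lborel {min b e<..<max b e}"
        using CK by (subst ennreal_mult) (auto simp: min_def max_def abs_if)
      also have "\<dots> \<le> ennreal (distortion_const * (K + 1)) * emeasure lborel {b\<in>?A. x n b \<in> {u<..v}}"
      proof (intro mult_left_mono emeasure_mono sub)
        have "{b\<in>?A. x n b \<in> {u<..v}} \<in> sets borel"
            by (rule preimage_borel[OF cell_subset_I cell_borel]) simp
        then show "{b\<in>?A. x n b \<in> {u<..v}} \<in> sets lborel" by (simp only: sets_lborel)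
      qed simp
      finally show ?thesis by (simp add: M2)
    qed
  qed
  moreover have "B \<inter> {p..q} = B" using B by auto
  ultimately show ?thesis using B by (simp add: M1 M2)
qed

end

section \<open>Intervals in the images of sets of positive measure\<close>

context expanding_family
begin

lemma ratio_const_pos: "0 < ratio_const"
proof -
  have "0 \<le> 2 * growth_const * (hi - lo)" using growth_const_pos lohi by simp
  moreover have "0 < 2 ^ N / Q" using Q0 by simp
  ultimately show ?thesis unfolding ratio_const_def by linarith
qed

lemma emeasure_cell: "emeasure lborel (cell n a) = ennreal (len (cell n a))"
  unfolding len_def using emeasure_cell_finite[of n a] by (intro emeasure_eq_ennreal_measure) auto

lemma len_le_ratio:
  assumes t: "0 \<le> t" and le: "\<And>b c. b \<in> cell n a \<Longrightarrow> c \<in> cell n a \<Longrightarrow> \<bar>x n b - x n c\<bar> \<le> t"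
  shows "len (cell n a) \<le> ratio n (cell n a) * t"
proof -
  have r0: "0 \<le> ratio n (cell n a)" by (rule ratio_nonneg[OF subset_refl])
  have "emeasure lborel (cell n a) \<le> ennreal (ratio n (cell n a) * t)"
  proof (rule emeasure_le_diameter[OF cell_borel])
    fix b c assume bc: "b \<in> cell n a" "c \<in> cell n a"
    have "\<bar>b - c\<bar> \<le> ratio n (cell n a) * \<bar>x n b - x n c\<bar>" by (rule ratio_upper[OF subset_refl bc])
    also have "\<dots> \<le> ratio n (cell n a) * t" by (rule mult_left_mono[OF le[OF bc] r0])
    finally show "\<bar>b - c\<bar> \<le> ratio n (cell n a) * t" .
  qed
  then show ?thesis using r0 t by (simp add: emeasure_cell)
qed

lemma finite_cells: "finite (cell n ` I)"
proof -
  have "cell n ` I = (\<lambda>w. {b\<in>I. itin n b = w}) ` itin n ` I"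
    unfolding image_image cell_def ..
  then show ?thesis using finite_itin by (simp only: finite_imageI)
qed

lemma measure_finite_subset_I:
  assumes "A \<in> sets borel" "A \<subseteq> I"
  shows "A \<in> fmeasurable lborel"
proof (rule fmeasurableI)
  show "A \<in> sets lborel" using assms by simp
  have "emeasure lborel A \<le> emeasure lborel I" using assms by (intro emeasure_mono) auto
  then show "emeasure lborel A < \<infinity>" by (rule le_less_trans) (use lohi in simp)
qed

text \<open>Short cells have small total length by \<open>ratio_total\<close>, so the long cells near a compact set
  carry a definite proportion of it, while the set fills most of an open neighbourhood.\<close>

lemma long_cell_mostly_in_compact:
  assumes Kc: "compact Kc" "Kc \<subseteq> I" and pos: "0 < len Kc"
  obtains t where "0 < t"
    "\<And>\<kappa>. 0 < \<kappa> \<Longrightarrow> \<exists>n a c d. a \<in> I \<and> c \<in> cell n a \<and> d \<in> cell n a \<and> t \<le> \<bar>x n c - x n d\<bar> \<and>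
      len (cell n a - Kc) \<le> \<kappa> * len (cell n a) \<and> 0 < len (cell n a)"
proof
  \<comment> \<open>Cells whose image is shorter than \<open>t\<close> have total length at most
    \<open>ratio_const * t\<close>, half of \<open>len Kc\<close>, at every level. Thus
    \<open>t\<close> does not depend on the precision demanded later, which is what survives in the
    limit.\<close>
  define t where "t = len Kc / (2 * ratio_const)"
  show t0: "0 < t" using pos ratio_const_pos by (simp add: t_def)
  fix \<kappa> :: real assume \<kappa>: "0 < \<kappa>"
  have Kcb: "Kc \<in> sets borel" using Kc by (simp add: compact_imp_closed)
  \<comment> \<open>The long cells meeting \<open>Kc\<close> have total length at least half of
    \<open>len Kc\<close>. If each lost at least the proportion \<open>\<kappa>\<close>, the loss
    would exceed the quarter allowed here.\<close>
  have \<kappa>': "0 < \<kappa> * len Kc / 4" using \<kappa> pos by simp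
  obtain U where U: "open U" "Kc \<subseteq> U" "emeasure lborel (U - Kc) < ennreal (\<kappa> * len Kc / 4)"
    using outer_regular_lborel[OF Kcb \<kappa>'] by blast
  obtain e where e: "0 < e" "(\<Union>b\<in>Kc. ball b e) \<subseteq> U"
    using compact_subset_open_imp_ball_epsilon_subset[OF Kc(1) U(1,2)] by blast
  \<comment> \<open>At this level all cells have diameter below \<open>e\<close>, so a cell meeting
    \<open>Kc\<close> lies in the neighbourhood \<open>U\<close>.\<close>
  obtain n where n: "(1 / lam) ^ n < e * Q / (K + 1)"
    using real_arch_pow_inv[of "e * Q / (K + 1)" "1 / lam"] e Q0 K0 lam(2) by auto
  have diam: "\<bar>b - c\<bar> < e" if bc: "b \<in> cell n a" "c \<in> cell n a" for a b c
  proof -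
    have I: "b \<in> I" "c \<in> I" using cell_I[OF bc(1)] cell_I[OF bc(2)] by blast+
    have "Q * lam ^ n * \<bar>b - c\<bar> \<le> K + 1"
      using expand[OF I cell_itin[OF bc]] x_diff_le[OF I, of n] by linarith
    moreover have "K + 1 < Q * lam ^ n * e"
    proof -
      have "1 < lam ^ n * (e * Q / (K + 1))" using n lam(2)
          by (simp add: power_one_over divide_less_eq mult.commute)
      then have "1 * (K + 1) < lam ^ n * (e * Q / (K + 1)) * (K + 1)" using K0
          by (intro mult_strict_right_mono) auto
      then show ?thesis using K0 by (simp add: mult_ac)
    qed
    ultimately have "(Q * lam ^ n) * \<bar>b - c\<bar> < (Q * lam ^ n) * e" by linarith
    then show ?thesis using Q0 lam(2) by (simp add: mult_less_cancel_left_pos)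
  qed
  define P where "P = cell n ` I"
  define long where "long A \<longleftrightarrow> (\<exists>c\<in>A. \<exists>d\<in>A. t \<le> \<bar>x n c - x n d\<bar>)" for A
  define G where "G = {A\<in>P. long A \<and> A \<inter> Kc \<noteq> {}}"
  have finP: "finite P" unfolding P_def by (rule finite_cells)
  have finG: "finite G" using finP by (simp add: G_def)
  have PE: "\<exists>a\<in>I. A = cell n a" if "A \<in> P" for A using that by (auto simp: P_def)
  have Pb: "A \<in> sets borel" "A \<subseteq> I" if "A \<in> P" for A using PE[OF that] cell_subset_I by auto
  have disjP: "pairwise disjnt P"
    unfolding pairwise_def disjnt_def P_def using cells_disjoint by blast
  have UP: "\<Union> P = I" unfolding P_def using cell_self cell_subset_I by blast
  have short: "(\<Sum>A\<in>{A\<in>P. \<not> long A}. len A) \<le> len Kc / 2"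
  proof -
    have "(\<Sum>A\<in>{A\<in>P. \<not> long A}. len A) \<le> (\<Sum>A\<in>{A\<in>P. \<not> long A}. ratio n A * t)"
    proof (rule sum_mono)
      fix A assume "A \<in> {A\<in>P. \<not> long A}"
      then obtain a where a: "A = cell n a" "\<not> long A" using PE by blast
      show "len A \<le> ratio n A * t" unfolding a(1)
      proof (rule len_le_ratio)
        fix b c assume "b \<in> cell n a" "c \<in> cell n a"
        then show "\<bar>x n b - x n c\<bar> \<le> t" using a unfolding long_def by force
      qed (use t0 in simp)
    qed
    also have "\<dots> \<le> (\<Sum>A\<in>P. ratio n A * t)"
    proof (rule sum_mono2[OF finP])
      fix A assume "A \<in> P - {A\<in>P. \<not> long A}"
      then obtain a where "A = cell n a" using PE by blast
      then show "0 \<le> ratio n A * t" using ratio_nonneg[OF subset_refl, of n a] t0 by simp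
    qed auto
    also have "\<dots> \<le> ratio_const * t" unfolding sum_distrib_right[symmetric] P_def
      using ratio_total t0 by (intro mult_right_mono) auto
    also have "\<dots> = len Kc / 2" using ratio_const_pos by (simp add: t_def)
    finally show ?thesis .
  qed
  have total: "len Kc \<le> (\<Sum>A\<in>{A\<in>P. \<not> long A}. len A) + (\<Sum>A\<in>G. len A)"
  proof -
    have "Kc \<subseteq> \<Union> ({A\<in>P. \<not> long A} \<union> G)" using UP Kc(2) unfolding G_def by blast
    moreover have fm: "\<And>A. A \<in> {A\<in>P. \<not> long A} \<union> G \<Longrightarrow> A \<in> fmeasurable lborel"
      using Pb measure_finite_subset_I unfolding G_def by blast
    moreover have fin: "finite ({A\<in>P. \<not> long A} \<union> G)" using finP finG by simp
    ultimately have "len Kc \<le> measure lborel (\<Union> ({A\<in>P. \<not> long A} \<union> G))"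
      unfolding len_def
    proof (intro measure_mono_fmeasurable measure_finite_subset_I)
      show "\<Union> ({A\<in>P. \<not> long A} \<union> G) \<in> sets borel"
        using Pb(1) by (intro sets.finite_Union[OF fin]) (auto simp: G_def)
      show "\<Union> ({A\<in>P. \<not> long A} \<union> G) \<subseteq> I" using Pb(2) by (auto simp: G_def)
    qed (use Kcb in simp_all)
    also have "\<dots> \<le> (\<Sum>A\<in>{A\<in>P. \<not> long A} \<union> G. measure lborel A)"
      using measure_Union_le[OF fin] fm by (auto simp: fmeasurable_def)
    also have "\<dots> = (\<Sum>A\<in>{A\<in>P. \<not> long A}. len A) + (\<Sum>A\<in>G. len A)"
      unfolding len_def using finP finG by (intro sum.union_disjoint) (auto simp: G_def)
    finally show ?thesis .
  qed
  have ex: "\<exists>A\<in>G. 0 < len A \<and> len (A - Kc) \<le> \<kappa> * len A"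
  proof (rule ccontr)
    assume neg: "\<not> ?thesis"
    have "(\<Sum>A\<in>G. \<kappa> * len A) \<le> (\<Sum>A\<in>G. measure lborel (A - Kc))"
    proof (rule sum_mono)
      fix A assume "A \<in> G"
      then show "\<kappa> * len A \<le> measure lborel (A - Kc)"
        using neg len_nonneg[of A] len_nonneg[of "A - Kc"] unfolding len_def by (cases
            "measure lborel A = 0") (auto simp: not_le less_le)
    qed
    also have "\<dots> = measure lborel (\<Union>A\<in>G. A - Kc)"
    proof (rule measure_finite_Union[OF finG, symmetric])
      show "(\<lambda>A. A - Kc) ` G \<subseteq> sets lborel" using Pb(1) Kcb by (auto simp: G_def)
      show "disjoint_family_on (\<lambda>A. A - Kc) G"
        using disjP by (auto simp: disjoint_family_on_def pairwise_def disjnt_def G_def)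
      show "emeasure lborel (A - Kc) \<noteq> \<infinity>" if "A \<in> G" for A
      proof -
        have "A \<in> P" using that by (simp add: G_def)
        then have "A - Kc \<in> fmeasurable lborel" using Pb[of A] Kcb
            by (intro measure_finite_subset_I) auto
        then show ?thesis by (auto simp: fmeasurable_def)
      qed
    qed
    also have "\<dots> \<le> \<kappa> * len Kc / 4"
    proof -
      have "(\<Union>A\<in>G. A - Kc) \<subseteq> U - Kc"
      proof
        fix b assume "b \<in> (\<Union>A\<in>G. A - Kc)"
        then obtain A where A: "A \<in> G" "b \<in> A" "b \<notin> Kc" by blast
        then obtain c where c: "c \<in> A" "c \<in> Kc" unfolding G_def by blast
        obtain a where "A = cell n a" using A(1) PE unfolding G_def by blast
        then have "\<bar>c - b\<bar> < e" using diam c A by blast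
        then have "b \<in> ball c e" by (simp add: dist_real_def)
        then show "b \<in> U - Kc" using e(2) c(2) A(3) by blast
      qed
      then have "emeasure lborel (\<Union>A\<in>G. A - Kc) \<le> emeasure lborel (U - Kc)"
        using U(1) Kcb by (intro emeasure_mono) auto
      then have "emeasure lborel (\<Union>A\<in>G. A - Kc) \<le> ennreal (\<kappa> * len Kc / 4)" using U(3) by simp
      then have "enn2real (emeasure lborel (\<Union>A\<in>G. A - Kc)) \<le> \<kappa> * len Kc / 4"
        using \<kappa>' by (intro enn2real_leI) auto
      then show ?thesis by (simp add: measure_def)
    qed
    finally have "\<kappa> * (\<Sum>A\<in>G. len A) \<le> \<kappa> * (len Kc / 4)" by (simp add: sum_distrib_left)
    then have "(\<Sum>A\<in>G. len A) \<le> len Kc / 4" using \<kappa> by simp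
    then show False using total short pos by linarith
  qed
  then obtain A where A: "A \<in> G" "0 < len A" "len (A - Kc) \<le> \<kappa> * len A" by blast
  then obtain a where a: "a \<in> I" "A = cell n a" using PE unfolding G_def by blast
  obtain c d where "c \<in> A" "d \<in> A" "t \<le> \<bar>x n c - x n d\<bar>" using A(1) unfolding G_def long_def
      by blast
  then show "\<exists>n a c d. a \<in> I \<and> c \<in> cell n a \<and> d \<in> cell n a \<and> t \<le> \<bar>x n c - x n d\<bar> \<and>
      len (cell n a - Kc) \<le> \<kappa> * len (cell n a) \<and> 0 < len (cell n a)"
    using a A(2,3) by blast
qed

text \<open>A point of the image interval missed by \<open>x n\<close> on \<open>Kc\<close> can only
  come from the small part of the cell outside \<open>Kc\<close>. \<open>image_measure_lower\<close>
  converts the proportion of that part into a measure, at the cost of the factor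
  \<open>distortion_const * (K + 1)\<close>.\<close>

lemma image_compact_fills:
  assumes Kc: "compact Kc" "Kc \<subseteq> I" and pos: "0 < len Kc"
  obtains t where "0 < t"
    "\<And>\<kappa>. 0 < \<kappa> \<Longrightarrow> \<exists>n p c d. c \<in> I \<and> d \<in> I \<and> p = x n c \<and> p + t \<le> x n d \<and>
      emeasure lborel ({p..p+t} - x n ` Kc) \<le> ennreal \<kappa>"
proof -
  obtain t where t: "0 < t" and long: "\<And>\<kappa>. 0 < \<kappa> \<Longrightarrow> \<exists>n a c d. a \<in> I \<and> c \<in> cell n a \<and> d \<in> cell n a \<and> t
      \<le> \<bar>x n c - x n d\<bar> \<and>
      len (cell n a - Kc) \<le> \<kappa> * len (cell n a) \<and> 0 < len (cell n a)"
    using long_cell_mostly_in_compact[OF Kc pos] by blast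
  show thesis
  proof (rule that[OF t])
    fix \<kappa> :: real assume \<kappa>: "0 < \<kappa>"
    have CK: "0 < distortion_const * (K + 1)" using distortion_const_pos K0 by simp
    then have "0 < \<kappa> / (distortion_const * (K + 1))" using \<kappa> by simp
    then obtain n a c' d' where *: "a \<in> I" "c' \<in> cell n a" "d' \<in> cell n a" "t \<le> \<bar>x n c' - x n d'\<bar>"
      "len (cell n a - Kc) \<le> \<kappa> / (distortion_const * (K + 1)) * len (cell n a)" "0 < len (cell n a)"
      using long by blast
    define c where "c = (if x n c' \<le> x n d' then c' else d')"
    define d where "d = (if x n c' \<le> x n d' then d' else c')"
    have cd: "c \<in> cell n a" "d \<in> cell n a" "x n c + t \<le> x n d"
      using * by (auto simp: c_def d_def split: if_splits)
    have cdI: "c \<in> I" "d \<in> I" using cell_I[OF cd(1)] cell_I[OF cd(2)] by blast+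
    let ?A = "cell n a" and ?B = "{x n c..x n c + t} - x n ` Kc"
    have "compact (x n ` Kc)"
      by (rule compact_continuous_image[OF continuous_on_subset[OF x_continuous Kc(2)] Kc(1)])
    then have Bb: "?B \<in> sets borel" by (intro sets.Diff borel_closed[OF compact_imp_closed]) auto
    have m: "min (x n c) (x n d) = x n c" "max (x n c) (x n d) = x n d" using cd(3) t by auto
    have "ennreal (len ?A) * emeasure lborel ?B
        \<le> ennreal (distortion_const * (K + 1)) * emeasure lborel {b\<in>?A. x n b \<in> ?B}"
      by (rule image_measure_lower[OF cd(1,2) m(1)[symmetric] m(2)[symmetric] Bb]) (use cd(3) in
        auto)
    also have "emeasure lborel {b\<in>?A. x n b \<in> ?B} \<le> emeasure lborel (?A - Kc)"
      using Kc by (intro emeasure_mono) (auto simp: compact_imp_closed)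
    also have "emeasure lborel (?A - Kc) = ennreal (len (?A - Kc))"
    proof -
      have "?A - Kc \<in> fmeasurable lborel"
        using Kc cell_subset_I by (intro measure_finite_subset_I) (auto simp: compact_imp_closed)
      then show ?thesis unfolding len_def
          by (intro emeasure_eq_ennreal_measure) (auto simp: fmeasurable_def)
    qed
    also have "ennreal (distortion_const * (K + 1)) * ennreal (len (?A - Kc))
        \<le> ennreal (distortion_const * (K + 1)) * ennreal (\<kappa> / (distortion_const * (K + 1)) * len
            ?A)"
      by (intro mult_left_mono ennreal_leI *) simp
    also have "\<dots> = ennreal (len ?A) * ennreal \<kappa>"
    proof -
      have e: "distortion_const * (K + 1) * (\<kappa> / (distortion_const * (K + 1)) * len ?A)
          = len ?A * \<kappa>"
      proof -
        have "D * (\<kappa> / D * y) = y * \<kappa>" if "0 < D" for D y :: real using that by simp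
        then show ?thesis using CK by blast
      qed
      have "ennreal (distortion_const * (K + 1)) * ennreal (\<kappa> / (distortion_const * (K + 1)) * len
          ?A) = ennreal (distortion_const * (K + 1) * (\<kappa> / (distortion_const * (K + 1)) * len ?A))"
        using CK \<kappa> len_nonneg by (intro ennreal_mult[symmetric]) auto
      also have "\<dots> = ennreal (len ?A) * ennreal \<kappa>" unfolding e using \<kappa> len_nonneg
          by (intro ennreal_mult) auto
      finally show ?thesis .
    qed
    finally have "ennreal (len ?A) * emeasure lborel ?B \<le> ennreal (len ?A) * ennreal \<kappa>"
        by (simp add: mult_left_mono)
    then have "emeasure lborel ?B \<le> ennreal \<kappa>"
      using *(6) by (subst (asm) ennreal_mult_le_mult_iff) auto
    then show "\<exists>n p c d. c \<in> I \<and> d \<in> I \<and> p = x n c \<and> p + t \<le> x n d \<and>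
      emeasure lborel ({p..p+t} - x n ` Kc) \<le> ennreal \<kappa>"
      using cdI cd(3) by blast
  qed
qed

text \<open>The intervals have a fixed length \<open>t\<close> while the measure missing from
  \<open>A\<close> tends to 0. Compactness of \<open>{u..v}\<close> gives convergent left ends, and
  a fixed interval survives in the limit.\<close>

theorem image_contains_interval:
  assumes Kc: "compact Kc" "Kc \<subseteq> I" and pos: "0 < len Kc"
    and A: "A \<in> sets borel" "\<And>n. x n ` Kc \<subseteq> A"
    and uv: "\<And>n a. a \<in> I \<Longrightarrow> x n a \<in> {u..v}"
  obtains p q where "p < q" "{p..q} \<subseteq> {u..v}" "emeasure lborel ({p..q} - A) = 0"
proof -
  obtain t where t: "0 < t" and fill: "\<And>\<kappa>. 0 < \<kappa> \<Longrightarrow> \<exists>n p c d. c \<in> I \<and> d \<in> I \<and> p = x n c \<and> p + t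
      \<le> x n d \<and>
      emeasure lborel ({p..p+t} - x n ` Kc) \<le> ennreal \<kappa>"
    using image_compact_fills[OF Kc pos] by blast
  have "\<exists>p. u \<le> p \<and> p + t \<le> v \<and> emeasure lborel ({p..p+t} - A) \<le> ennreal (1 / real (Suc m))" for m
  proof -
    obtain n p c d where *: "c \<in> I" "d \<in> I" "p = x n c" "p + t \<le> x n d"
      "emeasure lborel ({p..p+t} - x n ` Kc) \<le> ennreal (1 / real (Suc m))"
      using fill[of "1 / real (Suc m)"] by auto
    have "emeasure lborel ({p..p+t} - A) \<le> emeasure lborel ({p..p+t} - x n ` Kc)"
    proof (rule emeasure_mono)
      show "{p..p+t} - A \<subseteq> {p..p+t} - x n ` Kc" using A(2)[of n] by blast
      have "compact (x n ` Kc)"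
        by (rule compact_continuous_image[OF continuous_on_subset[OF x_continuous Kc(2)] Kc(1)])
      then show "{p..p+t} - x n ` Kc \<in> sets lborel"
        using borel_closed[OF compact_imp_closed] by (auto intro!: sets.Diff)
    qed
    moreover have "u \<le> p" "p + t \<le> v" using uv[OF *(1), of n] uv[OF *(2), of n] * by auto
    ultimately show ?thesis using *(5) by (blast intro: order_trans)
  qed
  then obtain p where p: "\<And>m. u \<le> p m" "\<And>m. p m + t \<le> v"
    "\<And>m. emeasure lborel ({p m..p m + t} - A) \<le> ennreal (1 / real (Suc m))" by metis
  have "\<forall>m. p m \<in> {u..v}"
  proof
    fix m show "p m \<in> {u..v}" using p(1)[of m] p(2)[of m] t by simp
  qed
  then obtain l r where lr: "strict_mono (r :: nat \<Rightarrow> nat)" "(p \<circ> r) \<longlonglongrightarrow> l"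
    using compact_Icc[of u v] unfolding compact_def by blast
  have "\<forall>\<^sub>F m in sequentially. \<bar>p (r m) - l\<bar> < t / 3"
    using tendstoD[OF lr(2), of "t/3"] t by (simp add: dist_real_def)
  then obtain M where M: "\<And>m. m \<ge> M \<Longrightarrow> \<bar>p (r m) - l\<bar> < t / 3" by (auto simp: eventually_sequentially)
  \<comment> \<open>The middle third of the limit interval: once the left ends are within
    \<open>t / 3\<close> of \<open>l\<close>, all intervals of the subsequence contain it.\<close>
  let ?P = "{l + t / 3..l + 2 * t / 3}"
  have sub: "?P \<subseteq> {p (r m)..p (r m) + t}" if "m \<ge> M" for m
  proof -
    have "p (r m) \<le> l + t / 3" "l + 2 * t / 3 \<le> p (r m) + t" using M[OF that] by linarith+
    then show ?thesis by auto
  qed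
  show thesis
  proof (rule that[of "l + t/3" "l + 2 * t / 3"])
    show "l + t / 3 < l + 2 * t / 3" using t by simp
    show "?P \<subseteq> {u..v}" using sub[of M] p(1)[of "r M"] p(2)[of "r M"] by fastforce
    have "emeasure lborel (?P - A) \<le> 0"
    proof (rule ennreal_le_epsilon)
      fix e :: real assume e: "0 < e"
      obtain m where m: "1 / real (Suc m) < e" using nat_approx_posE[OF e] by auto
      define k where "k = max m M"
      have "emeasure lborel (?P - A) \<le> emeasure lborel ({p (r k)..p (r k) + t} - A)"
        using sub[of k] A(1) by (intro emeasure_mono) (auto simp: k_def)
      also have "\<dots> \<le> ennreal (1 / real (Suc (r k)))" by (rule p(3))
      also have "\<dots> \<le> ennreal e"
      proof (rule ennreal_leI)
        have "m \<le> r k" using seq_suble[OF lr(1), of k] by (simp add: k_def)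
        then have "1 / real (Suc (r k)) \<le> 1 / real (Suc m)" by (intro divide_left_mono) auto
        then show "1 / real (Suc (r k)) \<le> e" using m by linarith
      qed
      finally show "emeasure lborel (?P - A) \<le> 0 + ennreal e" by simp
    qed
    then show "emeasure lborel (?P - A) = 0" by simp
  qed
qed

end

section \<open>Uniqueness of the invariant measure\<close>

definition slope :: "real \<Rightarrow> (real \<Rightarrow> real) \<Rightarrow> bool \<Rightarrow> real \<Rightarrow> real" where
  "slope K T s = deriv_within (branch K s) T"

lemma mvt_within_segment:
  fixes f f' :: "real \<Rightarrow> real"
  assumes S: "convex S" and p: "p \<in> S" and q: "q \<in> S"
    and f': "\<And>y. y \<in> S \<Longrightarrow> (f has_real_derivative f' y) (at y within S)"
  shows "\<exists>\<xi>\<in>closed_segment p q. f p - f q = f' \<xi> * (p - q)"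
proof -
  have main: "\<exists>\<xi>\<in>closed_segment p q. f p - f q = f' \<xi> * (p - q)" if "p < q" "p \<in> S" "q \<in> S" for p q
  proof -
    have sub: "{p..q} \<subseteq> S"
      using closed_segment_subset[OF that(2,3) S] that(1) by (simp add: closed_segment_eq_real_ivl)
    have "\<exists>\<xi>\<in>{p<..<q}. f q - f p = f' \<xi> * (q - p)"
    proof (rule mvt_simple[OF that(1)])
      fix y assume "p \<le> y" "y \<le> q"
      then have "y \<in> S" using sub by auto
      then show "(f has_derivative (*) (f' y)) (at y within {p..q})"
        using f' has_derivative_subset[OF _ sub] by (auto simp: has_field_derivative_def)
    qed
    then obtain \<xi> where \<xi>: "\<xi> \<in> {p<..<q}" "f q - f p = f' \<xi> * (q - p)" by blast
    have "f p - f q = f' \<xi> * (p - q)" using \<xi>(2) by (simp add: algebra_simps)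
    moreover have "\<xi> \<in> closed_segment p q" using \<xi>(1) that(1)
        by (simp add: closed_segment_eq_real_ivl)
    ultimately show ?thesis by blast
  qed
  consider "p < q" | "q < p" | "p = q" by linarith
  then show ?thesis
  proof cases
    case 1 then show ?thesis using main p q by blast
  next
    case 2
    then obtain \<xi> where "\<xi> \<in> closed_segment q p" "f q - f p = f' \<xi> * (q - p)" using main p q
        by blast
    then have "\<xi> \<in> closed_segment p q" "f p - f q = f' \<xi> * (p - q)"
      by (simp_all add: closed_segment_commute algebra_simps)
    then show ?thesis by blast
  qed auto
qed

lemma convex_branch: "convex (branch K s)"
  by (simp add: branch_def)

lemma C1_on_has_derivative:
  fixes f :: "real \<Rightarrow> real"
  assumes "C1_on S f" "y \<in> S"
  shows "(f has_real_derivative deriv_within S f y) (at y within S)"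
  using assms by (simp add: C1_on_def differentiable_on_def
      has_real_derivative_iff_has_vector_derivative
      vector_derivative_works[symmetric])

locale unimodal =
  fixes K L :: real and T :: "real \<Rightarrow> real"
  assumes K: "0 < K" and T: "T \<in> unimodal_maps K L"
begin

lemma C11: "C11_on L (branch K s) T"
  using T by (auto simp: unimodal_maps_def branch_def)

lemma slope_derivative: "y \<in> branch K s \<Longrightarrow> (T has_real_derivative slope K T s y) (at y within branch
    K s)"
  unfolding slope_def using C11 by (intro C1_on_has_derivative) (auto simp: C11_on_def)

lemma T_mvt: "p \<in> branch K s \<Longrightarrow> q \<in> branch K s \<Longrightarrow> \<exists>\<xi>\<in>closed_segment p q. T p - T q
    = slope K T s \<xi> * (p - q)"
  by (rule mvt_within_segment[OF convex_branch]) (auto intro: slope_derivative)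

lemma slope_lipschitz: "y \<in> branch K s \<Longrightarrow> z \<in> branch K s \<Longrightarrow> \<bar>slope K T s y - slope K T s z\<bar>
    \<le> L * \<bar>y - z\<bar>"
  using C11[of s] lipschitz_onD[of L "branch K s" "slope K T s" y z]
  by (simp add: C11_on_def slope_def dist_real_def)

lemma L_nonneg: "0 \<le> L"
  using C11[of True] lipschitz_on_nonneg by (auto simp: C11_on_def)

lemma slope_continuous: "continuous_on (branch K s) (slope K T s)"
  using C11[of s] by (simp add: C11_on_def C1_on_def slope_def)

lemma slope_left: "y \<in> branch K False \<Longrightarrow> 1 < slope K T False y"
proof -
  assume y: "y \<in> branch K False"
  have "bdd_below (slope K T False ` {-K..0})"
    using compact_continuous_image[OF slope_continuous[of False]]
    by (intro bounded_imp_bdd_below compact_imp_bounded) (simp add: branch_def)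
  then have "(INF x\<in>{-K..0}. slope K T False x) \<le> slope K T False y"
    using y by (intro cINF_lower) (simp_all add: branch_def)
  moreover have "1 < (INF x\<in>{-K..0}. slope K T False x)"
    using T by (simp add: unimodal_maps_def slope_def branch_def)
  ultimately show ?thesis by linarith
qed

lemma slope_right: "y \<in> branch K True \<Longrightarrow> slope K T True y < -1"
proof -
  assume y: "y \<in> branch K True"
  have "bdd_above (slope K T True ` {0..1})"
    using compact_continuous_image[OF slope_continuous[of True]]
    by (intro bounded_imp_bdd_above compact_imp_bounded) (simp add: branch_def)
  then have "slope K T True y \<le> (SUP x\<in>{0..1}. slope K T True x)"
    using y by (intro cSUP_upper) (simp_all add: branch_def)
  moreover have "(SUP x\<in>{0..1}. slope K T True x) < -1"
    using T by (simp add: unimodal_maps_def slope_def branch_def)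
  ultimately show ?thesis by linarith
qed

lemma T_0: "T 0 = 1" and T_1: "-K < T 1" and T_T_1: "T 1 \<le> T (T 1)"
  and T_continuous: "continuous_on {-K..1} T"
  using T by (auto simp: unimodal_maps_def)

lemma T_increasing:
  assumes "p \<in> {-K..0}" "q \<in> {-K..0}" "p \<le> q"
  shows "T p \<le> T q"
proof -
  have b: "p \<in> branch K False" "q \<in> branch K False" using assms by (auto simp: branch_def)
  obtain \<xi> where \<xi>: "\<xi> \<in> closed_segment p q" "T p - T q = slope K T False \<xi> * (p - q)"
    using T_mvt[OF b] by blast
  have "\<xi> \<in> branch K False" using closed_segment_subset[OF b convex_branch] \<xi>(1) by blast
  then have "slope K T False \<xi> * (p - q) \<le> 0"
    using slope_left assms(3) by (intro mult_nonneg_nonpos) (auto simp: less_imp_le intro: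
        order_trans[OF zero_le_one])
  then show ?thesis using \<xi>(2) by linarith
qed

lemma T_decreasing:
  assumes "p \<in> {0..1}" "q \<in> {0..1}" "p \<le> q"
  shows "T q \<le> T p"
proof -
  have b: "p \<in> branch K True" "q \<in> branch K True" using assms by (auto simp: branch_def)
  obtain \<xi> where \<xi>: "\<xi> \<in> closed_segment p q" "T p - T q = slope K T True \<xi> * (p - q)"
    using T_mvt[OF b] by blast
  have "\<xi> \<in> branch K True" using closed_segment_subset[OF b convex_branch] \<xi>(1) by blast
  then have "slope K T True \<xi> < -1" by (rule slope_right)
  then have "0 \<le> slope K T True \<xi> * (p - q)"
    using assms(3) by (intro mult_nonpos_nonpos) auto
  then show ?thesis using \<xi>(2) by linarith
qed

lemma T_1_neg: "T 1 < 0"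
proof -
  have b: "0 \<in> branch K True" "1 \<in> branch K True" by (auto simp: branch_def)
  obtain \<xi> where \<xi>: "\<xi> \<in> closed_segment 0 1" "T 0 - T 1 = slope K T True \<xi> * (0 - 1)"
    using T_mvt[OF b] by blast
  have "\<xi> \<in> branch K True" using closed_segment_subset[OF b convex_branch] \<xi>(1) by blast
  then have "slope K T True \<xi> < -1" by (rule slope_right)
  then show ?thesis using \<xi>(2) T_0 by simp
qed

abbreviation X :: "real set" where "X \<equiv> {T 1..1}"

lemma X_subset: "X \<subseteq> {-K..1}"
  using T_1 by auto

lemma zero_in_X: "0 \<in> X"
  using T_1_neg by simp

text \<open>On the left branch the least value is attained at \<open>T 1\<close>, where the
  condition T (T 1) \<ge> T 1 enters; on the right branch the extremes are \<open>T 0\<close> and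
  \<open>T 1\<close>.\<close>

lemma T_invariant: "y \<in> X \<Longrightarrow> T y \<in> X"
proof -
  assume y: "y \<in> X"
  show ?thesis
  proof (cases "y \<le> 0")
    case True
    have "T y \<le> T 0" using y True T_1 K by (intro T_increasing) auto
    moreover have "T (T 1) \<le> T y" using y True T_1 T_1_neg by (intro T_increasing) auto
    ultimately show ?thesis using T_0 T_T_1 by auto
  next
    case False
    have "T y \<le> T 0" "T 1 \<le> T y" using y False by (auto intro!: T_decreasing)
    then show ?thesis using T_0 by auto
  qed
qed

lemma T_iterate_invariant: "y \<in> X \<Longrightarrow> (T ^^ n) y \<in> X"
  by (induction n) (auto simp only: funpow.simps o_apply id_apply intro: T_invariant)

lemma T_cont_X: "continuous_on X T"
  by (rule continuous_on_subset[OF T_continuous X_subset])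

lemma iterate_cont_X: "continuous_on X (T ^^ n)"
proof (induction n)
  case (Suc n)
  have "continuous_on X (T \<circ> (T ^^ n))"
    by (rule continuous_on_compose[OF Suc continuous_on_subset[OF T_cont_X]]) (use
      T_iterate_invariant in blast)
  then show ?case by (simp only: funpow.simps)
qed (simp add: continuous_on_id)

lemma preimage_borel_X:
  assumes f: "continuous_on X f" and A: "A \<in> sets borel"
  shows "{y\<in>X. f y \<in> A} \<in> sets (borel :: real measure)"
proof -
  have "f \<in> borel_measurable (restrict_space borel X)"
    by (rule borel_measurable_continuous_on_restrict[OF f])
  then have "f -` A \<inter> space (restrict_space borel X) \<in> sets (restrict_space borel X)"
    by (rule measurable_sets) (rule A)
  moreover have "f -` A \<inter> space (restrict_space borel X) = {y\<in>X. f y \<in> A}"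
    by (auto simp: space_restrict_space)
  ultimately have "{y\<in>X. f y \<in> A} \<in> sets (restrict_space borel X)" by (simp only:)
  then show ?thesis by (subst (asm) sets_restrict_space_iff) simp_all
qed

lemma iterate_preimage_borel: "A \<in> sets borel \<Longrightarrow> {y\<in>X. (T ^^ n) y \<in> A} \<in> sets borel"
  by (rule preimage_borel_X[OF iterate_cont_X])

section \<open>Two different invariant measures yield disjoint invariant sets\<close>

lemma acip_facts:
  assumes "is_acip T \<mu>"
  shows "prob_space \<mu>" "sets \<mu> = sets borel" "emeasure \<mu> X = 1" "absolutely_continuous lborel \<mu>"
    and acip_invariant: "A \<in> sets borel \<Longrightarrow> emeasure \<mu> {y\<in>X. T y \<in> A} = emeasure \<mu> A"
proof -
  have eq: "T -` A \<inter> X = {y\<in>X. T y \<in> A}" for A by auto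
  show "prob_space \<mu>" "sets \<mu> = sets borel" "emeasure \<mu> X = 1" "absolutely_continuous lborel \<mu>"
    using assms unfolding is_acip_def by blast+
  show "emeasure \<mu> {y\<in>X. T y \<in> A} = emeasure \<mu> A" if "A \<in> sets borel"
    using assms that unfolding is_acip_def eq[symmetric] by blast
qed

lemma acip_iterate:
  assumes "is_acip T \<mu>" "A \<in> sets borel"
  shows "emeasure \<mu> {y\<in>X. (T ^^ n) y \<in> A} = emeasure \<mu> A"
proof (induction n)
  case 0
  interpret prob_space \<mu> by (rule acip_facts(1)[OF assms(1)])
  have s: "sets \<mu> = sets borel" by (rule acip_facts(2)[OF assms(1)])
  have "emeasure \<mu> A = emeasure \<mu> (A \<inter> X)"
  proof (rule emeasure_eq_AE)
    have "AE y in \<mu>. y \<in> X"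
      using acip_facts(3)[OF assms(1)] s by (intro AE_in_set_eq_1[THEN iffD2]) (auto simp:
          measure_def)
    then show "AE y in \<mu>. (y \<in> A) = (y \<in> A \<inter> X)" by eventually_elim auto
  qed (use assms s in auto)
  moreover have "A \<inter> X = {y\<in>X. (T ^^ 0) y \<in> A}" by auto
  ultimately show ?case by simp
next
  case (Suc n)
  have "{y\<in>X. (T ^^ Suc n) y \<in> A} = {y\<in>X. T y \<in> {y\<in>X. (T ^^ n) y \<in> A}}"
    using T_invariant by (auto simp: funpow_swap1 simp del: atLeastAtMost_iff)
  then show ?case
    using acip_invariant[OF assms(1) iterate_preimage_borel[OF assms(2)]] Suc by simp
qed

text \<open>Invariance forces the positive part of the difference of two invariant measures to be carried
  by a forward invariant set.\<close>

lemma hahn_invariant_set: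
  assumes \<mu>: "is_acip T \<mu>" and \<nu>: "is_acip T \<nu>" and Y: "Y \<in> sets borel"
    and ge: "\<And>B. B \<in> sets borel \<Longrightarrow> B \<subseteq> Y \<Longrightarrow> emeasure \<nu> B \<le> emeasure \<mu> B"
    and le: "\<And>B. B \<in> sets borel \<Longrightarrow> B \<inter> Y = {} \<Longrightarrow> emeasure \<mu> B \<le> emeasure \<nu> B"
    and pos: "emeasure \<nu> Y < emeasure \<mu> Y"
  shows "0 < emeasure lborel {y\<in>X. \<forall>n. (T ^^ n) y \<in> Y}"
proof -
  interpret \<mu>: prob_space \<mu> by (rule acip_facts(1)[OF \<mu>])
  interpret \<nu>: prob_space \<nu> by (rule acip_facts(1)[OF \<nu>])
  have s\<mu>: "sets \<mu> = sets borel" by (rule acip_facts(2)[OF \<mu>])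
  have s\<nu>: "sets \<nu> = sets borel" by (rule acip_facts(2)[OF \<nu>])
  define d where "d B = measure \<mu> B - measure \<nu> B" for B
  have d_ge: "0 \<le> d B" if "B \<in> sets borel" "B \<subseteq> Y" for B
    using ge[OF that] by (simp add: d_def \<mu>.emeasure_eq_measure \<nu>.emeasure_eq_measure)
  have d_le: "d B \<le> 0" if "B \<in> sets borel" "B \<inter> Y = {}" for B
    using le[OF that] by (simp add: d_def \<mu>.emeasure_eq_measure \<nu>.emeasure_eq_measure)
  have d_Un: "d (A \<union> B) = d A + d B" if "A \<in> sets borel" "B \<in> sets borel" "A \<inter> B = {}" for A B
    using that s\<mu> s\<nu> by (simp add: d_def \<mu>.finite_measure_Union \<nu>.finite_measure_Union)
  define Yn where "Yn n = {y\<in>X. (T ^^ n) y \<in> Y}" for n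
  have Yn: "Yn n \<in> sets borel" for n unfolding Yn_def by (rule iterate_preimage_borel[OF Y])
  have Yn0: "Yn 0 \<subseteq> Y" by (auto simp: Yn_def)
  have dYn: "d (Yn n) = d Y" for n
    using acip_iterate[OF \<mu> Y, of n] acip_iterate[OF \<nu> Y, of n]
    by (simp add: d_def measure_def Yn_def)
  \<comment> \<open>Invariance gives \<open>Yn n\<close> and \<open>Yn 0\<close> the same
    \<open>d\<close>. Removing their common part leaves a nonpositive amount outside
    \<open>Y\<close> equal to a nonnegative amount inside it, so both vanish.\<close>
  have diff0: "d (Yn 0 - Yn n) = 0" for n
  proof -
    have e1: "Yn n = (Yn 0 \<inter> Yn n) \<union> (Yn n - Y)" and e2: "Yn 0 = (Yn 0 \<inter> Yn n) \<union> (Yn 0 - Yn n)"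
      by (auto simp: Yn_def)
    have "d (Yn n) = d (Yn 0 \<inter> Yn n) + d (Yn n - Y)"
      by (subst e1, rule d_Un) (use Yn Y Yn0 in blast)+
    moreover have "d (Yn n - Y) \<le> 0" using Yn Y by (intro d_le) auto
    moreover have "d (Yn 0) = d (Yn 0 \<inter> Yn n) + d (Yn 0 - Yn n)"
      by (subst e2, rule d_Un) (use Yn in auto)
    moreover have "0 \<le> d (Yn 0 - Yn n)" by (intro d_ge sets.Diff Yn) (use Yn0 in blast)
    ultimately show ?thesis using dYn[of n] dYn[of 0] by linarith
  qed
  \<comment> \<open>Points that start in \<open>Y\<close> and leave it at some time below
    \<open>n\<close>. As \<open>d\<close> is nonnegative on subsets of \<open>Y\<close>, it vanishes
    on these finite unions and, by continuity from below, on the set of all points that ever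
    leave.\<close>
  define Z where "Z n = (\<Union>i<n. Yn 0 - Yn i)" for n :: nat
  have Z: "Z n \<in> sets borel" for n unfolding Z_def by (intro sets.finite_UN sets.Diff Yn) simp
  have dZ: "d (Z n) = 0" for n
  proof (induction n)
    case 0 then show ?case by (simp add: Z_def d_def)
  next
    case (Suc n)
    let ?W = "Yn 0 - Yn n"
    have "Z (Suc n) = Z n \<union> (?W - Z n)" by (auto simp: Z_def lessThan_Suc)
    then have "d (Z (Suc n)) = d (Z n) + d (?W - Z n)"
      using d_Un[OF Z, of "?W - Z n" n] Yn Z by auto
    moreover have "d ?W = d (?W \<inter> Z n) + d (?W - Z n)"
    proof -
      have "?W = (?W \<inter> Z n) \<union> (?W - Z n)" by auto
      then show ?thesis using d_Un[of "?W \<inter> Z n" "?W - Z n"] Yn Z by auto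
    qed
    moreover have "0 \<le> d (?W \<inter> Z n)" "0 \<le> d (?W - Z n)"
      by (intro d_ge sets.Diff sets.Int Yn Z; use Yn0 in blast)+
    ultimately show ?case using Suc diff0[of n] by linarith
  qed
  have inc: "incseq Z" by (auto simp: incseq_def Z_def)
  have "(\<lambda>n. d (Z n)) \<longlonglongrightarrow> d (\<Union>n. Z n)"
    unfolding d_def using Z s\<mu> s\<nu> inc
    by (intro tendsto_diff \<mu>.finite_Lim_measure_incseq \<nu>.finite_Lim_measure_incseq) auto
  then have dU: "d (\<Union>n. Z n) = 0" using dZ by (simp add: LIMSEQ_const_iff)
  define Y' where "Y' = {y\<in>X. \<forall>n. (T ^^ n) y \<in> Y}"
  have Y'_eq: "Y' = (\<Inter>n. Yn n)" by (auto simp: Y'_def Yn_def)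
  have Y': "Y' \<in> sets borel" unfolding Y'_eq using Yn by (intro sets.countable_INT) auto
  have UZ: "(\<Union>n. Z n) \<in> sets borel" using Z by auto
  have "Yn 0 = Y' \<union> (\<Union>n. Z n)" by (auto simp: Y'_eq Z_def)
  moreover have "Y' \<inter> (\<Union>n. Z n) = {}" by (auto simp: Y'_eq Z_def)
  ultimately have "d (Yn 0) = d Y'" using d_Un[OF Y' UZ] dU by simp
  moreover have "0 < d Y"
    using pos by (simp add: d_def \<mu>.emeasure_eq_measure \<nu>.emeasure_eq_measure ennreal_less_iff)
  ultimately have "0 < d Y'" using dYn[of 0] by simp
  then have "0 < measure \<mu> Y'" using measure_nonneg[of \<nu> Y'] unfolding d_def by linarith
  then have "emeasure \<mu> Y' \<noteq> 0" by (auto simp: measure_def)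
  then have "Y' \<notin> null_sets \<mu>" by auto
  then have "Y' \<notin> null_sets lborel" using acip_facts(4)[OF \<mu>]
      by (auto simp: absolutely_continuous_def)
  then show ?thesis using Y' by (auto simp: Y'_def null_sets_def zero_less_iff_neq_zero)
qed

text \<open>A Hahn set \<open>Y\<close> for the difference and its complement, with the roles of the
  measures exchanged, both go through \<open>hahn_invariant_set\<close>; orbits staying in
  \<open>Y\<close> and orbits staying outside \<open>Y\<close> form disjoint sets.\<close>

lemma acip_unique_if_no_disjoint_invariant_sets:
  assumes \<mu>: "is_acip T \<mu>" and \<nu>: "is_acip T \<nu>"
    and no: "\<And>A B. A \<in> sets borel \<Longrightarrow> B \<in> sets borel \<Longrightarrow> A \<subseteq> X \<Longrightarrow> B \<subseteq> X \<Longrightarrow> T ` A \<subseteq> A \<Longrightarrow> T ` B \<subseteq> B \<Longrightarrow> A \<inter> B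
        = {}
       \<Longrightarrow> 0 < emeasure lborel A \<Longrightarrow> 0 < emeasure lborel B \<Longrightarrow> False"
  shows "\<mu> = \<nu>"
proof (rule ccontr)
  assume neq: "\<mu> \<noteq> \<nu>"
  interpret \<mu>: prob_space \<mu> by (rule acip_facts(1)[OF \<mu>])
  interpret \<nu>: prob_space \<nu> by (rule acip_facts(1)[OF \<nu>])
  have s\<mu>: "sets \<mu> = sets borel" by (rule acip_facts(2)[OF \<mu>])
  have s\<nu>: "sets \<nu> = sets borel" by (rule acip_facts(2)[OF \<nu>])
  have sp: "space \<mu> = UNIV" "space \<nu> = UNIV"
      using sets_eq_imp_space_eq[OF s\<mu>] sets_eq_imp_space_eq[OF s\<nu>] by auto
  obtain Y where Y: "Y \<in> sets \<mu>" and ge: "\<forall>B\<in>sets \<mu>. B \<subseteq> Y \<longrightarrow> emeasure \<nu> B \<le> emeasure \<mu> B"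
    and le: "\<forall>B\<in>sets \<mu>. B \<inter> Y = {} \<longrightarrow> emeasure \<mu> B \<le> emeasure \<nu> B"
    using finite_unsigned_Hahn_decomposition[OF \<mu>.finite_measure_axioms \<nu>.finite_measure_axioms] s\<mu>
        s\<nu> by metis
  have Yb: "Y \<in> sets borel" using Y s\<mu> by simp
  define d where "d B = measure \<mu> B - measure \<nu> B" for B
  have d_ge: "0 \<le> d B" if "B \<in> sets borel" "B \<subseteq> Y" for B
    using ge that s\<mu> by (simp add: d_def \<mu>.emeasure_eq_measure \<nu>.emeasure_eq_measure)
  have d_le: "d B \<le> 0" if "B \<in> sets borel" "B \<inter> Y = {}" for B
    using le that s\<mu> by (simp add: d_def \<mu>.emeasure_eq_measure \<nu>.emeasure_eq_measure)
  have d_Un: "d (A \<union> B) = d A + d B" if "A \<in> sets borel" "B \<in> sets borel" "A \<inter> B = {}" for A B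
    using that s\<mu> s\<nu> by (simp add: d_def \<mu>.finite_measure_Union \<nu>.finite_measure_Union)
  have d_UNIV: "d UNIV = 0" using \<mu>.prob_space \<nu>.prob_space sp by (simp add: d_def)
  have d_compl: "d (- Y) = - d Y"
    using d_Un[of Y "- Y"] Yb d_UNIV by auto
  \<comment> \<open>Otherwise \<open>d\<close> is 0 on \<open>Y\<close> and on its complement, since
    both measures have total mass 1. Being of one sign on the subsets of either, it vanishes
    everywhere.\<close>
  have "d Y \<noteq> 0"
  proof
    assume dY: "d Y = 0"
    have "emeasure \<mu> B = emeasure \<nu> B" if B: "B \<in> sets \<mu>" for B
    proof -
      have Bb: "B \<in> sets borel" using B s\<mu> by simp
      have "d Y = d (Y \<inter> B) + d (Y - B)" using d_Un[of "Y \<inter> B" "Y - B"] Yb Bb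
          by (auto simp: Int_Diff_Un)
      moreover have "0 \<le> d (Y \<inter> B)" "0 \<le> d (Y - B)" using Yb Bb by (auto intro!: d_ge)
      moreover have "d (- Y) = d (B - Y) + d (- Y - B)"
      proof -
        have "- Y = (B - Y) \<union> (- Y - B)" by auto
        then show ?thesis using d_Un[of "B - Y" "- Y - B"] Yb Bb by auto
      qed
      moreover have "d (B - Y) \<le> 0" "d (- Y - B) \<le> 0" using Yb Bb by (auto intro!: d_le)
      moreover have "d B = d (Y \<inter> B) + d (B - Y)"
      proof -
        have "B = (Y \<inter> B) \<union> (B - Y)" by auto
        then show ?thesis using d_Un[of "Y \<inter> B" "B - Y"] Yb Bb by auto
      qed
      ultimately have "d B = 0" using dY d_compl by linarith
      then show ?thesis by (simp add: d_def \<mu>.emeasure_eq_measure \<nu>.emeasure_eq_measure)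
    qed
    then have "\<mu> = \<nu>" using s\<mu> s\<nu> by (intro measure_eqI) auto
    then show False using neq by simp
  qed
  moreover have "0 \<le> d Y" using Yb by (intro d_ge) auto
  ultimately have dY: "0 < d Y" by simp
  define A where "A = {y\<in>X. \<forall>n. (T ^^ n) y \<in> Y}"
  define B where "B = {y\<in>X. \<forall>n. (T ^^ n) y \<in> - Y}"
  have inv: "T ` {y\<in>X. \<forall>n. (T ^^ n) y \<in> W} \<subseteq> {y\<in>X. \<forall>n. (T ^^ n) y \<in> W}" for W
  proof (rule image_subsetI, rule CollectI, intro conjI allI)
    fix y n assume y: "y \<in> {y\<in>X. \<forall>n. (T ^^ n) y \<in> W}"
    then show "T y \<in> X" using T_invariant by blast
    have "(T ^^ Suc n) y \<in> W" using y by blast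
    then show "(T ^^ n) (T y) \<in> W" by (simp add: funpow_swap1)
  qed
  have meas: "{y\<in>X. \<forall>n. (T ^^ n) y \<in> W} \<in> sets borel" if "W \<in> sets borel" for W
  proof -
    have "{y\<in>X. \<forall>n. (T ^^ n) y \<in> W} = (\<Inter>n. {y\<in>X. (T ^^ n) y \<in> W})" by auto
    then show ?thesis using iterate_preimage_borel[OF that] by (auto intro!: sets.countable_INT)
  qed
  have "0 < emeasure lborel A" unfolding A_def
    using dY ge le s\<mu> by (intro hahn_invariant_set[OF \<mu> \<nu> Yb])
      (auto simp: d_def \<mu>.emeasure_eq_measure \<nu>.emeasure_eq_measure ennreal_less_iff)
  moreover have "0 < emeasure lborel B" unfolding B_def
    using dY d_compl ge le s\<mu> Yb by (intro hahn_invariant_set[OF \<nu> \<mu>])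
      (auto simp: d_def \<mu>.emeasure_eq_measure \<nu>.emeasure_eq_measure ennreal_less_iff)
  moreover have "A \<inter> B = {}"
  proof -
    have "y \<in> Y" if "y \<in> A" for y using that spec[of "\<lambda>n. (T ^^ n) y \<in> Y" 0] by (simp add: A_def)
    moreover have "y \<notin> Y" if "y \<in> B" for y using that spec[of "\<lambda>n. (T ^^ n) y \<in> - Y" 0]
        by (simp add: B_def)
    ultimately show ?thesis by blast
  qed
  moreover have "A \<in> sets borel" unfolding A_def by (rule meas[OF Yb])
  moreover have "B \<in> sets borel" unfolding B_def by (rule meas[OF borel_comp[OF Yb]])
  moreover have "A \<subseteq> X" "B \<subseteq> X" unfolding A_def B_def by blast+
  moreover have "T ` A \<subseteq> A" "T ` B \<subseteq> B" unfolding A_def B_def by (rule inv)+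
  ultimately show False by (intro no[of A B])
qed

end

text \<open>Forward invariant sets of positive measure contain intervals up to null sets, and a mixing map
  moves any interval into any other.\<close>

locale mixing_unimodal = unimodal +
  fixes l :: real
  assumes l: "1 < l" and slope_lower: "\<And>s y. y \<in> branch K s \<Longrightarrow> l \<le> \<bar>slope K T s y\<bar>"
    and mixing: "topologically_mixing_on {T 1..1} T"
    and nonperiodic: "\<And>i. 1 \<le> i \<Longrightarrow> (T ^^ i) 0 \<noteq> 0"
begin

lemma slope_upper: "\<exists>M. \<forall>s. \<forall>y\<in>branch K s. \<bar>slope K T s y\<bar> \<le> M"
proof -
  define M where "M = max \<bar>slope K T True 0\<bar> \<bar>slope K T False 0\<bar> + L * (K + 1)"
  have "\<bar>slope K T s y\<bar> \<le> M" if y: "y \<in> branch K s" for s y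
  proof -
    have "0 \<in> branch K s" using K by (simp add: branch_def)
    then have "\<bar>slope K T s y - slope K T s 0\<bar> \<le> L * \<bar>y - 0\<bar>" by (rule slope_lipschitz[OF y])
    moreover have "L * \<bar>y - 0\<bar> \<le> L * (K + 1)"
      using y K L_nonneg by (intro mult_left_mono) (auto simp: branch_def split: if_splits)
    moreover have "\<bar>slope K T s 0\<bar> \<le> max \<bar>slope K T True 0\<bar> \<bar>slope K T False 0\<bar>" by (cases s) auto
    ultimately show ?thesis unfolding M_def by linarith
  qed
  then show ?thesis by blast
qed

text \<open>A single map as an orbit family: the parameter is the initial point, so
  \<open>S = 0\<close>, \<open>Q = Q' = 1\<close> and \<open>lam = l\<close>. Nonperiodicity of 0
  makes the minimum \<open>\<kappa>\<close> over finitely many times positive, and taking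
  \<open>Suc N0\<close> guarantees \<open>N\<close> at least 1.\<close>

lemma expanding_family_exists:
  "\<exists>M \<kappa> N. expanding_family K L l M 0 1 1 l (T 1) 1 (\<lambda>_. T) (\<lambda>s _. slope K T s) (\<lambda>n a. (T ^^ n) a) \<kappa>
      N"
proof -
  obtain M where M: "\<And>s y. y \<in> branch K s \<Longrightarrow> \<bar>slope K T s y\<bar> \<le> M" using slope_upper by blast
  obtain N0 where N0: "4 < l ^ N0" using real_arch_pow[OF l] by blast
  define N where "N = Suc N0"
  have "l ^ N0 \<le> l ^ N" using l by (intro power_increasing) (auto simp: N_def)
  then have N: "4 \<le> l ^ N" using N0 by linarith
  have N1: "1 \<le> N" by (simp add: N_def)
  define \<kappa> where "\<kappa> = Min ((\<lambda>i. \<bar>(T ^^ i) 0\<bar>) ` {1..N})"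
  have \<kappa>: "0 < \<kappa>" unfolding \<kappa>_def using N1 nonperiodic by (subst Min_gr_iff) auto
  have "expanding_family K L l M 0 1 1 l (T 1) 1 (\<lambda>_. T) (\<lambda>s _. slope K T s) (\<lambda>n a. (T ^^ n) a) \<kappa> N"
  proof
    show "(T ^^ n) a \<in> {-K..1}" if "a \<in> X" for a n using T_iterate_invariant[OF that] X_subset
        by blast
    show "(T ^^ i) 0 \<in> {-K..1}" for i using T_iterate_invariant[OF zero_in_X] X_subset by blast
    show "\<exists>\<xi>\<in>closed_segment p q. T p - T q = slope K T s \<xi> * (p - q)" if "p \<in> branch K s"
        "q \<in> branch K s" for s p q
      by (rule T_mvt[OF that])
    show "l \<le> \<bar>slope K T s y\<bar> \<and> \<bar>slope K T s y\<bar> \<le> M" if "y \<in> branch K s" for s y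
      using slope_lower[OF that] M[OF that] by blast
    show "\<bar>slope K T s y - slope K T s z\<bar> \<le> L * (\<bar>a - b\<bar> + \<bar>y - z\<bar>)" if "y \<in> branch K s"
        "z \<in> branch K s" for a b :: real and s y z
    proof -
      have "L * \<bar>y - z\<bar> \<le> L * (\<bar>a - b\<bar> + \<bar>y - z\<bar>)" using L_nonneg by (intro mult_left_mono) auto
      then show ?thesis using slope_lipschitz[OF that] by linarith
    qed
    show "\<kappa> \<le> \<bar>(T ^^ i) 0\<bar>" if "1 \<le> i" "i \<le> N" for i
      unfolding \<kappa>_def using that by (intro Min_le) auto
  qed (use K L_nonneg l N N1 \<kappa> T_1_neg in auto)
  then show ?thesis by blast
qed

text \<open>Inner regularity yields a compact subset of positive length, and forward invariance
  keeps all its images inside \<open>A\<close>, as \<open>image_contains_interval\<close>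
  requires.\<close>

lemma invariant_contains_interval:
  assumes A: "A \<in> sets borel" "A \<subseteq> X" "T ` A \<subseteq> A" and pos: "0 < emeasure lborel A"
  obtains p q where "p < q" "{p..q} \<subseteq> X" "emeasure lborel ({p..q} - A) = 0"
proof -
  obtain M \<kappa> N where "expanding_family K L l M 0 1 1 l (T 1) 1 (\<lambda>_. T) (\<lambda>s _. slope K T s) (\<lambda>n a. (T
      ^^ n) a) \<kappa> N"
    using expanding_family_exists by blast
  then interpret E: expanding_family K L l M 0 1 1 l "T 1" 1 "\<lambda>_. T" "\<lambda>s _. slope K T s"
      "\<lambda>n a. (T ^^ n) a" \<kappa> N .
  have fin: "emeasure lborel A < \<infinity>"
    using E.measure_finite_subset_I[OF A(1,2)] by (simp add: fmeasurable_def)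
  define e where "e = measure lborel A"
  have e: "emeasure lborel A = ennreal e" unfolding e_def using fin
      by (intro emeasure_eq_ennreal_measure) auto
  have e0: "0 < e" using pos unfolding e by simp
  obtain Kc where Kc: "closed Kc" "Kc \<subseteq> A" "emeasure lebesgue (A - Kc) < ennreal e"
  proof (rule sets_lebesgue_inner_closed[OF _ e0])
    show "A \<in> sets lebesgue" using A(1) by simp
  qed
  have comp: "compact Kc" using Kc A(2) by (meson bounded_closed_interval bounded_subset
      compact_eq_bounded_closed subset_trans)
  have KI: "Kc \<subseteq> X" using Kc(2) A(2) by blast
  have Kb: "Kc \<in> sets borel" using Kc(1) by simp
  have Kf: "emeasure lborel Kc = ennreal (E.len Kc)"
    unfolding E.len_def using E.measure_finite_subset_I[OF Kb KI]
        by (intro emeasure_eq_ennreal_measure) (auto simp: fmeasurable_def)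
  have "0 < E.len Kc"
  proof (rule ccontr)
    assume "\<not> ?thesis"
    then have "emeasure lborel Kc = 0" using Kf by (simp add: ennreal_neg)
    then have "emeasure lborel A = emeasure lborel (A - Kc)"
      using A(1) Kb by (intro emeasure_Diff_null_set[symmetric]) auto
    also have "\<dots> = emeasure lebesgue (A - Kc)" using A(1) Kb by (simp add: emeasure_completion)
    finally show False using Kc(3) e by simp
  qed
  note pos' = this
  have img: "(T ^^ n) ` Kc \<subseteq> A" for n
  proof (induction n)
    case (Suc n)
    have "(T ^^ Suc n) ` Kc = T ` (T ^^ n) ` Kc" by (simp add: image_comp)
    then show ?case using Suc A(3) by blast
  qed (use Kc(2) in auto)
  show thesis
    by (rule E.image_contains_interval[OF comp KI pos' A(1) img T_iterate_invariant that])
qed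

text \<open>Mixing moves some ball from the interval almost inside \<open>A\<close> into the
  interval almost inside \<open>B\<close>. Almost every point of the ball has its image in
  \<open>A\<close> by invariance and in \<open>B\<close> by position, contrary to
  disjointness.\<close>

theorem acip_unique:
  assumes \<mu>: "is_acip T \<mu>" and \<nu>: "is_acip T \<nu>"
  shows "\<mu> = \<nu>"
proof (rule acip_unique_if_no_disjoint_invariant_sets[OF \<mu> \<nu>])
  fix A B assume A: "A \<in> sets borel" "A \<subseteq> X" "T ` A \<subseteq> A" "0 < emeasure lborel A"
    and B: "B \<in> sets borel" "B \<subseteq> X" "T ` B \<subseteq> B" "0 < emeasure lborel B" and AB: "A \<inter> B = {}"
  obtain M \<kappa> N where "expanding_family K L l M 0 1 1 l (T 1) 1 (\<lambda>_. T) (\<lambda>s _. slope K T s) (\<lambda>n a. (T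
      ^^ n) a) \<kappa> N"
    using expanding_family_exists by blast
  then interpret E: expanding_family K L l M 0 1 1 l "T 1" 1 "\<lambda>_. T" "\<lambda>s _. slope K T s"
      "\<lambda>n a. (T ^^ n) a" \<kappa> N .
  obtain p q where pq: "p < q" "{p..q} \<subseteq> X" "emeasure lborel ({p..q} - A) = 0"
    by (rule invariant_contains_interval[OF A])
  obtain u v where uv: "u < v" "{u..v} \<subseteq> X" "emeasure lborel ({u..v} - B) = 0"
    by (rule invariant_contains_interval[OF B])
  have op: "openin (top_of_set X) {c<..<d} \<and> {c<..<d} \<noteq> {}" if "c < d" "{c..d} \<subseteq> X" for c d
  proof
    have "{c<..<d} \<subseteq> {c..d}" by auto
    then have "{c<..<d} = X \<inter> {c<..<d}" using that(2) by blast
    then show "openin (top_of_set X) {c<..<d}" unfolding openin_open using open_greaterThanLessThan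
        by blast
    show "{c<..<d} \<noteq> {}" using that(1) by simp
  qed
  obtain n where "(T ^^ n) ` {p<..<q} \<inter> {u<..<v} \<noteq> {}"
  proof -
    have "\<exists>N. \<forall>n\<ge>N. (T ^^ n) ` {p<..<q} \<inter> {u<..<v} \<noteq> {}"
      using mixing op[OF pq(1,2)] op[OF uv(1,2)] unfolding topologically_mixing_on_def by simp
    then show ?thesis using that by blast
  qed
  then obtain y where y: "y \<in> {p<..<q}" "(T ^^ n) y \<in> {u<..<v}" by blast
  have cont: "continuous_on {p<..<q} (T ^^ n)"
    by (rule continuous_on_subset[OF iterate_cont_X]) (use pq(2) in auto)
  have "open ({p<..<q} \<inter> (T ^^ n) -` {u<..<v})"
    by (rule continuous_open_preimage[OF cont]) auto
  moreover have "y \<in> {p<..<q} \<inter> (T ^^ n) -` {u<..<v}" using y by blast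
  ultimately obtain r where r: "0 < r" "ball y r \<subseteq> {p<..<q} \<inter> (T ^^ n) -` {u<..<v}"
    unfolding open_contains_ball by blast
  define W where "W = ball y r"
  have Wpos: "emeasure lborel W \<noteq> 0"
    using r(1) by (simp add: W_def ball_eq_greaterThanLessThan)
  have Wsub: "W \<subseteq> {p..q}" "\<And>w. w \<in> W \<Longrightarrow> (T ^^ n) w \<in> {u..v}" using r(2) by (auto simp: W_def)
  have WX: "W \<subseteq> X" using Wsub(1) pq(2) by blast
  define N1 where "N1 = {u..v} - B"
  have N1: "N1 \<in> sets borel" "emeasure lborel N1 = 0" using B(1) uv(3) by (auto simp: N1_def)
  \<comment> \<open>Preimages of null sets are null: on each of the finitely many cells,
    \<open>T ^^ n\<close> sends Lebesgue measure to a measure of bounded density.\<close>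
  define N2 where "N2 = {w\<in>X. (T ^^ n) w \<in> N1}"
  have N2b: "N2 \<in> sets borel" unfolding N2_def by (rule iterate_preimage_borel[OF N1(1)])
  have N2: "emeasure lborel N2 = 0"
  proof -
    have N2_eq: "N2 = (\<Union>C\<in>E.cell n ` X. {b\<in>C. (T ^^ n) b \<in> N1})"
    proof (intro equalityI subsetI)
      fix w assume "w \<in> N2"
      then have "w \<in> X" "(T ^^ n) w \<in> N1" by (simp_all add: N2_def)
      then show "w \<in> (\<Union>C\<in>E.cell n ` X. {b\<in>C. (T ^^ n) b \<in> N1})" using E.cell_self[of w n] by blast
    next
      fix w assume "w \<in> (\<Union>C\<in>E.cell n ` X. {b\<in>C. (T ^^ n) b \<in> N1})"
      then obtain a where "w \<in> E.cell n a" "(T ^^ n) w \<in> N1" by blast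
      then show "w \<in> N2" unfolding N2_def using E.cell_I[of w n a] by blast
    qed
    have "emeasure lborel {b\<in>E.cell n a. (T ^^ n) b \<in> N1} = 0" for a
    proof -
      have "emeasure lborel {b\<in>E.cell n a. (T ^^ n) b \<in> N1}
          = emeasure (E.image_measure n (E.cell n a)) N1"
        by (rule E.emeasure_image_measure[OF E.cell_subset_I E.cell_borel N1(1), symmetric])
      also have "\<dots> \<le> ennreal (E.ratio n (E.cell n a)) * emeasure lborel N1"
          by (rule E.image_measure_le[OF N1(1)])
      finally show ?thesis using N1(2) by simp
    qed
    then have "{b\<in>E.cell n a. (T ^^ n) b \<in> N1} \<in> null_sets lborel" for a
      using E.preimage_borel[OF E.cell_subset_I E.cell_borel N1(1), of n a n]
          by (simp add: null_sets_def)
    then have "N2 \<in> null_sets lborel" unfolding N2_eq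
      using E.finite_cells by (intro null_sets.finite_UN) auto
    then show ?thesis by auto
  qed
  have "W \<subseteq> ({p..q} - A) \<union> N2"
  proof
    fix w assume w: "w \<in> W"
    show "w \<in> ({p..q} - A) \<union> N2"
    proof (cases "w \<in> A")
      case True
      have "(T ^^ n) w \<in> A"
      proof (induction n)
        case (Suc n) then show ?case using A(3) by auto
      qed (use True in simp)
      then have "(T ^^ n) w \<in> N1" using AB Wsub(2)[OF w] by (auto simp: N1_def)
      then show ?thesis using w WX by (auto simp: N2_def)
    qed (use w Wsub in auto)
  qed
  then have "emeasure lborel W \<le> emeasure lborel (({p..q} - A) \<union> N2)"
    using A(1) N2b by (intro emeasure_mono) auto
  also have "\<dots> \<le> emeasure lborel ({p..q} - A) + emeasure lborel N2"
    using A(1) N2b by (intro emeasure_subadditive) auto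
  finally show False using pq(3) N2 Wpos by simp
qed

end

section \<open>Weak limits of empirical measures\<close>

text \<open>A function supported in \<open>{p..q}\<close> with slopes m and -m, capped at 1: steep
  tents dominate the indicator of any compact part of the open interval. Rational ends leave
  countably many.\<close>

definition tent :: "real \<Rightarrow> real \<Rightarrow> nat \<Rightarrow> real \<Rightarrow> real" where
  "tent p q m y = min 1 (real m * max 0 (min (y - p) (q - y)))"

lemma tent_nonneg: "0 \<le> tent p q m y" and tent_le_1: "tent p q m y \<le> 1"
  by (auto simp: tent_def)

lemma tent_lipschitz: "\<bar>tent p q m y - tent p q m z\<bar> \<le> real m * \<bar>y - z\<bar>"
proof -
  have min1: "\<bar>min 1 u - min 1 v\<bar> \<le> \<bar>u - v\<bar>" for u v :: real by linarith
  have "\<bar>tent p q m y - tent p q m z\<bar> \<le> \<bar>real m * max 0 (min (y - p) (q - y)) - real m * max 0 (min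
      (z - p) (q - z))\<bar>"
    unfolding tent_def by (rule min1)
  also have "\<dots> = real m * \<bar>max 0 (min (y - p) (q - y)) - max 0 (min (z - p) (q - z))\<bar>"
    by (simp add: abs_mult right_diff_distrib[symmetric])
  also have "\<dots> \<le> real m * \<bar>y - z\<bar>"
    by (intro mult_left_mono) linarith+
  finally show ?thesis .
qed

lemma tent_continuous: "continuous_on A (tent p q m)"
  unfolding tent_def by (intro continuous_intros)

lemma tent_measurable: "tent p q m \<in> borel_measurable borel"
  by (rule borel_measurable_continuous_onI[OF tent_continuous])

lemma nn_integral_tent_le:
  assumes "p \<le> q"
  shows "(\<integral>\<^sup>+y. ennreal (tent p q m y) \<partial>lborel) \<le> ennreal (q - p)"
proof -
  have "(\<integral>\<^sup>+y. ennreal (tent p q m y) \<partial>lborel) \<le> (\<integral>\<^sup>+y. indicator {p..q} y \<partial>lborel)"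
  proof (rule nn_integral_mono)
    fix y
    show "ennreal (tent p q m y) \<le> indicator {p..q} y"
    proof (cases "y \<in> {p..q}")
      case True then show ?thesis using tent_le_1[of p q m y] by (simp add: ennreal_le_1)
    next
      case False
      then have "tent p q m y = 0" by (auto simp: tent_def)
      then show ?thesis by simp
    qed
  qed
  then show ?thesis using assms by simp
qed

lemma tent_eq_1: "1 \<le> real m * (y - p) \<Longrightarrow> 1 \<le> real m * (q - y) \<Longrightarrow> tent p q m y = 1"
proof -
  assume y: "1 \<le> real m * (y - p)" "1 \<le> real m * (q - y)"
  have pos: "0 < u" if "1 \<le> real m * u" for u
    using that mult_nonneg_nonpos[of "real m" u] by (cases "u \<le> 0") auto
  show ?thesis using y pos[OF y(1)] pos[OF y(2)] by (auto simp: tent_def min_def max_def)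
qed

text \<open>Continuous steps from 1 to 0 between x and y > x separate the distribution function at x
  from the one at y; right continuity then lets y decrease to x.\<close>

lemma real_distribution_eqI:
  assumes M: "real_distribution M" and N: "real_distribution N"
    and eq: "\<And>f. (\<And>x. isCont f x) \<Longrightarrow> (\<And>x. \<bar>f x\<bar> \<le> 1) \<Longrightarrow> (\<integral>x. f x \<partial>M) = (\<integral>x. f x \<partial>N :: real)"
  shows "M = N"
proof (rule cdf_unique[OF M N], rule ext)
  fix x
  have step: "(\<integral>x. cts_step a b x \<partial>M) = (\<integral>x. cts_step a b x \<partial>N)" if "a < b" for a b
  proof (rule eq)
    have "continuous_on UNIV (cts_step a b)"
      by (rule uniformly_continuous_imp_continuous[OF cts_step_uniformly_continuous[OF that]])
    then show "isCont (cts_step a b) x" for x by (simp add: continuous_on_eq_continuous_at)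
    show "\<bar>cts_step a b x\<bar> \<le> 1" for x using that by (auto simp: cts_step_def)
  qed
  have le: "cdf M' x \<le> cdf N' x"
    if M': "real_distribution M'" and N': "real_distribution N'"
      and st: "\<And>a b. a < b \<Longrightarrow> (\<integral>x. cts_step a b x \<partial>M') = (\<integral>x. cts_step a b x \<partial>N')" for M' N'
  proof -
    interpret M': real_distribution M' by (rule M')
    interpret N': real_distribution N' by (rule N')
    have "cdf M' x \<le> cdf N' y" if "x < y" for y
      using M'.cdf_cts_step(1)[OF that] N'.cdf_cts_step(2)[OF that] st[OF that] by linarith
    then have "eventually (\<lambda>y. cdf M' x \<le> cdf N' y) (at_right x)"
      by (auto simp: eventually_at_filter)
    moreover have "(cdf N' \<longlongrightarrow> cdf N' x) (at_right x)"
      using N'.cdf_is_right_cont by (simp add: continuous_within)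
    ultimately show ?thesis by (intro tendsto_lowerbound[of "cdf N'" _ "at_right x"]) auto
  qed
  show "cdf M x = cdf N x"
    using le[OF M N step] le[OF N M step[symmetric]] by (rule antisym)
qed

lemma real_distribution_empirical_measure: "real_distribution (empirical_measure T x (Suc n))"
proof -
  interpret prob_space "uniform_count_measure {..<Suc n}"
    by (rule prob_space_uniform_count_measure) auto
  have "prob_space (empirical_measure T x (Suc n))"
    unfolding empirical_measure_def
    by (rule prob_space_distr) (simp add: measurable_def space_uniform_count_measure
      sets_uniform_count_measure)
  then show ?thesis
    by (simp add: real_distribution_def real_distribution_axioms_def empirical_measure_def)
qed

section \<open>Empirical measures along the turning orbit\<close>

context unimodal
begin

text \<open>Retracting onto \<open>X\<close> before applying \<open>T\<close> gives a map continuous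
  on the whole line that agrees with \<open>T\<close> on the orbit, so that composing with it
  preserves bounded continuous test functions.\<close>

definition clamped :: "real \<Rightarrow> real" where
  "clamped y = T (max (T 1) (min 1 y))"

lemma clamp_in_X: "max (T 1) (min 1 y) \<in> X"
  using T_1_neg by (auto simp: min_def max_def)

lemma clamped_eq: "y \<in> X \<Longrightarrow> clamped y = T y"
  by (simp add: clamped_def min_absorb2 max_absorb2)

lemma clamped_continuous: "continuous_on UNIV clamped"
  unfolding clamped_def
  by (rule continuous_on_compose2[OF T_cont_X]) (auto intro!: continuous_intros simp: clamp_in_X
    simp del: atLeastAtMost_iff)

definition orbit_average :: "(real \<Rightarrow> real) \<Rightarrow> nat \<Rightarrow> real" where
  "orbit_average f n = (\<Sum>i<n. f ((T ^^ i) 0)) / real n"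

text \<open>The difference of the two sums telescopes to a boundary term bounded by
  \<open>2 * B\<close>, which the division by n removes.\<close>

lemma orbit_average_shift:
  assumes B: "\<And>y. \<bar>f y\<bar> \<le> B"
  shows "(\<lambda>n. orbit_average (\<lambda>y. f (clamped y)) (Suc n) - orbit_average f (Suc n)) \<longlonglongrightarrow> 0"
proof (rule Lim_null_comparison)
  have eq: "orbit_average (\<lambda>y. f (clamped y)) n - orbit_average f n
      = (f ((T ^^ n) 0) - f 0) / real n" for n
  proof -
    have "clamped ((T ^^ i) 0) = (T ^^ Suc i) 0" for i
      using clamped_eq[OF T_iterate_invariant[OF zero_in_X]] by simp
    then have "(\<Sum>i<n. f (clamped ((T ^^ i) 0))) - (\<Sum>i<n. f ((T ^^ i) 0))
        = (\<Sum>i<n. f ((T ^^ Suc i) 0) - f ((T ^^ i) 0))"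
      by (simp add: sum_subtractf)
    also have "\<dots> = f ((T ^^ n) 0) - f ((T ^^ 0) 0)" by (rule sum_lessThan_telescope)
    finally show ?thesis by (simp add: orbit_average_def diff_divide_distrib[symmetric])
  qed
  show "\<forall>\<^sub>F n in sequentially. norm (orbit_average (\<lambda>y. f (clamped y)) (Suc n) - orbit_average f
      (Suc n)) \<le> 2 * B / real (Suc n)"
  proof (rule always_eventually, rule allI)
    fix n
    have "\<bar>f ((T ^^ Suc n) 0) - f 0\<bar> \<le> 2 * B" using B[of "(T ^^ Suc n) 0"] B[of 0] by linarith
    then show "norm (orbit_average (\<lambda>y. f (clamped y)) (Suc n) - orbit_average f (Suc n))
        \<le> 2 * B / real (Suc n)"
      unfolding eq by (simp add: abs_divide divide_right_mono)
  qed
  show "(\<lambda>n. 2 * B / real (Suc n)) \<longlonglongrightarrow> 0" by real_asymp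
qed

text \<open>Weak limits of the empirical measures are absolutely continuous by the hypothesis on tent
  functions, hence all equal to the unique such invariant measure.\<close>

theorem typical_criterion:
  assumes uniq: "\<And>\<mu> \<nu>. is_acip T \<mu> \<Longrightarrow> is_acip T \<nu> \<Longrightarrow> \<mu> = \<nu>" and C: "0 \<le> C"
    and avg: "\<And>(p::rat) (q::rat) m \<eta>. p < q \<Longrightarrow> 0 < \<eta> \<Longrightarrow>
      \<forall>\<^sub>F n in sequentially. orbit_average (tent (of_rat p) (of_rat q) m) n
          \<le> C * (of_rat q - of_rat p) + \<eta>"
  shows "typical T (acip T) 0"
proof -
  \<comment> \<open>The index is shifted because the empirical measure for n = 0 is not a
    probability measure.\<close>
  define e where "e n = empirical_measure T 0 (Suc n)" for n
  have e: "real_distribution (e n)" for n unfolding e_def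
      by (rule real_distribution_empirical_measure)
  have int: "(\<integral>y. f y \<partial>e n) = orbit_average f (Suc n)" if "continuous_on UNIV f" for f ::
      "real \<Rightarrow> real" and n
    unfolding e_def orbit_average_def by (rule integral_empirical_measure[OF that]) simp
  have meas_e: "emeasure (e n) A = 1" if A: "A \<in> sets borel" "X \<subseteq> A" for n A
  proof -
    interpret real_distribution "e n" by (rule e)
    have "emeasure (e n) A = emeasure (uniform_count_measure {..<Suc n}) ((\<lambda>i. (T ^^ i) 0) -` A \<inter>
        {..<Suc n})"
      unfolding e_def empirical_measure_def using A(1)
      by (subst emeasure_distr) (auto simp: measurable_def space_uniform_count_measure
        sets_uniform_count_measure)
    also have "(\<lambda>i. (T ^^ i) 0) -` A \<inter> {..<Suc n} = {..<Suc n}"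
      using T_iterate_invariant[OF zero_in_X] A(2) by blast
    also have "emeasure (uniform_count_measure {..<Suc n}) {..<Suc n} = 1"
      by (subst emeasure_uniform_count_measure) auto
    finally show ?thesis .
  qed
  have tight: "tight e"
    unfolding tight_def
  proof (intro conjI allI impI)
    fix \<epsilon> :: real assume "0 < \<epsilon>"
    have "X \<subseteq> {T 1 - 1<..1}" by auto
    then have "measure (e n) {T 1 - 1<..1} = 1" for n using meas_e[of "{T 1 - 1<..1}" n]
        by (simp add: measure_def)
    then show "\<exists>a b. a < b \<and> (\<forall>n. 1 - \<epsilon> < measure (e n) {a<..b})"
      using \<open>0 < \<epsilon>\<close> T_1_neg by (intro exI[of _ "T 1 - 1"] exI[of _ 1]) auto
  qed (rule e)
  have limit: "is_acip T \<nu>" if s: "strict_mono s" and \<nu>: "real_distribution \<nu>" and conv: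
      "weak_conv_m (e \<circ> s) \<nu>" for s \<nu>
  proof -
    interpret \<nu>: real_distribution \<nu> by (rule \<nu>)
    have es: "real_distribution ((e \<circ> s) n)" for n using e by simp
    have lim: "(\<lambda>k. orbit_average f (Suc (s k))) \<longlonglongrightarrow> (\<integral>y. f y \<partial>\<nu>)"
      if f: "continuous_on UNIV f" "\<And>y. \<bar>f y\<bar> \<le> B" for f :: "real \<Rightarrow> real" and B
    proof -
      have "(\<lambda>k. \<integral>y. f y \<partial>(e \<circ> s) k) \<longlonglongrightarrow> (\<integral>y. f y \<partial>\<nu>)"
      proof (rule weak_conv_imp_integral_bdd_continuous_conv[OF es \<nu> conv])
        show "isCont f y" for y using f(1) by (simp add: continuous_on_eq_continuous_at)
        show "norm (f y) \<le> B" for y using f(2) by simp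
      qed
      then show ?thesis using int[OF f(1)] by simp
    qed
    have sub: "filterlim (\<lambda>k. Suc (s k)) at_top sequentially"
      using filterlim_compose[OF filterlim_Suc filterlim_subseq[OF s]] .
    have tent_le: "(\<integral>y. tent (of_rat p) (of_rat q) m y \<partial>\<nu>) \<le> C * (of_rat q - of_rat p)" if pq: "p
        < q" for p q :: rat and m
    proof (rule field_le_epsilon)
      fix \<eta> :: real assume "0 < \<eta>"
      from avg[OF pq this, of m] have "\<forall>\<^sub>F k in sequentially. orbit_average (tent (of_rat p) (of_rat
          q) m) (Suc (s k)) \<le> C * (of_rat q - of_rat p) + \<eta>"
        by (rule eventually_compose_filterlim[OF _ sub])
      moreover have "(\<lambda>k. orbit_average (tent (of_rat p) (of_rat q) m) (Suc (s k))) \<longlonglongrightarrow> (\<integral>y. tent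
          (of_rat p) (of_rat q) m y \<partial>\<nu>)"
      proof (rule lim[OF tent_continuous])
        show "\<bar>tent (of_rat p) (of_rat q) m y\<bar> \<le> 1" for y by (simp add: tent_nonneg tent_le_1)
      qed
      ultimately show "(\<integral>y. tent (of_rat p) (of_rat q) m y \<partial>\<nu>) \<le> C * (of_rat q - of_rat p) + \<eta>"
        by (intro tendsto_upperbound[of _ _ sequentially]) auto
    qed
    \<comment> \<open>The indicator of \<open>{a<..b}\<close> lies below a steep tent with rational
      ends within \<open>h\<close> of \<open>a\<close> and \<open>b\<close>. The choice of
      \<open>h\<close> keeps \<open>C * (2 * h)\<close> below \<open>\<eta>\<close>, also when
      \<open>C = 0\<close>.\<close>
    have half_open: "emeasure \<nu> {a<..b} \<le> ennreal (C * (b - a))" if ab: "a < b" for a b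
    proof -
      have "measure \<nu> {a<..b} \<le> C * (b - a)"
      proof (rule field_le_epsilon)
        fix \<eta> :: real assume \<eta>: "0 < \<eta>"
        define h where "h = \<eta> / (2 * (C + 1))"
        have h: "0 < h" using \<eta> C by (simp add: h_def)
        obtain p :: rat where p: "a - h < of_rat p" "of_rat p < a" using of_rat_dense[of
            "a - h" a] h by auto
        obtain q :: rat where q: "b < of_rat q" "of_rat q < b + h" using of_rat_dense[of b
            "b + h"] h by auto
        obtain m :: nat where m: "1 / (a - of_rat p) \<le> real m" "1 / (of_rat q - b) \<le> real m"
          using real_arch_simple[of "max (1 / (a - of_rat p)) (1 / (of_rat q - b))"] by auto
        have m': "1 \<le> real m * (a - of_rat p)" "1 \<le> real m * (of_rat q - b)"
          using m p q by (simp_all add: pos_divide_le_eq)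
        have one: "tent (of_rat p) (of_rat q) m y = 1" if y: "y \<in> {a<..b}" for y
        proof (rule tent_eq_1)
          have "real m * (a - of_rat p) \<le> real m * (y - of_rat p)" using y
              by (intro mult_left_mono) auto
          then show "1 \<le> real m * (y - of_rat p)" using m' by linarith
          have "real m * (of_rat q - b) \<le> real m * (of_rat q - y)" using y
              by (intro mult_left_mono) auto
          then show "1 \<le> real m * (of_rat q - y)" using m' by linarith
        qed
        have "measure \<nu> {a<..b} = (\<integral>y. indicator {a<..b} y \<partial>\<nu>)" by simp
        also have "\<dots> \<le> (\<integral>y. tent (of_rat p) (of_rat q) m y \<partial>\<nu>)"
        proof (rule integral_mono)
          show "integrable \<nu> (indicator {a<..b} :: real \<Rightarrow> real)"
            by (rule \<nu>.integrable_const_bound[where B=1]) (auto simp: indicator_def)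
          show "integrable \<nu> (tent (of_rat p) (of_rat q) m)"
            by (rule \<nu>.integrable_const_bound[where B=1]) (auto simp: tent_nonneg tent_le_1
              tent_measurable)
          show "indicator {a<..b} y \<le> tent (of_rat p) (of_rat q) m y" for y
            using one[of y] tent_nonneg[of "of_rat p" "of_rat q" m y] by (cases "y \<in> {a<..b}") auto
        qed
        also have "\<dots> \<le> C * (of_rat q - of_rat p)"
        proof (rule tent_le)
          have "(of_rat p :: real) < of_rat q" using p q ab by linarith
          then show "p < q" by (simp only: of_rat_less)
        qed
        also have "\<dots> \<le> C * (b - a + 2 * h)" using p q C by (intro mult_left_mono) auto
        also have "\<dots> = C * (b - a) + C * (2 * h)" by (rule distrib_left)
        also have "C * (2 * h) \<le> \<eta>"
        proof -
          have "D * (2 * (\<eta> / (2 * D))) = \<eta>" if "D \<noteq> 0" for D using that by simp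
          then have "(C + 1) * (2 * h) = \<eta>" unfolding h_def using C
              by (metis add_nonneg_eq_0_iff zero_le_one zero_neq_one)
          moreover have "C * (2 * h) \<le> (C + 1) * (2 * h)" using h by (intro mult_right_mono) auto
          ultimately show ?thesis by simp
        qed
        finally show "measure \<nu> {a<..b} \<le> C * (b - a) + \<eta>" by simp
      qed
      then show ?thesis by (simp add: \<nu>.emeasure_eq_measure ennreal_leI)
    qed
    have ac: "absolutely_continuous lborel \<nu>"
      unfolding absolutely_continuous_def
    proof
      fix A assume "A \<in> null_sets (lborel :: real measure)"
      then have A: "A \<in> sets borel" "emeasure lborel A = 0" by auto
      have "emeasure \<nu> A \<le> ennreal C * emeasure lborel A"
        by (rule emeasure_borel_le_lborel[OF _ C half_open A(1)]) simp
      then show "A \<in> null_sets \<nu>" using A by (auto simp: null_sets_def)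
    qed
    have X1: "emeasure \<nu> X = 1"
    proof -
      \<comment> \<open>The capped distance to \<open>X\<close> is a bounded continuous function
        vanishing on the orbit. Its limit integral is 0, so the limit measure is carried by the
        closed set \<open>X\<close>.\<close>
      define g where "g y = min 1 (infdist y X)" for y
      have gc: "continuous_on UNIV g" unfolding g_def by (intro continuous_intros)
      have g0: "0 \<le> g y" "\<bar>g y\<bar> \<le> 1" for y by (auto simp: g_def infdist_nonneg)
      have "orbit_average g n = 0" for n
        using T_iterate_invariant[OF zero_in_X]
            by (simp add: orbit_average_def g_def del: atLeastAtMost_iff)
      then have "(\<integral>y. g y \<partial>\<nu>) = 0" using lim[OF gc g0(2)] by (simp add: LIMSEQ_const_iff)
      moreover have "integrable \<nu> g"
        by (rule \<nu>.integrable_const_bound[where B=1]) (use g0 borel_measurable_continuous_onI[OF gc]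
          in auto)
      ultimately have "AE y in \<nu>. g y = 0" using g0
          by (subst (asm) integral_nonneg_eq_0_iff_AE) auto
      then have "AE y in \<nu>. y \<in> X"
      proof eventually_elim
        case (elim y)
        then have "infdist y X = 0" by (auto simp: g_def min_def split: if_splits)
        then show ?case using in_closed_iff_infdist_zero[of X y] zero_in_X
            by (metis closed_atLeastAtMost empty_iff)
      qed
      then show ?thesis
        using \<nu>.emeasure_eq_1_AE[of X] by simp
    qed
    have clm: "clamped \<in> borel_measurable borel"
        by (rule borel_measurable_continuous_onI[OF clamped_continuous])
    then have clm': "clamped \<in> measurable \<nu> borel" by simp
    \<comment> \<open>Averages of f and of f after \<open>clamped\<close> differ by a quantity
      tending to 0, so the limit measure and its push-forward integrate all test functions
      alike.\<close>
    have "distr \<nu> borel clamped = \<nu>"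
    proof (rule real_distribution_eqI[OF _ \<nu>])
      show "real_distribution (distr \<nu> borel clamped)"
        by (rule \<nu>.real_distribution_distr[OF clm'])
      fix f :: "real \<Rightarrow> real" assume f: "\<And>x. isCont f x" "\<And>x. \<bar>f x\<bar> \<le> 1"
      have fc: "continuous_on UNIV f" using f(1) by (simp add: continuous_on_eq_continuous_at)
      have fcc: "continuous_on UNIV (\<lambda>y. f (clamped y))"
        by (rule continuous_on_compose2[OF fc clamped_continuous]) auto
      have "(\<lambda>k. orbit_average (\<lambda>y. f (clamped y)) (Suc (s k)) - orbit_average f (Suc (s k))) \<longlonglongrightarrow> (\<integral>y.
          f (clamped y) \<partial>\<nu>) - (\<integral>y. f y \<partial>\<nu>)"
        by (intro tendsto_diff lim[OF fc f(2)] lim[OF fcc f(2)])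
      moreover have "(\<lambda>k. orbit_average (\<lambda>y. f (clamped y)) (Suc (s k)) - orbit_average f (Suc (s
          k))) \<longlonglongrightarrow> 0"
        by (rule filterlim_compose[OF orbit_average_shift[OF f(2)] filterlim_subseq[OF s]])
      ultimately have "(\<integral>y. f (clamped y) \<partial>\<nu>) = (\<integral>y. f y \<partial>\<nu>)"
        using LIMSEQ_unique by fastforce
      moreover have "(\<integral>x. f x \<partial>distr \<nu> borel clamped) = (\<integral>y. f (clamped y) \<partial>\<nu>)"
        by (rule integral_distr[OF clm' borel_measurable_continuous_onI[OF fc]])
      ultimately show "(\<integral>x. f x \<partial>distr \<nu> borel clamped) = (\<integral>x. f x \<partial>\<nu>)" by simp
    qed
    then have inv: "emeasure \<nu> (T -` A \<inter> X) = emeasure \<nu> A" if A: "A \<in> sets borel" for A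
    proof -
      have X: "AE y in \<nu>. y \<in> X" using X1 \<nu>.emeasure_eq_1_AE
          by (intro \<nu>.AE_prob_1) (simp add: measure_def)
      have "emeasure \<nu> A = emeasure (distr \<nu> borel clamped) A" using \<open>distr \<nu> borel clamped = \<nu>\<close>
          by simp
      also have "\<dots> = emeasure \<nu> (clamped -` A)" using A by (subst emeasure_distr[OF clm']) auto
      also have "\<dots> = emeasure \<nu> (T -` A \<inter> X)"
      proof (rule emeasure_eq_AE)
        show "AE y in \<nu>. (y \<in> clamped -` A) = (y \<in> T -` A \<inter> X)"
          using X by eventually_elim (simp add: clamped_eq del: atLeastAtMost_iff)
        show "clamped -` A \<in> sets \<nu>" using measurable_sets[OF clm A] by simp
        have "T -` A \<inter> X = {y\<in>X. T y \<in> A}" by auto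
        then show "T -` A \<inter> X \<in> sets \<nu>" using preimage_borel_X[OF T_cont_X A] by simp
      qed
      finally show ?thesis ..
    qed
    show ?thesis
      unfolding is_acip_def using \<nu>.prob_space_axioms X1 ac inv by simp
  qed
  obtain r \<nu> where r: "strict_mono (r :: nat \<Rightarrow> nat)" "real_distribution \<nu>"
      "weak_conv_m (e \<circ> id \<circ> r) \<nu>"
    using tight_imp_convergent_subsubsequence[OF tight strict_mono_id] by blast
  have \<nu>: "is_acip T \<nu>" using limit[OF r(1,2)] r(3) by simp
  have acip: "acip T = \<nu>" unfolding acip_def by (rule the_equality, rule \<nu>, rule uniq[OF _ \<nu>])
  have "weak_conv_m e \<nu>"
  proof (rule tight_subseq_weak_converge[OF e r(2) tight])
    fix s \<nu>' assume s: "strict_mono s" "real_distribution \<nu>'" "weak_conv_m (e \<circ> s) \<nu>'"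
    have "\<nu>' = \<nu>" by (rule uniq[OF limit[OF s] \<nu>])
    then show "weak_conv_m (e \<circ> s) \<nu>" using s(3) by simp
  qed
  show ?thesis
    unfolding typical_def weak_star_conv_def acip
  proof (intro allI impI)
    fix f :: "real \<Rightarrow> real" assume f: "continuous_on UNIV f \<and> bounded (range f)"
    then obtain B where B: "\<And>y. \<bar>f y\<bar> \<le> B" by (auto simp: bounded_iff)
    have "(\<lambda>n. \<integral>y. f y \<partial>e n) \<longlonglongrightarrow> (\<integral>y. f y \<partial>\<nu>)"
    proof (rule weak_conv_imp_integral_bdd_continuous_conv[OF e r(2) \<open>weak_conv_m e \<nu>\<close>])
      show "isCont f y" for y using f by (simp add: continuous_on_eq_continuous_at)
      show "norm (f y) \<le> B" for y using B by simp
    qed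
    then show "(\<lambda>n. \<integral>y. f y \<partial>empirical_measure T 0 n) \<longlonglongrightarrow> (\<integral>y. f y \<partial>\<nu>)"
      unfolding e_def by (rule LIMSEQ_imp_Suc)
  qed
qed

end

section \<open>Dependence on the parameter\<close>

text \<open>Difference quotients near 0 converge uniformly, from the right. Unlike differentiability this
  passes through the kink of \<open>T\<^sub>a\<close> when the orbit of 0 returns to 0 at \<open>a = 0\<close>.\<close>

definition strict_deriv0 :: "(real \<Rightarrow> real) \<Rightarrow> real \<Rightarrow> bool" where
  "strict_deriv0 u D \<longleftrightarrow>
    (\<forall>\<eta>>0. \<exists>r>0. \<forall>a\<in>{0..r}. \<forall>b\<in>{0..r}. \<bar>u a - u b - D * (a - b)\<bar> \<le> \<eta> * \<bar>a - b\<bar>)"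

lemma strict_deriv0D:
  assumes "strict_deriv0 u D" "0 < \<eta>"
  obtains r where "0 < r" "\<And>a b. a \<in> {0..r} \<Longrightarrow> b \<in> {0..r} \<Longrightarrow> \<bar>u a - u b - D * (a - b)\<bar> \<le> \<eta> * \<bar>a - b\<bar>"
  using assms unfolding strict_deriv0_def by blast

lemma strict_deriv0_imp_has_derivative:
  assumes "strict_deriv0 u D" "0 < \<delta>"
  shows "(u has_real_derivative D) (at 0 within {0..\<delta>})"
  unfolding has_field_derivative_def has_derivative_within_alt
proof (intro conjI allI impI)
  show "bounded_linear ((*) D)" by (rule bounded_linear_mult_right)
  fix e :: real assume "0 < e"
  then obtain r where r: "0 < r" "\<And>a b. a \<in> {0..r} \<Longrightarrow> b \<in> {0..r} \<Longrightarrow> \<bar>u a - u b - D * (a - b)\<bar>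
      \<le> e * \<bar>a - b\<bar>"
    using strict_deriv0D[OF assms(1)] by metis
  show "\<exists>d>0. \<forall>y\<in>{0..\<delta>}. norm (y - 0) < d \<longrightarrow> norm (u y - u 0 - D * (y - 0)) \<le> e * norm (y - 0)"
    using r(1) by (intro exI[of _ r] conjI ballI impI) (use r(2)[of _ 0] in auto)
qed

lemma has_derivative_unique_right:
  assumes "(u has_real_derivative D) (at 0 within {0..\<delta>})"
      "(u has_real_derivative D') (at 0 within {0..\<delta>})" "0 < \<delta>"
  shows "D = D'"
proof (rule vector_derivative_unique_within)
  show "at 0 within {0..\<delta>} \<noteq> bot" using assms(3)
      by (simp add: at_within_Icc_at_right trivial_limit_at_right_real)
  show "(u has_vector_derivative D) (at 0 within {0..\<delta>})"
      "(u has_vector_derivative D') (at 0 within {0..\<delta>})"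
    using assms(1,2) by (simp_all add: has_real_derivative_iff_has_vector_derivative)
qed

section \<open>Regularity of the family and of the turning orbit at a = 0\<close>

locale unimodal_family =
  fixes K L \<delta> l :: real and T :: "real \<Rightarrow> real" and Ta :: "real \<Rightarrow> real \<Rightarrow> real"
  assumes K: "0 < K" and L: "0 < L" and family: "one_parameter_family K L \<delta> T Ta"
    and mixing: "mixing_family \<delta> Ta" and l: "1 < l" and expansion: "expansion_bound K \<delta> Ta l"
begin

lemma \<delta>: "0 < \<delta>"
  using family by (simp add: one_parameter_family_def)

lemma unimodal_Ta: "a \<in> {0..\<delta>} \<Longrightarrow> unimodal K L (Ta a)"
  using family K by (simp add: one_parameter_family_def unimodal_def)

definition sl :: "bool \<Rightarrow> real \<Rightarrow> real \<Rightarrow> real" where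
  "sl s a = slope K (Ta a) s"

lemma sl_lower: "a \<in> {0..\<delta>} \<Longrightarrow> y \<in> branch K s \<Longrightarrow> l \<le> \<bar>sl s a y\<bar>"
  using expansion by (cases s) (auto simp: expansion_bound_def sl_def slope_def branch_def)

lemma sl_derivative: "a \<in> {0..\<delta>} \<Longrightarrow> y \<in> branch K s
    \<Longrightarrow> (Ta a has_real_derivative sl s a y) (at y within branch K s)"
  unfolding sl_def by (rule unimodal.slope_derivative[OF unimodal_Ta])

lemma Ta_mvt: "a \<in> {0..\<delta>} \<Longrightarrow> p \<in> branch K s \<Longrightarrow> q \<in> branch K s \<Longrightarrow> \<exists>\<xi>\<in>closed_segment p q. Ta a p - Ta a q
    = sl s a \<xi> * (p - q)"
  unfolding sl_def by (rule unimodal.T_mvt[OF unimodal_Ta])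

lemma sl_param_lipschitz:
  assumes "a \<in> {0..\<delta>}" "b \<in> {0..\<delta>}" "y \<in> branch K s"
  shows "\<bar>sl s a y - sl s b y\<bar> \<le> L * \<bar>a - b\<bar>"
proof (cases s)
  case True
  then have "L-lipschitz_on {0..\<delta>} (\<lambda>a. deriv_within {0..1} (Ta a) y)"
    using family assms(3) by (simp add: one_parameter_family_def branch_def)
  from lipschitz_onD[OF this assms(1,2)] show ?thesis
    using True by (simp add: sl_def slope_def branch_def dist_real_def)
next
  case False
  then have "L-lipschitz_on {0..\<delta>} (\<lambda>a. deriv_within {-K..0} (Ta a) y)"
    using family assms(3) by (simp add: one_parameter_family_def branch_def)
  from lipschitz_onD[OF this assms(1,2)] show ?thesis
    using False by (simp add: sl_def slope_def branch_def dist_real_def)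
qed

lemma sl_lipschitz:
  assumes "a \<in> {0..\<delta>}" "b \<in> {0..\<delta>}" "y \<in> branch K s" "z \<in> branch K s"
  shows "\<bar>sl s a y - sl s b z\<bar> \<le> L * (\<bar>a - b\<bar> + \<bar>y - z\<bar>)"
proof -
  have "\<bar>sl s a y - sl s b y\<bar> \<le> L * \<bar>a - b\<bar>" by (rule sl_param_lipschitz[OF assms(1-3)])
  moreover have "\<bar>sl s b y - sl s b z\<bar> \<le> L * \<bar>y - z\<bar>"
    unfolding sl_def by (rule unimodal.slope_lipschitz[OF unimodal_Ta[OF assms(2)] assms(3,4)])
  ultimately show ?thesis unfolding distrib_left by linarith
qed

lemma Ta_param_lipschitz:
  assumes "a \<in> {0..\<delta>}" "b \<in> {0..\<delta>}" "y \<in> {-K..1}"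
  shows "\<bar>Ta a y - Ta b y\<bar> \<le> L * \<bar>a - b\<bar>"
proof -
  have "L-lipschitz_on {0..\<delta>} (\<lambda>a. Ta a y)"
    using family assms(3) by (simp add: one_parameter_family_def)
  from lipschitz_onD[OF this assms(1,2)] show ?thesis by (simp add: dist_real_def)
qed

text \<open>On one branch, the mean value theorem is applied to the difference of the two maps,
  whose slope is at most \<open>L * |a - b|\<close>; the branches are then joined at 0.\<close>

lemma second_difference:
  assumes a: "a \<in> {0..\<delta>}" and b: "b \<in> {0..\<delta>}" and y: "y \<in> {-K..1}" and z: "z \<in> {-K..1}"
  shows "\<bar>(Ta a y - Ta b y) - (Ta a z - Ta b z)\<bar> \<le> L * \<bar>a - b\<bar> * \<bar>y - z\<bar>"
proof (rule branch_lipschitz_imp_lipschitz[OF less_imp_le[OF K] y z])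
  fix s y z assume yz: "y \<in> branch K s" "z \<in> branch K s"
  have "\<exists>\<xi>\<in>closed_segment y z. (Ta a y - Ta b y) - (Ta a z - Ta b z)
      = (sl s a \<xi> - sl s b \<xi>) * (y - z)"
    by (rule mvt_within_segment[OF convex_branch yz]) (intro DERIV_diff sl_derivative a b)
  then obtain \<xi> where \<xi>: "\<xi> \<in> closed_segment y z"
      "(Ta a y - Ta b y) - (Ta a z - Ta b z) = (sl s a \<xi> - sl s b \<xi>) * (y - z)"
    by blast
  have "\<xi> \<in> branch K s" using closed_segment_subset[OF yz convex_branch] \<xi>(1) by blast
  then show "\<bar>(Ta a y - Ta b y) - (Ta a z - Ta b z)\<bar> \<le> L * \<bar>a - b\<bar> * \<bar>y - z\<bar>"
    unfolding \<xi>(2) abs_mult by (intro mult_right_mono sl_param_lipschitz a b) auto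
qed

definition M :: real where
  "M = max \<bar>sl True 0 0\<bar> \<bar>sl False 0 0\<bar> + L * (\<delta> + (K + 1))"

lemma sl_upper:
  assumes a: "a \<in> {0..\<delta>}" and y: "y \<in> branch K s"
  shows "\<bar>sl s a y\<bar> \<le> M"
proof -
  have "0 \<in> branch K s" "0 \<in> {0..\<delta>}" using K \<delta> by (auto simp: branch_def)
  then have "\<bar>sl s a y - sl s 0 0\<bar> \<le> L * (\<bar>a - 0\<bar> + \<bar>y - 0\<bar>)" by (intro sl_lipschitz a y)
  also have "\<dots> \<le> L * (\<delta> + (K + 1))"
    using a y L K by (intro mult_left_mono) (auto simp: branch_def split: if_splits)
  finally have "\<bar>sl s a y - sl s 0 0\<bar> \<le> L * (\<delta> + (K + 1))" .
  moreover have "\<bar>sl s 0 0\<bar> \<le> max \<bar>sl True 0 0\<bar> \<bar>sl False 0 0\<bar>" by (cases s) auto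
  ultimately show ?thesis unfolding M_def by linarith
qed

lemma M_pos: "0 < M"
proof -
  have "0 \<in> branch K True" "0 \<in> {0..\<delta>}" using \<delta> by (auto simp: branch_def)
  then have "l \<le> \<bar>sl True 0 0\<bar>" "\<bar>sl True 0 0\<bar> \<le> M" by (auto intro: sl_lower sl_upper)
  then show ?thesis using l by linarith
qed

lemma Ta_lipschitz:
  assumes a: "a \<in> {0..\<delta>}" and y: "y \<in> {-K..1}" and z: "z \<in> {-K..1}"
  shows "\<bar>Ta a y - Ta a z\<bar> \<le> M * \<bar>y - z\<bar>"
proof (rule branch_lipschitz_imp_lipschitz[OF less_imp_le[OF K] y z])
  fix s y z assume yz: "y \<in> branch K s" "z \<in> branch K s"
  obtain \<xi> where \<xi>: "\<xi> \<in> closed_segment y z" "Ta a y - Ta a z = sl s a \<xi> * (y - z)"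
    using Ta_mvt[OF a yz] by blast
  have "\<xi> \<in> branch K s" using closed_segment_subset[OF yz convex_branch] \<xi>(1) by blast
  then show "\<bar>Ta a y - Ta a z\<bar> \<le> M * \<bar>y - z\<bar>"
    unfolding \<xi>(2) abs_mult by (intro mult_right_mono sl_upper a) auto
qed

definition orb :: "nat \<Rightarrow> real \<Rightarrow> real" where
  "orb n a = (Ta a ^^ n) 0"

lemma orb_Suc: "orb (Suc n) a = Ta a (orb n a)"
  by (simp add: orb_def)

lemma orb_in_X: "a \<in> {0..\<delta>} \<Longrightarrow> orb n a \<in> {Ta a 1..1}"
  unfolding orb_def by (rule unimodal.T_iterate_invariant[OF unimodal_Ta unimodal.zero_in_X[OF
      unimodal_Ta]])

lemma orb_range: "a \<in> {0..\<delta>} \<Longrightarrow> orb n a \<in> {-K..1}"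
  using orb_in_X unimodal.X_subset[OF unimodal_Ta] by blast

lemma orb_lipschitz: "\<exists>C\<ge>0. \<forall>a\<in>{0..\<delta>}. \<forall>b\<in>{0..\<delta>}. \<bar>orb n a - orb n b\<bar> \<le> C * \<bar>a - b\<bar>"
proof (induction n)
  case 0
  then show ?case by (intro exI[of _ 0]) (simp add: orb_def)
next
  case (Suc n)
  then obtain C where C: "0 \<le> C" "\<And>a b. a \<in> {0..\<delta>} \<Longrightarrow> b \<in> {0..\<delta>} \<Longrightarrow> \<bar>orb n a - orb n b\<bar> \<le> C * \<bar>a - b\<bar>"
    by blast
  have "\<bar>orb (Suc n) a - orb (Suc n) b\<bar> \<le> (M * C + L) * \<bar>a - b\<bar>" if ab: "a \<in> {0..\<delta>}" "b \<in> {0..\<delta>}"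
      for a b
  proof -
    have "\<bar>Ta a (orb n a) - Ta a (orb n b)\<bar> \<le> M * \<bar>orb n a - orb n b\<bar>"
      by (intro Ta_lipschitz orb_range ab)
    also have "\<dots> \<le> M * (C * \<bar>a - b\<bar>)" using C(2)[OF ab] M_pos by (intro mult_left_mono) auto
    finally have "\<bar>Ta a (orb n a) - Ta a (orb n b)\<bar> \<le> M * C * \<bar>a - b\<bar>" by (simp only: mult.assoc)
    moreover have "\<bar>Ta a (orb n b) - Ta b (orb n b)\<bar> \<le> L * \<bar>a - b\<bar>"
      by (intro Ta_param_lipschitz orb_range ab)
    ultimately show ?thesis unfolding orb_Suc distrib_right by linarith
  qed
  moreover have "0 \<le> M * C + L" using M_pos C(1) L by simp
  ultimately show ?case by blast
qed

definition g :: "real \<Rightarrow> real" where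
  "g y = deriv_within {0..\<delta>} (\<lambda>a. Ta a y) 0"

text \<open>By the mean value theorem a quotient near 0 equals the derivative at an intermediate
  parameter, and that derivative is continuous at 0.\<close>

lemma param_strict_deriv:
  assumes y: "y \<in> {-K..1}"
  shows "strict_deriv0 (\<lambda>a. Ta a y) (g y)"
  unfolding strict_deriv0_def
proof (intro allI impI)
  fix \<eta> :: real assume \<eta>: "0 < \<eta>"
  have C1: "C1_on {0..\<delta>} (\<lambda>a. Ta a y)" using family y by (simp add: one_parameter_family_def)
  define h where "h = deriv_within {0..\<delta>} (\<lambda>a. Ta a y)"
  have "continuous_on {0..\<delta>} h" using C1 by (simp add: C1_on_def h_def)
  then obtain d where d: "0 < d" "\<And>c. c \<in> {0..\<delta>} \<Longrightarrow> dist c 0 < d \<Longrightarrow> dist (h c) (h 0) < \<eta>"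
    unfolding continuous_on_iff using \<eta> \<delta> by (metis atLeastAtMost_iff less_imp_le order_refl)
  define r where "r = min (d / 2) \<delta>"
  have r: "0 < r" using d(1) \<delta> by (simp add: r_def)
  show "\<exists>r>0. \<forall>a\<in>{0..r}. \<forall>b\<in>{0..r}. \<bar>Ta a y - Ta b y - g y * (a - b)\<bar> \<le> \<eta> * \<bar>a - b\<bar>"
  proof (intro exI[of _ r] conjI ballI r)
    fix a b assume ab: "a \<in> {0..r}" "b \<in> {0..r}"
    have ab': "a \<in> {0..\<delta>}" "b \<in> {0..\<delta>}" using ab by (auto simp: r_def)
    obtain \<xi> where \<xi>: "\<xi> \<in> closed_segment a b" "Ta a y - Ta b y = h \<xi> * (a - b)"
      using mvt_within_segment[of "{0..\<delta>}" a b "\<lambda>a. Ta a y" h] C1_on_has_derivative[OF C1] ab'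
      unfolding h_def by auto
    have "\<xi> \<in> {0..r}" using closed_segment_subset[OF ab] \<xi>(1) by auto
    then have "\<xi> \<in> {0..\<delta>}" "dist \<xi> 0 < d" using d(1) by (auto simp: r_def dist_real_def)
    then have "\<bar>h \<xi> - g y\<bar> \<le> \<eta>" using d(2)[of \<xi>] by (simp add: g_def h_def dist_real_def)
    then have "\<bar>h \<xi> - g y\<bar> * \<bar>a - b\<bar> \<le> \<eta> * \<bar>a - b\<bar>" by (rule mult_right_mono) simp
    then show "\<bar>Ta a y - Ta b y - g y * (a - b)\<bar> \<le> \<eta> * \<bar>a - b\<bar>"
      unfolding \<xi>(2) by (simp add: abs_mult[symmetric] left_diff_distrib)
  qed
qed

lemma g_bound: "y \<in> {-K..1} \<Longrightarrow> \<bar>g y\<bar> \<le> L"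
proof (rule field_le_epsilon)
  fix \<eta> :: real assume y: "y \<in> {-K..1}" and \<eta>: "0 < \<eta>"
  obtain r where r: "0 < r" "\<And>a b. a \<in> {0..r} \<Longrightarrow> b \<in> {0..r} \<Longrightarrow> \<bar>Ta a y - Ta b y - g y * (a - b)\<bar>
      \<le> \<eta> * \<bar>a - b\<bar>"
    using strict_deriv0D[OF param_strict_deriv[OF y] \<eta>] by metis
  define c where "c = min r \<delta>"
  have c: "0 < c" "c \<in> {0..r}" "c \<in> {0..\<delta>}" "0 \<in> {0..r}" "0 \<in> {0..\<delta>}" using r(1) \<delta>
      by (auto simp: c_def)
  have "\<bar>Ta c y - Ta 0 y - g y * (c - 0)\<bar> \<le> \<eta> * \<bar>c - 0\<bar>" by (rule r(2)[OF c(2,4)])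
  moreover have "\<bar>Ta c y - Ta 0 y\<bar> \<le> L * \<bar>c - 0\<bar>" by (rule Ta_param_lipschitz[OF c(3,5) y])
  ultimately have "\<bar>g y * c\<bar> \<le> L * c + \<eta> * c" using c(1) by auto
  then have "\<bar>g y\<bar> * c \<le> (L + \<eta>) * c" using c(1) by (simp add: abs_mult distrib_right)
  then show "\<bar>g y\<bar> \<le> L + \<eta>" using c(1) by simp
qed

text \<open>The increment splits into three parts: the point moves under a fixed map, the parameter
  moves at the fixed point \<open>u0\<close>, and a mixed second difference, which is of smaller
  order because \<open>u a\<close> tends to \<open>u0\<close>.\<close>

lemma orb_strict_deriv_step:
  assumes D: "strict_deriv0 (orb n) D"
  shows "\<exists>D'. strict_deriv0 (orb (Suc n)) D'"
proof -
  define u where "u = orb n"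
  define u0 where "u0 = u 0"
  have I0: "0 \<in> {0..\<delta>}" using \<delta> by simp
  have u0: "u0 \<in> {-K..1}" unfolding u0_def u_def by (rule orb_range[OF I0])
  have D: "strict_deriv0 u D" using D by (simp add: u_def)
  have ur: "u a \<in> {-K..1}" if "a \<in> {0..\<delta>}" for a unfolding u_def by (rule orb_range[OF that])
  obtain C where C: "0 \<le> C" "\<And>a b. a \<in> {0..\<delta>} \<Longrightarrow> b \<in> {0..\<delta>} \<Longrightarrow> \<bar>u a - u b\<bar> \<le> C * \<bar>a - b\<bar>"
    using orb_lipschitz[of n] unfolding u_def by blast
  text \<open>If \<open>u\<close> vanishes at 0 with nonzero slope, then it stays on one branch; if its slope
    vanishes too, the contribution of \<open>u\<close> is of smaller order on either branch.\<close>
  have second: "\<exists>E. \<forall>\<eta>>0. \<exists>r>0. r \<le> \<delta> \<and> (\<forall>a\<in>{0..r}. \<forall>b\<in>{0..r}. \<bar>Ta b (u a) - Ta b (u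
      b) - E * (a - b)\<bar> \<le> \<eta> * \<bar>a - b\<bar>)"
  proof (cases "u0 = 0 \<and> D = 0")
    case True
    have "\<exists>r>0. r \<le> \<delta> \<and> (\<forall>a\<in>{0..r}. \<forall>b\<in>{0..r}. \<bar>Ta b (u a) - Ta b (u b) - 0 * (a - b)\<bar>
        \<le> \<eta> * \<bar>a - b\<bar>)" if \<eta>: "0 < \<eta>" for \<eta>
    proof -
      have "0 < \<eta> / M" using \<eta> M_pos by simp
      then obtain r where r: "0 < r" "\<And>a b. a \<in> {0..r} \<Longrightarrow> b \<in> {0..r} \<Longrightarrow> \<bar>u a - u b - D * (a - b)\<bar>
          \<le> \<eta> / M * \<bar>a - b\<bar>"
        using strict_deriv0D[OF D] by metis
      show ?thesis
      proof (intro exI[of _ "min r \<delta>"] conjI ballI)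
        fix a b assume ab: "a \<in> {0..min r \<delta>}" "b \<in> {0..min r \<delta>}"
        have "\<bar>Ta b (u a) - Ta b (u b)\<bar> \<le> M * \<bar>u a - u b\<bar>"
          using ab by (intro Ta_lipschitz ur) auto
        also have "\<dots> \<le> M * (\<eta> / M * \<bar>a - b\<bar>)"
          using r(2)[of a b] ab True M_pos by (intro mult_left_mono) auto
        also have "\<dots> = \<eta> * \<bar>a - b\<bar>" using M_pos by simp
        finally show "\<bar>Ta b (u a) - Ta b (u b) - 0 * (a - b)\<bar> \<le> \<eta> * \<bar>a - b\<bar>" by simp
      qed (use r(1) \<delta> in auto)
    qed
    then show ?thesis by blast
  next
    case False
    have "\<exists>s r1. 0 < r1 \<and> r1 \<le> \<delta> \<and> (\<forall>a\<in>{0..r1}. u a \<in> branch K s)"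
    proof (cases "u0 = 0")
      case False
      \<comment> \<open>Within this radius \<open>u a\<close> moves by at most the distance of
        \<open>u0\<close> from the turning point and stays on the branch of
        \<open>u0\<close>.\<close>
      define r1 where "r1 = min \<delta> (\<bar>u0\<bar> / (C + 1))"
      have r1: "0 < r1" using \<delta> C(1) False by (simp add: r1_def)
      have "u a \<in> branch K (0 \<le> u0)" if a: "a \<in> {0..r1}" for a
      proof -
        have ad: "a \<in> {0..\<delta>}" using a by (auto simp: r1_def)
        have "\<bar>u a - u 0\<bar> \<le> C * \<bar>a - 0\<bar>" by (rule C(2)[OF ad I0])
        also have "\<dots> \<le> (C + 1) * r1" using a C(1) by (intro mult_mono) auto
        also have "\<dots> \<le> (C + 1) * (\<bar>u0\<bar> / (C + 1))" using C(1)
            by (intro mult_left_mono) (auto simp: r1_def)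
        also have "\<dots> = \<bar>u0\<bar>" using C(1) by simp
        finally have "\<bar>u a - u0\<bar> \<le> \<bar>u0\<bar>" by (simp add: u0_def)
        then show ?thesis using ur[OF ad] False by (auto simp: branch_def split: if_splits)
      qed
      then show ?thesis using r1 by (intro exI[of _ "0 \<le> u0"] exI[of _ r1]) (auto simp: r1_def)
    next
      case True
      then have D0: "D \<noteq> 0" using False by simp
      \<comment> \<open>The tolerance \<open>|D|\<close> already places \<open>u a\<close> between 0
        and 2 D a, hence on the side given by the sign of \<open>D\<close>.\<close>
      obtain r where r: "0 < r" "\<And>a b. a \<in> {0..r} \<Longrightarrow> b \<in> {0..r} \<Longrightarrow> \<bar>u a - u b - D * (a - b)\<bar>
          \<le> \<bar>D\<bar> * \<bar>a - b\<bar>"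
        using strict_deriv0D[OF D, of "\<bar>D\<bar>"] D0 by auto
      have "u a \<in> branch K (0 \<le> D)" if a: "a \<in> {0..min r \<delta>}" for a
      proof -
        have "\<bar>u a - D * a\<bar> \<le> \<bar>D\<bar> * a" using r(2)[of a 0] a True r(1) by (simp add: u0_def)
        moreover have "D * a = \<bar>D\<bar> * a \<or> D * a = - (\<bar>D\<bar> * a)" by (simp add: abs_if)
        moreover have "0 \<le> D \<Longrightarrow> D * a = \<bar>D\<bar> * a" "\<not> 0 \<le> D \<Longrightarrow> D * a = - (\<bar>D\<bar> * a)" by auto
        ultimately have "0 \<le> D \<Longrightarrow> 0 \<le> u a" "\<not> 0 \<le> D \<Longrightarrow> u a \<le> 0" by linarith+
        then show ?thesis using ur[of a] a by (auto simp: branch_def)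
      qed
      then show ?thesis using r(1) \<delta> by (intro exI[of _ "0 \<le> D"] exI[of _ "min r \<delta>"]) auto
    qed
    then obtain s r1 where r1: "0 < r1" "r1 \<le> \<delta>" "\<And>a. a \<in> {0..r1} \<Longrightarrow> u a \<in> branch K s" by blast
    define s0 where "s0 = sl s 0 u0"
    have u0b: "u0 \<in> branch K s" using r1(3)[of 0] r1(1) by (simp add: u0_def)
    show ?thesis
    proof (rule exI[of _ "s0 * D"], intro allI impI)
      fix \<eta> :: real assume \<eta>: "0 < \<eta>"
      define \<eta>1 where "\<eta>1 = \<eta> / (2 * (\<bar>s0\<bar> + 1))"
      have \<eta>1: "0 < \<eta>1" using \<eta> by (simp add: \<eta>1_def)
      obtain r2 where r2: "0 < r2" "\<And>a b. a \<in> {0..r2} \<Longrightarrow> b \<in> {0..r2} \<Longrightarrow> \<bar>u a - u b - D * (a - b)\<bar>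
          \<le> \<eta>1 * \<bar>a - b\<bar>"
        using strict_deriv0D[OF D \<eta>1] by metis
      \<comment> \<open>The slope error \<open>L * (1 + C) * r\<close> times the Lipschitz bound
        \<open>C + 1\<close> of the orbit point; the radius \<open>r\<close> below makes the product
        at most \<open>\<eta> / 2\<close>.\<close>
      define W where "W = L * (1 + C) * (C + 1)"
      have W: "0 < W" using L C(1) by (simp add: W_def)
      define r where "r = min (min r1 r2) (\<eta> / (2 * W))"
      have r: "0 < r" using r1(1) r2(1) \<eta> W by (simp add: r_def)
      show "\<exists>r>0. r \<le> \<delta> \<and> (\<forall>a\<in>{0..r}. \<forall>b\<in>{0..r}. \<bar>Ta b (u a) - Ta b (u b) - s0 * D * (a - b)\<bar>
          \<le> \<eta> * \<bar>a - b\<bar>)"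
      proof (intro exI[of _ r] conjI ballI r)
        show "r \<le> \<delta>" using r1(2) by (simp add: r_def)
        fix a b assume ab: "a \<in> {0..r}" "b \<in> {0..r}"
        have ab1: "a \<in> {0..r1}" "b \<in> {0..r1}" and ab2: "a \<in> {0..r2}" "b \<in> {0..r2}" using ab
            by (auto simp: r_def)
        have abd: "a \<in> {0..\<delta>}" "b \<in> {0..\<delta>}" using ab1 r1(2) by auto
        have ub: "u a \<in> branch K s" "u b \<in> branch K s"
            by (rule r1(3)[OF ab1(1)], rule r1(3)[OF ab1(2)])
        obtain \<xi> where \<xi>: "\<xi> \<in> closed_segment (u a) (u b)" "Ta b (u a) - Ta b (u b)
            = sl s b \<xi> * (u a - u b)"
          using Ta_mvt[OF abd(2) ub] by blast
        have \<xi>b: "\<xi> \<in> branch K s" using closed_segment_subset[OF ub convex_branch] \<xi>(1) by blast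
        have near: "\<bar>u c - u0\<bar> \<le> C * r" if "c \<in> {0..r}" "c \<in> {0..\<delta>}" for c
        proof -
          have "\<bar>u c - u 0\<bar> \<le> C * \<bar>c - 0\<bar>" by (rule C(2)[OF that(2) I0])
          also have "\<dots> \<le> C * r" using that(1) C(1) by (intro mult_left_mono) auto
          finally show ?thesis by (simp add: u0_def)
        qed
        have "\<bar>\<xi> - u0\<bar> \<le> C * r"
          using near[OF ab(1) abd(1)] near[OF ab(2) abd(2)] \<xi>(1)
              by (auto simp: closed_segment_eq_real_ivl split: if_splits)
        then have "\<bar>sl s b \<xi> - s0\<bar> \<le> L * (r + C * r)"
          using sl_lipschitz[OF abd(2) I0 \<xi>b u0b] ab(2) L unfolding s0_def
          by (intro order_trans[OF _ mult_left_mono[of "\<bar>b - 0\<bar> + \<bar>\<xi> - u0\<bar>" "r + C * r" L]]) auto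
        then have "\<bar>sl s b \<xi> - s0\<bar> * \<bar>u a - u b\<bar> \<le> (L * (r + C * r)) * ((C + 1) * \<bar>a - b\<bar>)"
          using C(2)[OF abd] C(1) L r
          by (intro mult_mono order_trans[OF C(2)[OF abd]] mult_right_mono) auto
        also have "\<dots> = W * r * \<bar>a - b\<bar>" by (simp add: W_def algebra_simps)
        also have "\<dots> \<le> \<eta> / 2 * \<bar>a - b\<bar>"
        proof (rule mult_right_mono)
          have "W * r \<le> W * (\<eta> / (2 * W))" using W by (intro mult_left_mono) (auto simp: r_def)
          then show "W * r \<le> \<eta> / 2" using W by simp
        qed simp
        finally have t1: "\<bar>(sl s b \<xi> - s0) * (u a - u b)\<bar> \<le> \<eta> / 2 * \<bar>a - b\<bar>"
            by (simp only: abs_mult)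
        have "\<bar>s0\<bar> * \<bar>u a - u b - D * (a - b)\<bar> \<le> (\<bar>s0\<bar> + 1) * (\<eta>1 * \<bar>a - b\<bar>)"
          using r2(2)[OF ab2] \<eta>1 by (intro mult_mono) auto
        also have "\<dots> = \<eta> / 2 * \<bar>a - b\<bar>"
        proof -
          have "d * (\<eta> / (2 * d) * y) = \<eta> / 2 * y" if "0 < d" for d y :: real using that by simp
          from this[of "\<bar>s0\<bar> + 1" "\<bar>a - b\<bar>"] show ?thesis unfolding \<eta>1_def by linarith
        qed
        finally have t2: "\<bar>s0 * (u a - u b - D * (a - b))\<bar> \<le> \<eta> / 2 * \<bar>a - b\<bar>"
            by (simp only: abs_mult)
        have "Ta b (u a) - Ta b (u b) - s0 * D * (a - b)
            = (sl s b \<xi> - s0) * (u a - u b) + s0 * (u a - u b - D * (a - b))"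
          unfolding \<xi>(2) by (simp add: algebra_simps)
        then show "\<bar>Ta b (u a) - Ta b (u b) - s0 * D * (a - b)\<bar> \<le> \<eta> * \<bar>a - b\<bar>"
          using t1 t2 by linarith
      qed
    qed
  qed
  then obtain E where E: "\<And>\<eta>. 0 < \<eta> \<Longrightarrow> \<exists>r>0. r \<le> \<delta>
      \<and> (\<forall>a\<in>{0..r}. \<forall>b\<in>{0..r}. \<bar>Ta b (u a) - Ta b (u b) - E * (a - b)\<bar> \<le> \<eta> * \<bar>a - b\<bar>)"
    by blast
  have "strict_deriv0 (orb (Suc n)) (g u0 + E)"
    unfolding strict_deriv0_def
  proof (intro allI impI)
    fix \<eta> :: real assume \<eta>: "0 < \<eta>"
    then have \<eta>3: "0 < \<eta> / 3" by simp
    obtain r1 where r1: "0 < r1" "r1 \<le> \<delta>" "\<And>a b. a \<in> {0..r1} \<Longrightarrow> b \<in> {0..r1}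
        \<Longrightarrow> \<bar>Ta b (u a) - Ta b (u b) - E * (a - b)\<bar> \<le> \<eta> / 3 * \<bar>a - b\<bar>"
      using E[OF \<eta>3] by blast
    obtain r2 where r2: "0 < r2" "\<And>a b. a \<in> {0..r2} \<Longrightarrow> b \<in> {0..r2}
        \<Longrightarrow> \<bar>Ta a u0 - Ta b u0 - g u0 * (a - b)\<bar> \<le> \<eta> / 3 * \<bar>a - b\<bar>"
      using strict_deriv0D[OF param_strict_deriv[OF u0] \<eta>3] by metis
    define W where "W = L * (C + 1)"
    have W: "0 < W" using L C(1) by (simp add: W_def)
    define r where "r = min (min r1 r2) (\<eta> / (3 * W))"
    have r: "0 < r" using r1(1) r2(1) \<eta> W by (simp add: r_def)
    show "\<exists>r>0. \<forall>a\<in>{0..r}. \<forall>b\<in>{0..r}. \<bar>orb (Suc n) a - orb (Suc n) b - (g u0 + E) * (a - b)\<bar>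
        \<le> \<eta> * \<bar>a - b\<bar>"
    proof (intro exI[of _ r] conjI ballI r)
      fix a b assume ab: "a \<in> {0..r}" "b \<in> {0..r}"
      have ab1: "a \<in> {0..r1}" "b \<in> {0..r1}" and ab2: "a \<in> {0..r2}" "b \<in> {0..r2}" using ab
          by (auto simp: r_def)
      have abd: "a \<in> {0..\<delta>}" "b \<in> {0..\<delta>}" using ab1 r1(2) by auto
      have t1: "\<bar>Ta b (u a) - Ta b (u b) - E * (a - b)\<bar> \<le> \<eta> / 3 * \<bar>a - b\<bar>" by (rule r1(3)[OF ab1])
      have t2: "\<bar>Ta a u0 - Ta b u0 - g u0 * (a - b)\<bar> \<le> \<eta> / 3 * \<bar>a - b\<bar>" by (rule r2(2)[OF ab2])
      have "\<bar>(Ta a (u a) - Ta b (u a)) - (Ta a u0 - Ta b u0)\<bar> \<le> L * \<bar>a - b\<bar> * \<bar>u a - u0\<bar>"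
        by (rule second_difference[OF abd ur[OF abd(1)] u0])
      also have "\<dots> \<le> L * \<bar>a - b\<bar> * ((C + 1) * r)"
      proof (rule mult_left_mono)
        have "\<bar>u a - u 0\<bar> \<le> C * \<bar>a - 0\<bar>" by (rule C(2)[OF abd(1) I0])
        also have "\<dots> \<le> (C + 1) * r" using ab(1) C(1) by (intro mult_mono) auto
        finally show "\<bar>u a - u0\<bar> \<le> (C + 1) * r" by (simp add: u0_def)
      qed (use L in simp)
      also have "\<dots> = W * r * \<bar>a - b\<bar>" by (simp add: W_def)
      also have "\<dots> \<le> \<eta> / 3 * \<bar>a - b\<bar>"
      proof (rule mult_right_mono)
        have "W * r \<le> W * (\<eta> / (3 * W))" using W by (intro mult_left_mono) (auto simp: r_def)
        then show "W * r \<le> \<eta> / 3" using W by simp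
      qed simp
      finally have t3: "\<bar>(Ta a (u a) - Ta b (u a)) - (Ta a u0 - Ta b u0)\<bar> \<le> \<eta> / 3 * \<bar>a - b\<bar>" .
      have "orb (Suc n) a - orb (Suc n) b - (g u0 + E) * (a - b)
          = (Ta b (u a) - Ta b (u b) - E * (a - b)) + (Ta a u0 - Ta b u0 - g u0 * (a - b))
            + ((Ta a (u a) - Ta b (u a)) - (Ta a u0 - Ta b u0))"
        unfolding orb_Suc u_def by (simp add: algebra_simps)
      then show "\<bar>orb (Suc n) a - orb (Suc n) b - (g u0 + E) * (a - b)\<bar> \<le> \<eta> * \<bar>a - b\<bar>"
        using t1 t2 t3 by linarith
    qed
  qed
  then show ?thesis by blast
qed

lemma orb_strict_deriv: "\<exists>D. strict_deriv0 (orb n) D"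
proof (induction n)
  case 0
  have "strict_deriv0 (orb 0) 0" unfolding strict_deriv0_def
      by (auto simp: orb_def intro: exI[of _ 1])
  then show ?case by blast
next
  case (Suc n) then show ?case using orb_strict_deriv_step by blast
qed

end

section \<open>Transversal families\<close>

text \<open>The parameter bound has a third parameter \<open>c\<close> because it is used along the
  orbit of \<open>Ta c\<close>, which lives in \<open>{Ta c 1..1}\<close> and may leave the interval
  belonging to a = 0.\<close>

locale transversal_family = unimodal_family +
  fixes j0 :: nat and \<epsilon> S Q Q' :: real
  assumes j0: "1 \<le> j0" and \<epsilon>: "0 < \<epsilon>" "\<epsilon> \<le> \<delta>" and S: "0 \<le> S" and Q: "0 < Q" and Q': "0 < Q'"
    and SQ: "S / Q < l - 1"
    and param_le: "\<And>a b c y. a \<in> {0..\<epsilon>} \<Longrightarrow> b \<in> {0..\<epsilon>} \<Longrightarrow> c \<in> {0..\<epsilon>} \<Longrightarrow> y \<in> {Ta c 1..1}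
        \<Longrightarrow> \<bar>Ta a y - Ta b y\<bar> \<le> S * \<bar>a - b\<bar>"
    and orb_lower: "\<And>a b. a \<in> {0..\<epsilon>} \<Longrightarrow> b \<in> {0..\<epsilon>} \<Longrightarrow> Q * \<bar>a - b\<bar> \<le> \<bar>orb j0 a - orb j0 b\<bar>"
    and orb_upper: "\<And>a b. a \<in> {0..\<epsilon>} \<Longrightarrow> b \<in> {0..\<epsilon>} \<Longrightarrow> \<bar>orb j0 a - orb j0 b\<bar> \<le> Q' * \<bar>a - b\<bar>"
begin

lemma \<epsilon>_sub: "a \<in> {0..\<epsilon>} \<Longrightarrow> a \<in> {0..\<delta>}"
  using \<epsilon> by auto

lemma orbits:
  assumes "0 \<le> lo" "lo \<le> hi" "hi \<le> \<epsilon>"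
  shows "expanding_orbits K L l M S Q Q' (l - S / Q) lo hi Ta sl (\<lambda>n. orb (j0 + n))"
proof
  have sub: "a \<in> {0..\<epsilon>}" if "a \<in> {lo..hi}" for a using that assms by auto
  have sub': "a \<in> {0..\<delta>}" if "a \<in> {lo..hi}" for a using \<epsilon>_sub[OF sub[OF that]] .
  show "orb (j0 + Suc n) a = Ta a (orb (j0 + n) a)" for n a by (simp add: orb_Suc)
  show "orb (j0 + n) a \<in> {- K..1}" if "a \<in> {lo..hi}" for n a by (rule orb_range[OF sub'[OF that]])
  show "\<exists>\<xi>\<in>closed_segment p q. Ta a p - Ta a q = sl s a \<xi> * (p - q)"
    if "a \<in> {lo..hi}" "p \<in> branch K s" "q \<in> branch K s" for a s p q
    by (rule Ta_mvt[OF sub'[OF that(1)] that(2,3)])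
  show "l \<le> \<bar>sl s a y\<bar> \<and> \<bar>sl s a y\<bar> \<le> M" if "a \<in> {lo..hi}" "y \<in> branch K s" for a s y
    using sl_lower[OF sub'[OF that(1)] that(2)] sl_upper[OF sub'[OF that(1)] that(2)] by blast
  show "\<bar>sl s a y - sl s b z\<bar> \<le> L * (\<bar>a - b\<bar> + \<bar>y - z\<bar>)"
    if "a \<in> {lo..hi}" "b \<in> {lo..hi}" "y \<in> branch K s" "z \<in> branch K s" for a b s y z
    by (rule sl_lipschitz[OF sub'[OF that(1)] sub'[OF that(2)] that(3,4)])
  show "\<bar>Ta a (orb (j0 + n) b) - Ta b (orb (j0 + n) b)\<bar> \<le> S * \<bar>a - b\<bar>" if "a \<in> {lo..hi}"
      "b \<in> {lo..hi}" for a b n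
    by (rule param_le[OF sub[OF that(1)] sub[OF that(2)] sub[OF that(2)] orb_in_X[OF sub'[OF
      that(2)]]])
  show "Q * \<bar>a - b\<bar> \<le> \<bar>orb (j0 + 0) a - orb (j0 + 0) b\<bar>" if "a \<in> {lo..hi}" "b \<in> {lo..hi}" for a b
    using orb_lower[OF sub[OF that(1)] sub[OF that(2)]] by simp
  show "\<bar>orb (j0 + 0) a - orb (j0 + 0) b\<bar> \<le> Q' * \<bar>a - b\<bar>" if "a \<in> {lo..hi}" "b \<in> {lo..hi}" for a b
    using orb_upper[OF sub[OF that(1)] sub[OF that(2)]] by simp
qed (use K L S Q Q' SQ assms in auto)

definition periodic :: "real set" where
  "periodic = {a \<in> {0..\<epsilon>}. \<exists>i\<ge>1. orb i a = 0}"

text \<open>If 0 returns at time \<open>i\<close>, it also returns at \<open>i * j0\<close>, which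
  is at least \<open>j0\<close>; from time \<open>j0\<close> on the orbit expands in the parameter
  and its level sets are finite.\<close>

lemma countable_periodic: "countable periodic"
proof -
  interpret E: expanding_orbits K L l M S Q Q' "l - S / Q" 0 \<epsilon> Ta sl "\<lambda>n. orb (j0 + n)"
    by (rule orbits) (use \<epsilon> in auto)
  have "periodic \<subseteq> (\<Union>n. {a\<in>{0..\<epsilon>}. orb (j0 + n) a = 0})"
  proof
    fix a assume "a \<in> periodic"
    then obtain i where i: "a \<in> {0..\<epsilon>}" "1 \<le> i" "orb i a = 0" by (auto simp: periodic_def)
    have "orb (i * k) a = 0" for k
    proof (induction k)
      case (Suc k)
      have "orb (i * Suc k) a = (Ta a ^^ i) (orb (i * k) a)"
        unfolding orb_def by (simp add: funpow_add)
      then show ?case using Suc i(3) by (simp add: orb_def)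
    qed (simp add: orb_def)
    then have "orb (i * j0) a = 0" .
    moreover have "j0 \<le> i * j0" using i(2) by simp
    then have "i * j0 = j0 + (i * j0 - j0)" by simp
    ultimately have "orb (j0 + (i * j0 - j0)) a = 0" by simp
    then show "a \<in> (\<Union>n. {a\<in>{0..\<epsilon>}. orb (j0 + n) a = 0})" using i(1) by blast
  qed
  moreover have "countable (\<Union>n. {a\<in>{0..\<epsilon>}. orb (j0 + n) a = 0})"
  proof (rule countable_UN)
    show "countable {a\<in>{0..\<epsilon>}. orb (j0 + n) a = 0}" for n
      by (rule countable_finite[OF E.finite_level_set])
  qed simp
  ultimately show ?thesis by (rule countable_subset)
qed

text \<open>At a nonperiodic parameter finitely many orbit points are nonzero, and Lipschitz
  dependence keeps each at half its modulus, with its sign, on a small interval.\<close>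

lemma turn_uniform:
  assumes a0: "a0 \<in> {0..\<epsilon>}" "a0 \<notin> periodic"
  obtains \<kappa> h where "0 < \<kappa>" "0 < h"
    "\<And>a i. a \<in> {0..\<epsilon>} \<Longrightarrow> \<bar>a - a0\<bar> \<le> h \<Longrightarrow> 1 \<le> i \<Longrightarrow> i \<le> N \<Longrightarrow> \<kappa> \<le> \<bar>orb i a\<bar> \<and> (0 \<le> orb i a \<longleftrightarrow> 0 \<le> orb i a0)"
proof -
  have "\<exists>\<kappa>>0. \<exists>h>0. \<forall>a i. a \<in> {0..\<epsilon>} \<longrightarrow> \<bar>a - a0\<bar> \<le> h \<longrightarrow> 1 \<le> i \<longrightarrow> i \<le> N \<longrightarrow> \<kappa> \<le> \<bar>orb i a\<bar> \<and> (0 \<le> orb i a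
      \<longleftrightarrow> 0 \<le> orb i a0)"
  proof (induction N)
    case 0
    show ?case by (rule exI[of _ 1], rule conjI, simp, rule exI[of _ 1], auto)
  next
    case (Suc N)
    then obtain \<kappa> h where IH: "0 < \<kappa>" "0 < h"
      "\<And>a i. a \<in> {0..\<epsilon>} \<Longrightarrow> \<bar>a - a0\<bar> \<le> h \<Longrightarrow> 1 \<le> i \<Longrightarrow> i \<le> N \<Longrightarrow> \<kappa> \<le> \<bar>orb i a\<bar> \<and> (0 \<le> orb i a \<longleftrightarrow> 0
          \<le> orb i a0)"
      by metis
    define v where "v = \<bar>orb (Suc N) a0\<bar>"
    have "orb (Suc N) a0 \<noteq> 0"
    proof
      assume "orb (Suc N) a0 = 0"
      then have "a0 \<in> periodic" using a0(1) unfolding periodic_def by (intro CollectI conjI exI[of _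
          "Suc N"]) simp_all
      then show False using a0(2) by blast
    qed
    then have v: "0 < v" by (simp add: v_def)
    obtain C where C: "0 \<le> C" "\<And>a b. a \<in> {0..\<delta>} \<Longrightarrow> b \<in> {0..\<delta>} \<Longrightarrow> \<bar>orb (Suc N) a - orb (Suc N) b\<bar>
        \<le> C * \<bar>a - b\<bar>"
      using orb_lipschitz[of "Suc N"] by blast
    define h' where "h' = min h (v / (2 * (C + 1)))"
    have h': "0 < h'" using IH(2) v C(1) by (simp add: h'_def)
    have near: "\<bar>orb (Suc N) a - orb (Suc N) a0\<bar> \<le> v / 2" if a: "a \<in> {0..\<epsilon>}" "\<bar>a - a0\<bar> \<le> h'" for a
    proof -
      have "\<bar>orb (Suc N) a - orb (Suc N) a0\<bar> \<le> C * \<bar>a - a0\<bar>"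
          by (rule C(2)[OF \<epsilon>_sub[OF a(1)] \<epsilon>_sub[OF a0(1)]])
      also have "\<dots> \<le> (C + 1) * (v / (2 * (C + 1)))"
        using a(2) C(1) by (intro mult_mono) (auto simp: h'_def)
      also have "\<dots> = v / 2"
      proof -
        have "d * (v / (2 * d)) = v / 2" if "0 < d" for d using that by simp
        from this[of "C + 1"] show ?thesis using C(1) by linarith
      qed
      finally show ?thesis .
    qed
    have both: "min \<kappa> (v / 2) \<le> \<bar>orb i a\<bar> \<and> (0 \<le> orb i a \<longleftrightarrow> 0 \<le> orb i a0)"
      if a: "a \<in> {0..\<epsilon>}" "\<bar>a - a0\<bar> \<le> h'" and i: "1 \<le> i" "i \<le> Suc N" for a i
    proof (cases "i = Suc N")
      case True
      have m: "min \<kappa> (v / 2) \<le> v / 2" by simp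
      show ?thesis unfolding True
      proof (intro conjI iffI)
        show "min \<kappa> (v / 2) \<le> \<bar>orb (Suc N) a\<bar>" using near[OF a] m v unfolding v_def by linarith
        show "0 \<le> orb (Suc N) a0" if "0 \<le> orb (Suc N) a" using that near[OF a] v unfolding v_def
            by linarith
        show "0 \<le> orb (Suc N) a" if "0 \<le> orb (Suc N) a0" using that near[OF a] v unfolding v_def
            by linarith
      qed
    next
      case False
      then have iN: "i \<le> N" using i by simp
      have "\<bar>a - a0\<bar> \<le> h" using a(2) by (simp add: h'_def)
      from IH(3)[OF a(1) this i(1) iN] show ?thesis by (auto intro: min.coboundedI1)
    qed
    have pos: "0 < min \<kappa> (v / 2)" using IH(1) v by simp
    show ?case
      by (rule exI[of _ "min \<kappa> (v / 2)"], rule conjI[OF pos], rule exI[of _ h'], rule conjI[OF h'])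
        (intro allI impI both)
  qed
  then show thesis using that by blast
qed

text \<open>The estimates start at time \<open>j0\<close>, and the initial terms change an average
  by at most j0 / n. Nonperiodicity of 0 also supplies uniqueness of the invariant measure for this
  map.\<close>

lemma typical_at:
  assumes a: "a \<in> {0..\<epsilon>}" "a \<notin> periodic" and C: "0 \<le> C"
    and avg: "\<And>(p::rat) (q::rat) m \<eta>. p < q \<Longrightarrow> 0 < \<eta> \<Longrightarrow>
      \<forall>\<^sub>F n in sequentially. (\<Sum>i<n. tent (of_rat p) (of_rat q) m (orb (j0 + i) a)) / real n
          \<le> C * (of_rat q - of_rat p) + \<eta>"
  shows "typical (Ta a) (acip (Ta a)) 0"
proof -
  have ad: "a \<in> {0..\<delta>}" by (rule \<epsilon>_sub[OF a(1)])
  interpret U: unimodal K L "Ta a" by (rule unimodal_Ta[OF ad])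
  interpret mixing_unimodal K L "Ta a" l
  proof
    show "1 < l" by (rule l)
    show "l \<le> \<bar>slope K (Ta a) s y\<bar>" if "y \<in> branch K s" for s y using sl_lower[OF ad that]
        by (simp add: sl_def)
    show "topologically_mixing_on {Ta a 1..1} (Ta a)" using mixing ad
        by (simp add: mixing_family_def)
    show "(Ta a ^^ i) 0 \<noteq> 0" if "1 \<le> i" for i using a that by (auto simp: periodic_def orb_def)
  qed
  show ?thesis
  proof (rule U.typical_criterion[OF acip_unique C])
    fix p q :: rat and m :: nat and \<eta> :: real assume pq: "p < q" and \<eta>: "0 < \<eta>"
    define f where "f = tent (of_rat p) (of_rat q) m"
    have f: "0 \<le> f y" "f y \<le> 1" for y by (simp_all add: f_def tent_nonneg tent_le_1)
    have "\<forall>\<^sub>F n in sequentially. real j0 / real n \<le> \<eta> / 2"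
    proof -
      have "(\<lambda>n. real j0 / real n) \<longlonglongrightarrow> 0" by real_asymp
      then have "\<forall>\<^sub>F n in sequentially. real j0 / real n < \<eta> / 2" using \<eta>
          by (intro order_tendstoD(2)) auto
      then show ?thesis by eventually_elim simp
    qed
    moreover have "\<forall>\<^sub>F n in sequentially. (\<Sum>i<n. f (orb (j0 + i) a)) / real n
        \<le> C * (of_rat q - of_rat p) + \<eta> / 2"
      unfolding f_def using pq \<eta> by (intro avg) auto
    ultimately show "\<forall>\<^sub>F n in sequentially. U.orbit_average (tent (of_rat p) (of_rat q) m) n
        \<le> C * (of_rat q - of_rat p) + \<eta>"
    proof eventually_elim
      case (elim n)
      have "(\<Sum>i<n. f (orb i a)) \<le> (\<Sum>i<j0 + n. f (orb i a))" using f by (intro sum_mono2) auto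
      also have "\<dots> = (\<Sum>i<j0. f (orb i a)) + (\<Sum>i<n. f (orb (i + j0) a))"
          by (rule sum_lessThan_add_split)
      also have "(\<Sum>i<j0. f (orb i a)) \<le> (\<Sum>i<j0. 1)" by (intro sum_mono f)
      finally have "(\<Sum>i<n. f (orb i a)) \<le> real j0 + (\<Sum>i<n. f (orb (j0 + i) a))"
          by (simp add: add.commute)
      then have "(\<Sum>i<n. f (orb i a)) / real n
          \<le> real j0 / real n + (\<Sum>i<n. f (orb (j0 + i) a)) / real n"
        by (simp add: divide_right_mono add_divide_distrib[symmetric])
      then have "(\<Sum>i<n. f (orb i a)) / real n \<le> C * (of_rat q - of_rat p) + \<eta>" using elim
          by linarith
      then show ?case by (simp add: U.orbit_average_def f_def orb_def)
    qed
  qed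
qed

text \<open>With \<open>N\<close> fixed by the expansion rate, \<open>turn_uniform\<close> supplies
  \<open>\<kappa>\<close> and an interval around \<open>a0\<close> forming an
  \<open>expanding_family\<close>. The exceptional sets for all rational tents form a countable
  union.\<close>

lemma AE_typical_near:
  assumes a0: "a0 \<in> {0..\<epsilon>}" "a0 \<notin> periodic"
  obtains h where "0 < h" "AE a in lborel. a \<in> {0..\<epsilon>} \<and> \<bar>a - a0\<bar> \<le> h \<and> a \<notin> periodic
      \<longrightarrow> typical (Ta a) (acip (Ta a)) 0"
proof -
  define lam where "lam = l - S / Q"
  have lam: "1 < lam" using SQ by (simp add: lam_def)
  obtain N0 where N0: "4 < lam ^ N0" using real_arch_pow[OF lam] by blast
  define N where "N = Suc N0"
  have "lam ^ N0 \<le> lam ^ N" using lam by (intro power_increasing) (auto simp: N_def)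
  then have N: "4 \<le> lam ^ N" "1 \<le> N" using N0 by (auto simp: N_def simp del: power_Suc)
  obtain \<kappa> h where \<kappa>: "0 < \<kappa>" and h: "0 < h" and
    turn: "\<And>a i. a \<in> {0..\<epsilon>} \<Longrightarrow> \<bar>a - a0\<bar> \<le> h \<Longrightarrow> 1 \<le> i \<Longrightarrow> i \<le> N \<Longrightarrow> \<kappa> \<le> \<bar>orb i a\<bar> \<and> (0 \<le> orb i a \<longleftrightarrow> 0
        \<le> orb i a0)"
    by (rule turn_uniform[OF a0, of N]) blast
  define lo where "lo = max 0 (a0 - h)"
  define hi where "hi = min \<epsilon> (a0 + h)"
  have lohi: "0 \<le> lo" "lo \<le> hi" "hi \<le> \<epsilon>" using a0(1) h by (auto simp: lo_def hi_def)
  have inI: "a \<in> {lo..hi} \<longleftrightarrow> a \<in> {0..\<epsilon>} \<and> \<bar>a - a0\<bar> \<le> h" for a by (auto simp: lo_def hi_def)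
  interpret E0: expanding_orbits K L l M S Q Q' lam lo hi Ta sl "\<lambda>n. orb (j0 + n)"
    unfolding lam_def by (rule orbits[OF lohi])
  interpret E: expanding_family K L l M S Q Q' lam lo hi Ta sl "\<lambda>n. orb (j0 + n)" \<kappa> N
  proof
    show "(Ta a ^^ i) 0 \<in> {-K..1}" if "a \<in> {lo..hi}" for a i
      using orb_range[of a i] \<epsilon>_sub that inI unfolding orb_def by blast
    show "\<kappa> \<le> \<bar>(Ta a ^^ i) 0\<bar>" if "a \<in> {lo..hi}" "1 \<le> i" "i \<le> N" for a i
      using turn[of a i] that inI unfolding orb_def by blast
    show "(0 \<le> (Ta a ^^ i) 0) = (0 \<le> (Ta b ^^ i) 0)" if "a \<in> {lo..hi}" "b \<in> {lo..hi}" "1 \<le> i" "i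
        \<le> N" for a b i
      using turn[of a i] turn[of b i] that inI unfolding orb_def by blast
  qed (use \<kappa> N in auto)
  have "AE a in lborel. a \<in> {lo..hi} \<longrightarrow> (\<forall>\<eta>>0. \<forall>\<^sub>F n in sequentially.
      (\<Sum>i<n. tent (of_rat p) (of_rat q) m (orb (j0 + i) a)) / real n
          \<le> 2 * E.growth_const * (of_rat q - of_rat p) + \<eta>)"
    if "p < q" for p q :: rat and m
  proof (rule E.AE_average_le[OF tent_nonneg tent_le_1 tent_lipschitz _ tent_measurable])
    have "(of_rat p :: real) < of_rat q" using that by (simp only: of_rat_less)
    then show "0 \<le> of_rat q - (of_rat p :: real)"
      "(\<integral>\<^sup>+ y. ennreal (tent (of_rat p) (of_rat q) m y) \<partial>lborel) \<le> ennreal (of_rat q - of_rat p)"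
      by (auto intro!: nn_integral_tent_le)
  qed simp
  then have "AE a in lborel. \<forall>p q m. p < q \<longrightarrow> a \<in> {lo..hi} \<longrightarrow> (\<forall>\<eta>>0. \<forall>\<^sub>F n in sequentially.
      (\<Sum>i<n. tent (of_rat (p::rat)) (of_rat (q::rat)) m (orb (j0 + i) a)) / real n
          \<le> 2 * E.growth_const * (of_rat q - of_rat p) + \<eta>)"
    unfolding AE_all_countable by auto
  then have "AE a in lborel. a \<in> {0..\<epsilon>} \<and> \<bar>a - a0\<bar> \<le> h \<and> a \<notin> periodic
      \<longrightarrow> typical (Ta a) (acip (Ta a)) 0"
  proof eventually_elim
    case (elim a)
    show ?case
    proof
      assume a: "a \<in> {0..\<epsilon>} \<and> \<bar>a - a0\<bar> \<le> h \<and> a \<notin> periodic"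
      then have aI: "a \<in> {lo..hi}" using inI by blast
      show "typical (Ta a) (acip (Ta a)) 0"
      proof (rule typical_at)
        show "a \<in> {0..\<epsilon>}" "a \<notin> periodic" using a by blast+
        show "0 \<le> 2 * E.growth_const" using E.growth_const_pos by simp
        show "\<forall>\<^sub>F n in sequentially. (\<Sum>i<n. tent (of_rat p) (of_rat q) m (orb (j0 + i) a)) / real n
            \<le> 2 * E.growth_const * (of_rat q - of_rat p) + \<eta>" if "p < q" "0 < \<eta>" for p q :: rat
                and m \<eta>
          using elim that aI by blast
      qed
    qed
  qed
  then show thesis using h that by blast
qed

text \<open>The neighbourhood and the constants depend on \<open>a0\<close>, so the exceptional set
  is first found to be locally negligible, which implies negligible.\<close>

theorem AE_typical: "AE a\<in>{0..\<epsilon>} in lborel. typical (Ta a) (acip (Ta a)) 0"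
proof -
  define B where "B = {a \<in> {0..\<epsilon>} - periodic. \<not> typical (Ta a) (acip (Ta a)) 0}"
  have "negligible B"
  proof (rule locally_negligible_alt[THEN iffD2], rule ballI)
    fix a0 assume a0: "a0 \<in> B"
    have a0': "a0 \<in> {0..\<epsilon>}" "a0 \<notin> periodic" using a0 unfolding B_def by blast+
    obtain h where h: "0 < h" "AE a in lborel. a \<in> {0..\<epsilon>} \<and> \<bar>a - a0\<bar> \<le> h \<and> a \<notin> periodic
        \<longrightarrow> typical (Ta a) (acip (Ta a)) 0"
      by (rule AE_typical_near[OF a0'])
    from AE_E[OF h(2)] obtain Z where Z: "{a \<in> space lborel. \<not> (a \<in> {0..\<epsilon>} \<and> \<bar>a - a0\<bar> \<le> h
        \<and> a \<notin> periodic \<longrightarrow> typical (Ta a) (acip (Ta a)) 0)} \<subseteq> Z"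
      "emeasure lborel Z = 0" "Z \<in> sets lborel" .
    have "negligible Z" using Z(2,3) by (simp add: negligible_iff_emeasure0 emeasure_completion)
    moreover have "B \<inter> ball a0 h \<subseteq> Z"
    proof
      fix a assume "a \<in> B \<inter> ball a0 h"
      then have "a \<in> {0..\<epsilon>}" "a \<notin> periodic" "\<not> typical (Ta a) (acip (Ta a)) 0" "\<bar>a - a0\<bar> \<le> h"
        by (simp_all add: B_def dist_real_def abs_minus_commute)
      then have "a \<in> {a \<in> space lborel. \<not> (a \<in> {0..\<epsilon>} \<and> \<bar>a - a0\<bar> \<le> h \<and> a \<notin> periodic
          \<longrightarrow> typical (Ta a) (acip (Ta a)) 0)}"
        by simp
      then show "a \<in> Z" using Z(1) by blast
    qed
    ultimately have "negligible (B \<inter> ball a0 h)" by (rule negligible_subset)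
    then show "\<exists>U. openin (top_of_set B) U \<and> a0 \<in> U \<and> negligible U"
      using a0 h(1) by (intro exI[of _ "B \<inter> ball a0 h"] conjI openin_open_Int) simp_all
  qed
  moreover have "negligible periodic" unfolding negligible_iff_null_sets
    by (rule null_sets_completionI[OF countable_imp_null_set_lborel[OF countable_periodic]])
  ultimately have "negligible (B \<union> periodic)" by (rule negligible_Un)
  then have "AE a in lebesgue. a \<notin> B \<union> periodic"
    by (intro AE_not_in) (simp add: negligible_iff_null_sets)
  then have "AE a in lborel. a \<notin> B \<union> periodic" by (simp only: AE_completion_iff)
  then show ?thesis by (rule eventually_mono) (unfold B_def, blast)
qed

end

section \<open>Existence of a transversal parameter interval\<close>

context unimodal_family
begin

text \<open>Uniformity in \<open>y\<close> comes from a finite net: quotients at net points are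
  within \<open>\<tau>\<close> of the derivative bound, and \<open>second_difference\<close> carries
  them to nearby points at the cost of another \<open>\<tau>\<close>. Points of
  \<open>{Ta c 1..1}\<close> below \<open>Ta 0 1\<close> are compared with
  \<open>Ta 0 1\<close>.\<close>

lemma param_quotient_le:
  assumes S: "(SUP y\<in>{Ta 0 1..1}. \<bar>g y\<bar>) < S"
  obtains r where "0 < r" "r \<le> \<delta>"
    "\<And>a b c y. a \<in> {0..r} \<Longrightarrow> b \<in> {0..r} \<Longrightarrow> c \<in> {0..r} \<Longrightarrow> y \<in> {Ta c 1..1} \<Longrightarrow> \<bar>Ta a y - Ta b y\<bar>
        \<le> S * \<bar>a - b\<bar>"
proof -
  have I0: "0 \<in> {0..\<delta>}" using \<delta> by simp
  define X where "X = {Ta 0 1..1}"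
  have X: "X \<subseteq> {-K..1}" unfolding X_def by (rule unimodal.X_subset[OF unimodal_Ta[OF I0]])
  have one: "Ta 0 1 \<in> X" unfolding X_def using unimodal.T_1_neg[OF unimodal_Ta[OF I0]] by simp
  define S0 where "S0 = (SUP y\<in>X. \<bar>g y\<bar>)"
  have gS: "\<bar>g y\<bar> \<le> S0" if "y \<in> X" for y
    unfolding S0_def using that g_bound X by (intro cSUP_upper bdd_aboveI2[where M=L]) auto
  define \<tau> where "\<tau> = (S - S0) / 3"
  have \<tau>: "0 < \<tau>" using S by (simp add: \<tau>_def S0_def X_def)
  have "\<exists>k. finite k \<and> k \<subseteq> X \<and> X \<subseteq> (\<Union>z\<in>k. ball z (\<tau> / L))"
    using seq_compact_imp_totally_bounded[of X] \<tau> L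
        by (simp add: X_def compact_eq_seq_compact_metric[symmetric])
  then obtain k where k: "finite k" "k \<subseteq> X" "X \<subseteq> (\<Union>z\<in>k. ball z (\<tau> / L))" by blast
  have "\<exists>r>0. \<forall>a\<in>{0..r}. \<forall>b\<in>{0..r}. \<bar>Ta a z - Ta b z\<bar> \<le> (S0 + \<tau>) * \<bar>a - b\<bar>" if z: "z \<in> X" for z
  proof -
    have "z \<in> {-K..1}" using z X by blast
    then obtain r where r: "0 < r" "\<And>a b. a \<in> {0..r} \<Longrightarrow> b \<in> {0..r}
        \<Longrightarrow> \<bar>Ta a z - Ta b z - g z * (a - b)\<bar> \<le> \<tau> * \<bar>a - b\<bar>"
      using strict_deriv0D[OF param_strict_deriv \<tau>] by metis
    have "\<bar>Ta a z - Ta b z\<bar> \<le> (S0 + \<tau>) * \<bar>a - b\<bar>" if "a \<in> {0..r}" "b \<in> {0..r}" for a b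
    proof -
      have "\<bar>g z * (a - b)\<bar> \<le> S0 * \<bar>a - b\<bar>" unfolding abs_mult
          by (rule mult_right_mono[OF gS[OF z]]) simp
      then show ?thesis using r(2)[OF that] unfolding distrib_right by linarith
    qed
    then show ?thesis using r(1) by blast
  qed
  then obtain \<rho> where \<rho>: "\<And>z. z \<in> X \<Longrightarrow> 0 < \<rho> z"
    "\<And>z a b. z \<in> X \<Longrightarrow> a \<in> {0..\<rho> z} \<Longrightarrow> b \<in> {0..\<rho> z} \<Longrightarrow> \<bar>Ta a z - Ta b z\<bar> \<le> (S0 + \<tau>) * \<bar>a - b\<bar>"
    by metis
  \<comment> \<open>A point of \<open>{Ta c 1..1}\<close> outside \<open>X\<close> is within
    \<open>L * r\<close> of \<open>Ta 0 1\<close>; the entry with \<open>L\<close> squared turns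
    this into a transfer error of at most \<open>\<tau>\<close>.\<close>
  define r where "r = Min (insert \<delta> (insert (\<tau> / L\<^sup>2) (insert (\<rho> (Ta 0 1)) (\<rho> ` k))))"
  have r: "0 < r" unfolding r_def using k(1,2) \<delta> \<tau> L \<rho>(1) one by (subst Min_gr_iff) auto
  have r_le: "r \<le> \<delta>" "r \<le> \<tau> / L\<^sup>2" "r \<le> \<rho> (Ta 0 1)" "\<And>z. z \<in> k \<Longrightarrow> r \<le> \<rho> z"
    unfolding r_def using k(1) by (intro Min_le; simp)+
  have S_eq: "S = S0 + \<tau> + \<tau> + \<tau>" by (simp add: \<tau>_def field_simps)
  show thesis
  proof (rule that[OF r r_le(1)])
    fix a b c y assume a: "a \<in> {0..r}" and b: "b \<in> {0..r}" and c: "c \<in> {0..r}" and y: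
        "y \<in> {Ta c 1..1}"
    have ad: "a \<in> {0..\<delta>}" "b \<in> {0..\<delta>}" "c \<in> {0..\<delta>}" using a b c r_le(1) by auto
    have yK: "y \<in> {-K..1}" using y unimodal.X_subset[OF unimodal_Ta[OF ad(3)]] by blast
    have "\<exists>z\<in>X. r \<le> \<rho> z \<and> L * \<bar>y - z\<bar> \<le> \<tau>"
    proof (cases "y \<in> X")
      case True
      then obtain z where z: "z \<in> k" "dist z y < \<tau> / L" using k(3) by auto
      then have "L * \<bar>y - z\<bar> \<le> \<tau>" using L
          by (simp add: dist_real_def abs_minus_commute pos_less_divide_eq mult.commute)
      then show ?thesis using z(1) k(2) r_le(4) by blast
    next
      case False
      then have "\<bar>y - Ta 0 1\<bar> \<le> \<bar>Ta c 1 - Ta 0 1\<bar>" using y by (auto simp: X_def)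
      also have "\<dots> \<le> L * \<bar>c - 0\<bar>" using K by (intro Ta_param_lipschitz ad I0) auto
      also have "\<dots> \<le> L * r" using c L by (intro mult_left_mono) auto
      finally have "L * \<bar>y - Ta 0 1\<bar> \<le> L * (L * r)" using L by (intro mult_left_mono) auto
      also have "L * (L * r) = L\<^sup>2 * r" by (simp add: power2_eq_square)
      also have "\<dots> \<le> L\<^sup>2 * (\<tau> / L\<^sup>2)" using r_le(2) by (intro mult_left_mono) auto
      also have "\<dots> = \<tau>" using L by simp
      finally show ?thesis using one r_le(3) by blast
    qed
    then obtain z where z: "z \<in> X" "r \<le> \<rho> z" "L * \<bar>y - z\<bar> \<le> \<tau>" by blast
    have zK: "z \<in> {-K..1}" using z(1) X by blast
    have "\<bar>Ta a z - Ta b z\<bar> \<le> (S0 + \<tau>) * \<bar>a - b\<bar>" using a b z(2) by (intro \<rho>(2)[OF z(1)]) auto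
    moreover have "\<bar>(Ta a y - Ta b y) - (Ta a z - Ta b z)\<bar> \<le> L * \<bar>a - b\<bar> * \<bar>y - z\<bar>"
      by (rule second_difference[OF ad(1,2) yK zK])
    moreover have "L * \<bar>a - b\<bar> * \<bar>y - z\<bar> \<le> \<tau> * \<bar>a - b\<bar>"
    proof -
      have "(L * \<bar>y - z\<bar>) * \<bar>a - b\<bar> \<le> \<tau> * \<bar>a - b\<bar>" using z(3) by (rule mult_right_mono) simp
      then show ?thesis by (simp only: mult_ac)
    qed
    moreover have "0 \<le> \<tau> * \<bar>a - b\<bar>" using \<tau> by simp
    ultimately show "\<bar>Ta a y - Ta b y\<bar> \<le> S * \<bar>a - b\<bar>" unfolding S_eq distrib_right by linarith
  qed
qed

text \<open>Once the derivative of \<open>T\<^sub>a\<^sup>j(0)\<close> exceeds \<open>S / (l - 1)\<close>, the recursion \<open>D \<ge> l D - S\<close> makes it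
    grow
  exponentially; this is what \<open>Lambda0\<close> is for.\<close>

lemma transversal:
  assumes D: "((\<lambda>a. (Ta a ^^ j0) 0) has_real_derivative D) (at 0 within {0..\<delta>})"
    and big: "(SUP y\<in>{Ta 0 1..1}. \<bar>g y\<bar>) / (l - 1) < \<bar>D\<bar>" and j0: "1 \<le> j0"
  obtains \<epsilon> S Q Q' where "transversal_family K L \<delta> l T Ta j0 \<epsilon> S Q Q'"
proof -
  define S0 where "S0 = (SUP y\<in>{Ta 0 1..1}. \<bar>g y\<bar>)"
  have I0: "0 \<in> {0..\<delta>}" using \<delta> by simp
  have S0: "0 \<le> S0"
  proof -
    have "1 \<in> {Ta 0 1..1}" using unimodal.T_1_neg[OF unimodal_Ta[OF I0]] by simp
    then show ?thesis unfolding S0_def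
      using g_bound unimodal.X_subset[OF unimodal_Ta[OF I0]]
      by (intro cSUP_upper2[where x=1] bdd_aboveI2[where M=L]) auto
  qed
  obtain D' where D': "strict_deriv0 (orb j0) D'" using orb_strict_deriv by blast
  have DD': "D' = D"
    by (rule has_derivative_unique_right[OF strict_deriv0_imp_has_derivative[OF D' \<delta>] _ \<delta>])
      (use D in \<open>simp add: orb_def[abs_def]\<close>)
  \<comment> \<open>Halfway between the threshold and \<open>|D|\<close>: below \<open>|D|\<close>,
    so that quotients near 0 stay above \<open>Q\<close>, and above the threshold, so that there is
    room for \<open>S\<close>.\<close>
  define Q where "Q = (\<bar>D\<bar> + S0 / (l - 1)) / 2"
  have b: "S0 / (l - 1) < \<bar>D\<bar>" using big unfolding S0_def .
  have mid: "u < (v + u) / 2 \<and> (v + u) / 2 < v" if "u < v" for u v :: real using that by simp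
  have Q: "S0 / (l - 1) < Q" "Q < \<bar>D\<bar>" using mid[OF b] unfolding Q_def by blast+
  have Q0: "0 < Q" using Q(1) S0 l by (meson divide_nonneg_pos diff_gt_0_iff_gt le_less_trans)
  \<comment> \<open>Strictly above \<open>S0\<close>, as \<open>param_quotient_le\<close> requires,
    and strictly below \<open>Q * (l - 1)\<close>, which is the condition
    \<open>S / Q < l - 1\<close> for expansion in the parameter.\<close>
  define S where "S = (S0 + Q * (l - 1)) / 2"
  have S: "S0 < S" "S < Q * (l - 1)" using Q(1) l by (auto simp: S_def pos_divide_less_eq)
  have SQ: "S / Q < l - 1" using S(2) Q0 by (simp add: pos_divide_less_eq mult.commute)
  obtain r1 where r1: "0 < r1" "r1 \<le> \<delta>" "\<And>a b c y. a \<in> {0..r1} \<Longrightarrow> b \<in> {0..r1} \<Longrightarrow> c \<in> {0..r1}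
      \<Longrightarrow> y \<in> {Ta c 1..1} \<Longrightarrow> \<bar>Ta a y - Ta b y\<bar> \<le> S * \<bar>a - b\<bar>"
    using param_quotient_le[of S] S(1) unfolding S0_def by metis
  have "0 < \<bar>D\<bar> - Q" using Q(2) by simp
  then obtain r2 where r2: "0 < r2" "\<And>a b. a \<in> {0..r2} \<Longrightarrow> b \<in> {0..r2}
      \<Longrightarrow> \<bar>orb j0 a - orb j0 b - D * (a - b)\<bar> \<le> (\<bar>D\<bar> - Q) * \<bar>a - b\<bar>"
    using strict_deriv0D[OF D'] unfolding DD' by metis
  define \<epsilon> where "\<epsilon> = min r1 r2"
  have \<epsilon>: "0 < \<epsilon>" "\<epsilon> \<le> \<delta>" "\<epsilon> \<le> r1" "\<epsilon> \<le> r2" using r1(1,2) r2(1) by (auto simp: \<epsilon>_def)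
  have two: "Q * \<bar>a - b\<bar> \<le> \<bar>orb j0 a - orb j0 b\<bar> \<and> \<bar>orb j0 a - orb j0 b\<bar> \<le> (2 * \<bar>D\<bar>) * \<bar>a - b\<bar>"
    if "a \<in> {0..\<epsilon>}" "b \<in> {0..\<epsilon>}" for a b
  proof -
    have "\<bar>orb j0 a - orb j0 b - D * (a - b)\<bar> \<le> (\<bar>D\<bar> - Q) * \<bar>a - b\<bar>" using that \<epsilon>(4)
        by (intro r2(2)) auto
    moreover have "\<bar>D * (a - b)\<bar> = \<bar>D\<bar> * \<bar>a - b\<bar>" by (rule abs_mult)
    moreover have "0 \<le> Q * \<bar>a - b\<bar>" using Q0 by simp
    ultimately show ?thesis unfolding left_diff_distrib mult.assoc by linarith
  qed
  have "transversal_family K L \<delta> l T Ta j0 \<epsilon> S Q (2 * \<bar>D\<bar>)"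
  proof
    show "\<bar>Ta a y - Ta b y\<bar> \<le> S * \<bar>a - b\<bar>" if "a \<in> {0..\<epsilon>}" "b \<in> {0..\<epsilon>}" "c \<in> {0..\<epsilon>}"
        "y \<in> {Ta c 1..1}" for a b c y
      using that \<epsilon>(3) by (intro r1(3)[of a b c]) auto
    show "Q * \<bar>a - b\<bar> \<le> \<bar>orb j0 a - orb j0 b\<bar>" "\<bar>orb j0 a - orb j0 b\<bar> \<le> 2 * \<bar>D\<bar> * \<bar>a - b\<bar>"
      if "a \<in> {0..\<epsilon>}" "b \<in> {0..\<epsilon>}" for a b
      using two[OF that] by blast+
  qed (use j0 \<epsilon> S0 S Q0 Q SQ in auto)
  then show thesis by (rule that)
qed

end

theorem theorem6p2:
  fixes K L \<delta> l :: real
    and T :: "real \<Rightarrow> real"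
    and Ta :: "real \<Rightarrow> real \<Rightarrow> real"
  assumes "K > 0" and "L > 0" and "\<delta> > 0"
    and "T \<in> unimodal_maps K L"
    and "one_parameter_family K L \<delta> T Ta"
    and "mixing_family \<delta> Ta"
    and "l > 1"
    and "expansion_bound K \<delta> Ta l"
    and "\<exists>j0\<ge>3. \<exists>D. ((\<lambda>a. (Ta a ^^ j0) 0) has_real_derivative D) (at 0 within {0..\<delta>}) \<and>
           \<bar>D\<bar> > Lambda0 \<delta> T Ta l"
  shows "\<exists>\<epsilon>. 0 < \<epsilon> \<and> \<epsilon> \<le> \<delta> \<and>
           (AE a\<in>{0..\<epsilon>} in lborel. typical (Ta a) (acip (Ta a)) 0)"
proof -
  interpret unimodal_family K L \<delta> l T Ta
    by standard (use assms in auto)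
  obtain j0 D where j0: "3 \<le> j0" and D: "((\<lambda>a. (Ta a ^^ j0) 0) has_real_derivative D) (at 0 within
      {0..\<delta>})"
    and big: "Lambda0 \<delta> T Ta l < \<bar>D\<bar>"
    using assms(9) by blast
  have "T 1 = Ta 0 1" using assms(1,5) by (simp add: one_parameter_family_def)
  then have "(SUP y\<in>{Ta 0 1..1}. \<bar>g y\<bar>) / (l - 1) < \<bar>D\<bar>" using big by (simp add: Lambda0_def g_def)
  moreover have "1 \<le> j0" using j0 by simp
  ultimately obtain \<epsilon> S Q Q' where "transversal_family K L \<delta> l T Ta j0 \<epsilon> S Q Q'"
    using transversal[OF D] by blast
  then interpret transversal_family K L \<delta> l T Ta j0 \<epsilon> S Q Q' .
  show ?thesis using \<epsilon> AE_typical by blast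
qed

end
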